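(* Let $T$ be a complete first-order theory with monster model $\mathbb{M}$, and let $\kappa,\kappa'$ be cardinals such that $2^{|T|}<\kappa<\kappa'$ and $\mathrm{cf}(\kappa)=\kappa$. The following are equivalent. (1) $T$ is NATP. (2) For every strongly indiscernible tree $(a_\eta)_{\eta\in 2^{<\kappa'}}$ in $\mathbb{M}$ and every finite tuple $b$ in $\mathbb{M}$, there are $\rho\in 2^\kappa$ and $b'$ such that (a) the sequence $(a_{\rho^\frown 0^i})_{i<\kappa'}$ is indiscernible over $b'$, and (b) $b\equiv_{a_\rho}b'$ (that is, $\mathrm{tp}(b/a_\rho)=\mathrm{tp}(b'/a_\rho)$).
   Context: $|T|$ is the number of formulas of the language of $T$ (at least $\aleph_0$). $2^{\kappa}$ is the set of functions $\kappa\to 2$ and $2^{<\kappa'}=\bigcup_{\alpha<\kappa'}2^\alpha$ (union over ordinals $\alpha<\kappa'$). $\eta\trianglelefteq\nu$ means $\eta\subseteq\nu$; $\eta\wedge\nu$ is the largest common initial segment; $\eta<_{lex}\nu$ means $\eta\trianglelefteq\nu$, or $\eta,\nu$ are incomparable and $\eta(l)<\nu(l)$ where $l$ is the domain of $\eta\wedge\nu$. ${}^\frown$ is concatenation and $0^i$ is the constant zero sequence of length $i$. The tree is viewed as a structure in the language $\mathcal{L}_0=\{\trianglelefteq,<_{lex},\wedge\}$ ($\wedge$ a binary function symbol). The parameters $a_\eta$ are finite tuples of $\mathbb{M}$, all of the same length. A tree $(a_\eta)$ is strongly indiscernible if for all finite tuples $\bar\eta=(\eta_0,\dots,\eta_n),\bar\nu=(\nu_0,\dots,\nu_n)$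 of indices with the same quantifier-free $\mathcal{L}_0$-type, $\mathrm{tp}(a_{\eta_0}\dots a_{\eta_n})=\mathrm{tp}(a_{\nu_0}\dots a_{\nu_n})$. A formula $\varphi(x,y)$ has ATP if there is a family $(c_\eta)_{\eta\in 2^{<\omega}}$ of parameters such that $\{\varphi(x,c_\eta):\eta\in X\}$ is consistent for every antichain (set of pairwise $\trianglelefteq$-incomparable elements) $X\subseteq 2^{<\omega}$, and $\{\varphi(x,c_\eta),\varphi(x,c_\nu)\}$ is inconsistent whenever $\eta\trianglelefteq\nu$, $\eta\ne\nu$. $T$ has ATP if some formula has ATP; otherwise $T$ is NATP. *)

theory Defs
  imports Main
begin

unbundle cardinal_syntax

section \<open>First-order logic\<close>

text \<open>
  A language is given by two partial arity functions; the symbols of the language are the elements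
  of their domains.  The variables are the natural numbers.
\<close>

record ('f, 'r) lang =
  fun_ar :: "'f \<Rightarrow> nat option"
  rel_ar :: "'r \<Rightarrow> nat option"

datatype 'f tm = Var nat | Fun 'f "'f tm list"

datatype ('f, 'r) fm =
    Eq "'f tm" "'f tm"
  | Rel 'r "'f tm list"
  | Neg "('f, 'r) fm"
  | Conj "('f, 'r) fm" "('f, 'r) fm"
  | Ex nat "('f, 'r) fm"

fun wf_tm :: "('f, 'r) lang \<Rightarrow> 'f tm \<Rightarrow> bool" where
  "wf_tm L (Var i) = True"
| "wf_tm L (Fun f ts) = (fun_ar L f = Some (length ts) \<and> (\<forall>t\<in>set ts. wf_tm L t))"

fun wf_fm :: "('f, 'r) lang \<Rightarrow> ('f, 'r) fm \<Rightarrow> bool" where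
  "wf_fm L (Eq s t) = (wf_tm L s \<and> wf_tm L t)"
| "wf_fm L (Rel R ts) = (rel_ar L R = Some (length ts) \<and> (\<forall>t\<in>set ts. wf_tm L t))"
| "wf_fm L (Neg \<phi>) = wf_fm L \<phi>"
| "wf_fm L (Conj \<phi> \<psi>) = (wf_fm L \<phi> \<and> wf_fm L \<psi>)"
| "wf_fm L (Ex i \<phi>) = wf_fm L \<phi>"

definition formulas :: "('f, 'r) lang \<Rightarrow> ('f, 'r) fm set" where
  "formulas L = {\<phi>. wf_fm L \<phi>}"

fun fv_tm :: "'f tm \<Rightarrow> nat set" where
  "fv_tm (Var i) = {i}"
| "fv_tm (Fun f ts) = (\<Union>t\<in>set ts. fv_tm t)"

fun fv :: "('f, 'r) fm \<Rightarrow> nat set" where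
  "fv (Eq s t) = fv_tm s \<union> fv_tm t"
| "fv (Rel R ts) = (\<Union>t\<in>set ts. fv_tm t)"
| "fv (Neg \<phi>) = fv \<phi>"
| "fv (Conj \<phi> \<psi>) = fv \<phi> \<union> fv \<psi>"
| "fv (Ex i \<phi>) = fv \<phi> - {i}"

definition sentences :: "('f, 'r) lang \<Rightarrow> ('f, 'r) fm set" where
  "sentences L = {\<phi> \<in> formulas L. fv \<phi> = {}}"

fun quantifier_free :: "('f, 'r) fm \<Rightarrow> bool" where
  "quantifier_free (Eq s t) = True"
| "quantifier_free (Rel R ts) = True"
| "quantifier_free (Neg \<phi>) = quantifier_free \<phi>"
| "quantifier_free (Conj \<phi> \<psi>) = (quantifier_free \<phi> \<and> quantifier_free \<psi>)"
| "quantifier_free (Ex i \<phi>) = False"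

record ('f, 'r, 'a) struct =
  univ :: "'a set"
  fun_int :: "'f \<Rightarrow> 'a list \<Rightarrow> 'a"
  rel_int :: "'r \<Rightarrow> 'a list \<Rightarrow> bool"

definition tuples :: "('f, 'r, 'a) struct \<Rightarrow> nat \<Rightarrow> 'a list set" where
  "tuples M n = {xs \<in> lists (univ M). length xs = n}"

definition is_struct :: "('f, 'r) lang \<Rightarrow> ('f, 'r, 'a) struct \<Rightarrow> bool" where
  "is_struct L M \<longleftrightarrow> univ M \<noteq> {} \<and>
     (\<forall>f n. fun_ar L f = Some n \<longrightarrow> (\<forall>xs\<in>tuples M n. fun_int M f xs \<in> univ M))"

fun tm_val :: "('f, 'r, 'a) struct \<Rightarrow> (nat \<Rightarrow> 'a) \<Rightarrow> 'f tm \<Rightarrow> 'a" where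
  "tm_val M v (Var i) = v i"
| "tm_val M v (Fun f ts) = fun_int M f (map (tm_val M v) ts)"

fun sat :: "('f, 'r, 'a) struct \<Rightarrow> (nat \<Rightarrow> 'a) \<Rightarrow> ('f, 'r) fm \<Rightarrow> bool" where
  "sat M v (Eq s t) = (tm_val M v s = tm_val M v t)"
| "sat M v (Rel R ts) = rel_int M R (map (tm_val M v) ts)"
| "sat M v (Neg \<phi>) = (\<not> sat M v \<phi>)"
| "sat M v (Conj \<phi> \<psi>) = (sat M v \<phi> \<and> sat M v \<psi>)"
| "sat M v (Ex i \<phi>) = (\<exists>x\<in>univ M. sat M (v(i := x)) \<phi>)"

text \<open>
  Satisfaction by a tuple: variable \<open>i\<close> denotes the \<open>i\<close>-th entry.  It is only used for formulas
  whose free variables are smaller than the length of the tuple, so that the value of \<open>!\<close> out of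
  bounds is irrelevant.
\<close>

definition holds :: "('f, 'r, 'a) struct \<Rightarrow> ('f, 'r) fm \<Rightarrow> 'a list \<Rightarrow> bool" where
  "holds M \<phi> xs \<longleftrightarrow> sat M (\<lambda>i. xs ! i) \<phi>"

definition is_model :: "('f, 'r) lang \<Rightarrow> ('f, 'r) fm set \<Rightarrow> ('f, 'r, 'a) struct \<Rightarrow> bool" where
  "is_model L T M \<longleftrightarrow> is_struct L M \<and> (\<forall>\<sigma>\<in>T. holds M \<sigma> [])"

text \<open>
  Only models with universe in the type of formulas are considered here.  By Loewenheim--Skolem
  this is no restriction: that type is infinite and has at least as many elements as there are
  formulas of \<open>L\<close>.
\<close>

definition entails :: "('f, 'r) lang \<Rightarrow> ('f, 'r) fm set \<Rightarrow> ('f, 'r) fm \<Rightarrow> bool" where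
  "entails L T \<sigma> \<longleftrightarrow>
     (\<forall>N :: ('f, 'r, ('f, 'r) fm) struct. is_model L T N \<longrightarrow> holds N \<sigma> [])"

definition complete_theory :: "('f, 'r) lang \<Rightarrow> ('f, 'r) fm set \<Rightarrow> bool" where
  "complete_theory L T \<longleftrightarrow> T \<subseteq> sentences L \<and>
     (\<exists>N :: ('f, 'r, ('f, 'r) fm) struct. is_model L T N) \<and>
     (\<forall>\<sigma>\<in>sentences L. entails L T \<sigma> \<or> entails L T (Neg \<sigma>))"


section \<open>Types, saturation, monster models\<close>

text \<open>
  A formula \<open>\<phi>(x\<^sub>0,\<dots>,x\<^sub>n\<^sub>-\<^sub>1, c)\<close> with parameters is a pair \<open>(\<phi>, c)\<close>: the first \<open>n\<close> variables of
  \<open>\<phi>\<close> are the object variables, the following ones stand for the entries of the tuple \<open>c\<close>.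
\<close>

definition formulas_over ::
  "('f, 'r) lang \<Rightarrow> nat \<Rightarrow> 'a set \<Rightarrow> (('f, 'r) fm \<times> 'a list) set" where
  "formulas_over L n A =
     {(\<phi>, c). \<phi> \<in> formulas L \<and> c \<in> lists A \<and> fv \<phi> \<subseteq> {..<n + length c}}"

definition realizes ::
  "('f, 'r, 'a) struct \<Rightarrow> 'a list \<Rightarrow> (('f, 'r) fm \<times> 'a list) set \<Rightarrow> bool" where
  "realizes M b p \<longleftrightarrow> (\<forall>(\<phi>, c)\<in>p. holds M \<phi> (b @ c))"

text \<open>
  A set of formulas over \<open>M\<close> is consistent (with the elementary diagram of \<open>M\<close>) if it is finitely
  satisfiable in \<open>M\<close>.
\<close>

definition consistent ::
  "('f, 'r, 'a) struct \<Rightarrow> nat \<Rightarrow> (('f, 'r) fm \<times> 'a list) set \<Rightarrow> bool" where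
  "consistent M n p \<longleftrightarrow> (\<forall>q\<subseteq>p. finite q \<longrightarrow> (\<exists>b\<in>tuples M n. realizes M b q))"

definition tp ::
  "('f, 'r) lang \<Rightarrow> ('f, 'r, 'a) struct \<Rightarrow> 'a list \<Rightarrow> 'a set \<Rightarrow> (('f, 'r) fm \<times> 'a list) set" where
  "tp L M b A = {(\<phi>, c) \<in> formulas_over L (length b) A. holds M \<phi> (b @ c)}"

definition qf_tp ::
  "('f, 'r) lang \<Rightarrow> ('f, 'r, 'a) struct \<Rightarrow> 'a list \<Rightarrow> ('f, 'r) fm set" where
  "qf_tp L M b =
     {\<phi> \<in> formulas L. quantifier_free \<phi> \<and> fv \<phi> \<subseteq> {..<length b} \<and> holds M \<phi> b}"

definition saturated ::
  "('f, 'r) lang \<Rightarrow> ('f, 'r, 'a) struct \<Rightarrow> 'l rel \<Rightarrow> bool" where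
  "saturated L M \<mu> \<longleftrightarrow>
     (\<forall>A\<subseteq>univ M. |A| <o \<mu> \<longrightarrow>
        (\<forall>n. \<forall>p\<subseteq>formulas_over L n A. consistent M n p \<longrightarrow> (\<exists>b\<in>tuples M n. realizes M b p)))"

definition partial_elementary ::
  "('f, 'r) lang \<Rightarrow> ('f, 'r, 'a) struct \<Rightarrow> 'a set \<Rightarrow> ('a \<Rightarrow> 'a) \<Rightarrow> bool" where
  "partial_elementary L M A g \<longleftrightarrow> g ` A \<subseteq> univ M \<and>
     (\<forall>\<phi>\<in>formulas L. \<forall>c\<in>lists A. fv \<phi> \<subseteq> {..<length c} \<longrightarrow>
        (holds M \<phi> c \<longleftrightarrow> holds M \<phi> (map g c)))"

definition automorphism ::
  "('f, 'r) lang \<Rightarrow> ('f, 'r, 'a) struct \<Rightarrow> ('a \<Rightarrow> 'a) \<Rightarrow> bool" where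
  "automorphism L M h \<longleftrightarrow> bij_betw h (univ M) (univ M) \<and>
     (\<forall>f n. fun_ar L f = Some n \<longrightarrow>
        (\<forall>xs\<in>tuples M n. h (fun_int M f xs) = fun_int M f (map h xs))) \<and>
     (\<forall>R n. rel_ar L R = Some n \<longrightarrow>
        (\<forall>xs\<in>tuples M n. rel_int M R xs \<longleftrightarrow> rel_int M R (map h xs)))"

definition strongly_homogeneous ::
  "('f, 'r) lang \<Rightarrow> ('f, 'r, 'a) struct \<Rightarrow> 'l rel \<Rightarrow> bool" where
  "strongly_homogeneous L M \<mu> \<longleftrightarrow>
     (\<forall>A\<subseteq>univ M. \<forall>g. |A| <o \<mu> \<and> partial_elementary L M A g \<longrightarrow>
        (\<exists>h. automorphism L M h \<and> (\<forall>x\<in>A. h x = g x)))"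

text \<open>The cardinal \<open>\<mu>\<close> bounds what counts as small; see the assumptions of the theorem.\<close>

definition monster_model ::
  "('f, 'r) lang \<Rightarrow> ('f, 'r) fm set \<Rightarrow> 'l rel \<Rightarrow> ('f, 'r, 'a) struct \<Rightarrow> bool" where
  "monster_model L T \<mu> M \<longleftrightarrow>
     is_model L T M \<and> saturated L M \<mu> \<and> strongly_homogeneous L M \<mu>"


section \<open>Trees of binary sequences of ordinal length\<close>

text \<open>
  Let \<open>r\<close> be a well-order of type \<open>\<kappa>\<close>.  The ordinals \<open>\<alpha> < \<kappa>\<close> are represented by the elements of
  \<open>Field r\<close>, and the ordinal \<open>\<alpha>\<close> as a set of ordinals by \<open>underS r \<alpha>\<close>.  A sequence in \<open>2\<^sup>\<alpha>\<close> is a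
  partial function with domain \<open>underS r \<alpha>\<close>, where \<open>False\<close> is \<open>0\<close> and \<open>True\<close> is \<open>1\<close>.  Inclusion
  of sequences is \<open>map_le\<close>.  For \<open>r = natLeq\<close> one gets the finite binary sequences.
\<close>

type_synonym 'o node = "'o \<Rightarrow> bool option"

definition tree :: "'o rel \<Rightarrow> 'o node set" where
  "tree r = {\<eta>. \<exists>\<alpha>\<in>Field r. dom \<eta> = underS r \<alpha>}"

text \<open>The sequences whose length is the order type of the well-order \<open>k\<close>.\<close>

definition level :: "'o rel \<Rightarrow> 'k rel \<Rightarrow> 'o node set" where
  "level r k = {\<eta> \<in> tree r. Restr r (dom \<eta>) =o k}"

definition meet :: "'o rel \<Rightarrow> 'o node \<Rightarrow> 'o node \<Rightarrow> 'o node" where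
  "meet r \<eta> \<nu> = \<eta> |` {x \<in> dom \<eta> \<inter> dom \<nu>. \<forall>y\<in>under r x. \<eta> y = \<nu> y}"

definition incomparable :: "'o node \<Rightarrow> 'o node \<Rightarrow> bool" where
  "incomparable \<eta> \<nu> \<longleftrightarrow> \<not> \<eta> \<subseteq>\<^sub>m \<nu> \<and> \<not> \<nu> \<subseteq>\<^sub>m \<eta>"

definition lex :: "'o rel \<Rightarrow> 'o node \<Rightarrow> 'o node \<Rightarrow> bool" where
  "lex r \<eta> \<nu> \<longleftrightarrow> \<eta> \<subseteq>\<^sub>m \<nu> \<or>
     (incomparable \<eta> \<nu> \<and>
      (\<exists>l\<in>Field r. dom (meet r \<eta> \<nu>) = underS r l \<and> the (\<eta> l) < the (\<nu> l)))"

text \<open>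
  If \<open>A\<close> is the ordinal \<open>\<alpha>\<close> (as a set of ordinals) and \<open>\<alpha> \<le> x\<close>, this is the ordinal \<open>y\<close> with
  \<open>\<alpha> + y = x\<close>.
\<close>

definition ord_minus :: "'o rel \<Rightarrow> 'o set \<Rightarrow> 'o \<Rightarrow> 'o" where
  "ord_minus r A x =
     (THE y. y \<in> Field r \<and> Restr r (underS r x - A) =o Restr r (underS r y))"

definition concat_node :: "'o rel \<Rightarrow> 'o node \<Rightarrow> 'o node \<Rightarrow> 'o node" where
  "concat_node r \<eta> \<nu> =
     (\<lambda>x. if x \<in> dom \<eta> then \<eta> x
          else if x \<in> Field r then \<nu> (ord_minus r (dom \<eta>) x) else None)"

definition zeros :: "'o rel \<Rightarrow> 'o \<Rightarrow> 'o node" where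
  "zeros r i = (\<lambda>x. if x \<in> underS r i then Some False else None)"


section \<open>The tree language, indiscernibility\<close>

datatype tree_fun = Meet
datatype tree_rel = Initial | Lex

definition L0 :: "(tree_fun, tree_rel) lang" where
  "L0 = \<lparr>fun_ar = (\<lambda>_. Some 2), rel_ar = (\<lambda>_. Some 2)\<rparr>"

definition tree_struct :: "'o rel \<Rightarrow> (tree_fun, tree_rel, 'o node) struct" where
  "tree_struct r =
     \<lparr>univ = tree r,
      fun_int = (\<lambda>_ xs. meet r (xs ! 0) (xs ! 1)),
      rel_int = (\<lambda>R xs. case R of Initial \<Rightarrow> xs ! 0 \<subseteq>\<^sub>m xs ! 1 | Lex \<Rightarrow> lex r (xs ! 0) (xs ! 1))\<rparr>"

text \<open>Trees of \<open>n\<close>-tuples of \<open>M\<close> indexed by \<open>tree r\<close>.\<close>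

definition strongly_indiscernible ::
  "('f, 'r) lang \<Rightarrow> ('f, 'r, 'a) struct \<Rightarrow> 'o rel \<Rightarrow> nat \<Rightarrow> ('o node \<Rightarrow> 'a list) \<Rightarrow> bool" where
  "strongly_indiscernible L M r n a \<longleftrightarrow>
     (\<forall>\<eta>\<in>tree r. a \<eta> \<in> tuples M n) \<and>
     (\<forall>\<eta>s\<in>lists (tree r). \<forall>\<nu>s\<in>lists (tree r).
        length \<eta>s = length \<nu>s \<and> qf_tp L0 (tree_struct r) \<eta>s = qf_tp L0 (tree_struct r) \<nu>s \<longrightarrow>
        tp L M (concat (map a \<eta>s)) {} = tp L M (concat (map a \<nu>s)) {})"

text \<open>Sequences indexed by the well-order \<open>r\<close>.\<close>

definition indiscernible_seq ::
  "('f, 'r) lang \<Rightarrow> ('f, 'r, 'a) struct \<Rightarrow> 'o rel \<Rightarrow> ('o \<Rightarrow> 'a list) \<Rightarrow> 'a set \<Rightarrow> bool" where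
  "indiscernible_seq L M r s B \<longleftrightarrow>
     (\<forall>is\<in>lists (Field r). \<forall>js\<in>lists (Field r).
        length is = length js \<and>
        sorted_wrt (\<lambda>x y. x \<noteq> y \<and> (x, y) \<in> r) is \<and>
        sorted_wrt (\<lambda>x y. x \<noteq> y \<and> (x, y) \<in> r) js \<longrightarrow>
        tp L M (concat (map s is)) B = tp L M (concat (map s js)) B)"


section \<open>The antichain tree property\<close>

text \<open>
  The formula \<open>\<phi>(x, y)\<close> comes with the lengths \<open>m\<close> of \<open>x\<close> and \<open>n\<close> of \<open>y\<close>; the variables of \<open>x\<close> are
  \<open>0, \<dots>, m - 1\<close>, those of \<open>y\<close> are \<open>m, \<dots>, m + n - 1\<close>.
\<close>

definition formula_ATP ::
  "('f, 'r, 'a) struct \<Rightarrow> nat \<Rightarrow> nat \<Rightarrow> ('f, 'r) fm \<Rightarrow> bool" where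
  "formula_ATP M m n \<phi> \<longleftrightarrow>
     (\<exists>c :: nat node \<Rightarrow> 'a list.
        (\<forall>\<eta>\<in>tree natLeq. c \<eta> \<in> tuples M n) \<and>
        (\<forall>X\<subseteq>tree natLeq. (\<forall>\<eta>\<in>X. \<forall>\<nu>\<in>X. \<eta> \<noteq> \<nu> \<longrightarrow> incomparable \<eta> \<nu>) \<longrightarrow>
           consistent M m {(\<phi>, c \<eta>) |\<eta>. \<eta> \<in> X}) \<and>
        (\<forall>\<eta>\<in>tree natLeq. \<forall>\<nu>\<in>tree natLeq. \<eta> \<subseteq>\<^sub>m \<nu> \<and> \<eta> \<noteq> \<nu> \<longrightarrow>
           \<not> consistent M m {(\<phi>, c \<eta>), (\<phi>, c \<nu>)}))"

text \<open>For the complete theory of \<open>M\<close>, where \<open>M\<close> is a monster model.\<close>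

definition NATP :: "('f, 'r) lang \<Rightarrow> ('f, 'r, 'a) struct \<Rightarrow> bool" where
  "NATP L M \<longleftrightarrow>
     \<not> (\<exists>m n. \<exists>\<phi>\<in>formulas L. fv \<phi> \<subseteq> {..<m + n} \<and> formula_ATP M m n \<phi>)"

end

theory Submission
  imports Defs "HOL-Library.Ramsey" "HOL-Library.Sublist"
begin

text \<open>
  Suppose that (2) fails for a strongly indiscernible tree and \<open>b\<close>.  By Ramsey's theorem and
  compactness every \<open>\<rho> \<in> 2\<^sup>\<kappa>\<close> has a formula \<open>\<psi>(x, y)\<close> with \<open>\<psi>(b, a\<^sub>\<rho>)\<close> and a number \<open>k\<close> such that \<open>\<psi>\<close>
  is inconsistent along some \<open>k\<close> members of the chain of the \<open>\<rho> 0\<^sup>i\<close>.  There are fewer than \<open>\<kappa>\<close> such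
  pairs, so by regularity one of them occurs densely above some node.  Then \<open>b\<close> realizes \<open>\<psi>\<close> along
  copies of all finite antichains, and by strong indiscernibility \<open>\<psi>\<close> is consistent along all finite
  antichains and inconsistent along all chains of length \<open>k\<close>.  A conjunction of instances of \<open>\<psi>\<close> then
  has ATP.

  Conversely, a Ramsey theorem for trees and compactness turn a witness of ATP for \<open>\<phi>\<close> into a strongly
  indiscernible tree with the same consistency pattern.  As \<open>2\<^sup>\<kappa>\<close> is an antichain, some \<open>b\<close> satisfies
  \<open>\<phi>(x, a\<^sub>\<rho>)\<close> for all \<open>\<rho> \<in> 2\<^sup>\<kappa>\<close>, and a \<open>b'\<close> as in (2) would satisfy \<open>\<phi>(x, a\<^sub>\<eta>)\<close> for two comparable \<open>\<eta>\<close>.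
\<close>

section \<open>Renaming of variables and definable predicates\<close>

text \<open>Both directions rest on what the tree language cannot see. It knows inclusion, meets and
  the lexicographic order, but no lengths. A strictly increasing chain may therefore climb at any
  speed and still has the type of \<zeta>, \<zeta>0, \<zeta>00, ..., as long as nothing branches
  off. So only the size of a finite inconsistent part of the chain above \<rho> matters, not its
  position, which keeps the number of colours below \<kappa>; and extensions of an antichain up to
  level \<kappa> have the type of the antichain itself. For the converse, homogeneity is wanted for
  all tuples of equal quantifier-free type, but the homogeneous copy has to preserve inclusion only,
  because ATP speaks of nothing else. This freedom allows replacing binary sequences by sequences of
  natural numbers, whose entries can be chosen from one homogeneous set of numbers, so that the
  classical Ramsey theorem suffices. Compactness is used with as many variables as there are entries
  in a tree. It is therefore phrased for predicates of assignments that depend on finitely many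
  variables, and not for formulas with numbered variables.\<close>

lemma finite_fv_tm: "finite (fv_tm t)"
  by (induction t) auto

lemma finite_fv: "finite (fv \<phi>)"
  by (induction \<phi>) (auto simp: finite_fv_tm)

lemma tm_val_cong: "(\<And>i. i \<in> fv_tm t \<Longrightarrow> v i = v' i) \<Longrightarrow> tm_val M v t = tm_val M v' t"
proof (induction t)
  case (Fun f ts)
  then have "map (tm_val M v) ts = map (tm_val M v') ts" by auto
  then show ?case by (simp del: map_eq_conv)
qed simp

lemma sat_cong: "(\<And>i. i \<in> fv \<phi> \<Longrightarrow> v i = v' i) \<Longrightarrow> sat M v \<phi> = sat M v' \<phi>"
proof (induction \<phi> arbitrary: v v')
  case (Eq s t)
  have "tm_val M v s = tm_val M v' s" "tm_val M v t = tm_val M v' t"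
    by (rule tm_val_cong, use Eq in simp)+
  then show ?case by simp
next
  case (Rel R ts)
  have "tm_val M v t = tm_val M v' t" if "t \<in> set ts" for t
    by (rule tm_val_cong) (use Rel that in auto)
  then have "map (tm_val M v) ts = map (tm_val M v') ts" by simp
  then show ?case by (simp del: map_eq_conv)
next
  case (Conj \<phi> \<psi>)
  have "sat M v \<phi> = sat M v' \<phi>" "sat M v \<psi> = sat M v' \<psi>"
    by (rule Conj.IH, use Conj.prems in simp)+
  then show ?case by simp
next
  case (Ex i \<phi>)
  have "sat M (v(i := x)) \<phi> = sat M (v'(i := x)) \<phi>" for x
    by (rule Ex.IH) (use Ex.prems in auto)
  then show ?case by simp
next
  case (Neg \<phi>)
  then show ?case by (metis fv.simps(3) sat.simps(3))
qed

section \<open>Substitution of variables for variables\<close>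

fun ren_tm :: "(nat \<Rightarrow> nat) \<Rightarrow> 'f tm \<Rightarrow> 'f tm" where
  "ren_tm s (Var i) = Var (s i)"
| "ren_tm s (Fun f ts) = Fun f (map (ren_tm s) ts)"

lemma wf_ren_tm: "wf_tm L (ren_tm s t) = wf_tm L t"
  by (induction t) auto

lemma fv_ren_tm: "fv_tm (ren_tm s t) = s ` fv_tm t"
  by (induction t) auto

lemma tm_val_ren: "tm_val M v (ren_tm s t) = tm_val M (v \<circ> s) t"
proof (induction t)
  case (Fun f ts)
  then have "map (tm_val M v) (map (ren_tm s) ts) = map (tm_val M (v \<circ> s)) ts"
    by (simp add: comp_def)
  then show ?case by (simp only: ren_tm.simps tm_val.simps)
qed simp

text \<open>\<open>s\<close> may identify variables (as in \<open>definable_formula\<close>, where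
  several variables denote the same entry), so a bound variable cannot be kept: it is replaced by
  one outside the image of the free variables of the quantified formula.\<close>

fun ren :: "(nat \<Rightarrow> nat) \<Rightarrow> ('f, 'r) fm \<Rightarrow> ('f, 'r) fm" where
  "ren s (Eq t u) = Eq (ren_tm s t) (ren_tm s u)"
| "ren s (Rel R ts) = Rel R (map (ren_tm s) ts)"
| "ren s (Neg \<phi>) = Neg (ren s \<phi>)"
| "ren s (Conj \<phi> \<psi>) = Conj (ren s \<phi>) (ren s \<psi>)"
| "ren s (Ex i \<phi>) = (let j = LEAST j. j \<notin> s ` (fv \<phi> - {i}) in Ex j (ren (s(i := j)) \<phi>))"

lemma fresh_Least:
  "(LEAST j. j \<notin> s ` (fv \<phi> - {i})) \<notin> s ` (fv \<phi> - {i :: nat})" for s :: "nat \<Rightarrow> nat"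
proof -
  have "finite (s ` (fv \<phi> - {i}))" by (simp add: finite_fv)
  then have "\<exists>j. j \<notin> s ` (fv \<phi> - {i})" by (rule ex_new_if_finite[OF infinite_UNIV_nat])
  then show ?thesis by (rule LeastI_ex)
qed

lemma wf_ren: "wf_fm L (ren s \<phi>) = wf_fm L \<phi>"
  by (induction \<phi> arbitrary: s) (auto simp: wf_ren_tm Let_def)

lemma fv_ren: "fv (ren s \<phi>) = s ` fv \<phi>"
proof (induction \<phi> arbitrary: s)
  case (Ex i \<phi>)
  define j where "j = (LEAST j. j \<notin> s ` (fv \<phi> - {i}))"
  have j: "j \<notin> s ` (fv \<phi> - {i})" unfolding j_def by (rule fresh_Least)
  have "fv (ren s (Ex i \<phi>)) = (s(i := j)) ` fv \<phi> - {j}"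
    by (simp add: Let_def j_def Ex.IH)
  also have "\<dots> = s ` (fv \<phi> - {i})" using j by auto
  finally show ?case by simp
qed (auto simp: fv_ren_tm)

lemma sat_ren: "sat M v (ren s \<phi>) = sat M (v \<circ> s) \<phi>"
proof (induction \<phi> arbitrary: s v)
  case (Rel R ts)
  have "map (tm_val M v) (map (ren_tm s) ts) = map (tm_val M (v \<circ> s)) ts"
    by (simp add: tm_val_ren)
  then have "rel_int M R (map (tm_val M v) (map (ren_tm s) ts)) = rel_int M R (map (tm_val M (v \<circ> s)) ts)"
    by (rule arg_cong)
  then show ?case by (simp only: ren.simps sat.simps)
next
  case (Ex i \<phi>)
  define j where "j = (LEAST j. j \<notin> s ` (fv \<phi> - {i}))"
  have j: "j \<notin> s ` (fv \<phi> - {i})" unfolding j_def by (rule fresh_Least)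
  have "sat M (v(j := x) \<circ> s(i := j)) \<phi> = sat M ((v \<circ> s)(i := x)) \<phi>" for x
    by (rule sat_cong) (use j in auto)
  then have "sat M v (Ex j (ren (s(i := j)) \<phi>)) = sat M (v \<circ> s) (Ex i \<phi>)"
    by (simp only: sat.simps Ex.IH)
  then show ?case by (simp only: ren.simps Let_def j_def)
qed (auto simp: tm_val_ren)

text \<open>
  The index type \<open>'i\<close> is arbitrary, which avoids all bookkeeping of the positions of variables.
\<close>

definition definable ::
  "('f, 'r) lang \<Rightarrow> ('f, 'r, 'a) struct \<Rightarrow> 'i set \<Rightarrow> (('i \<Rightarrow> 'a) \<Rightarrow> bool) \<Rightarrow> bool" where
  "definable L M V P \<longleftrightarrow>
     (\<exists>\<phi>\<in>formulas L. \<exists>v. v ` fv \<phi> \<subseteq> V \<and> (\<forall>g. P g = sat M (g \<circ> v) \<phi>))"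

lemma definable_mono: "definable L M V P \<Longrightarrow> V \<subseteq> W \<Longrightarrow> definable L M W P"
  unfolding definable_def by (meson subset_trans)

lemma definable_cong:
  assumes "definable L M V P" "\<And>i. i \<in> V \<Longrightarrow> g i = h i"
  shows "P g = P h"
proof -
  from assms(1) obtain \<phi> v where "v ` fv \<phi> \<subseteq> V" and P: "\<And>g. P g = sat M (g \<circ> v) \<phi>"
    unfolding definable_def by blast
  then show ?thesis unfolding P by (intro sat_cong) (use assms(2) in auto)
qed

lemma definable_finite:
  assumes "definable L M V P"
  obtains F where "finite F" "F \<subseteq> V" "definable L M F P"
proof -
  from assms obtain \<phi> v where "\<phi> \<in> formulas L" "v ` fv \<phi> \<subseteq> V" "\<And>g. P g = sat M (g \<circ> v) \<phi>"
    unfolding definable_def by blast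
  then have "definable L M (v ` fv \<phi>) P" "finite (v ` fv \<phi>)"
    unfolding definable_def by (blast, simp add: finite_fv)
  then show thesis using that \<open>v ` fv \<phi> \<subseteq> V\<close> by blast
qed

lemma definable_reindex:
  assumes "definable L M V P"
  shows "definable L M (f ` V) (\<lambda>g. P (g \<circ> f))"
proof -
  from assms obtain \<phi> v where "\<phi> \<in> formulas L" "v ` fv \<phi> \<subseteq> V" "\<And>g. P g = sat M (g \<circ> v) \<phi>"
    unfolding definable_def by blast
  then show ?thesis unfolding definable_def
    by (intro bexI[of _ \<phi>] exI[of _ "f \<circ> v"]) (auto simp: comp_assoc)
qed

lemma definable_not: "definable L M V P \<Longrightarrow> definable L M V (\<lambda>g. \<not> P g)"
proof -
  assume "definable L M V P"
  then obtain \<phi> v where "\<phi> \<in> formulas L" "v ` fv \<phi> \<subseteq> V" "\<And>g. P g = sat M (g \<circ> v) \<phi>"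
    unfolding definable_def by blast
  then show ?thesis
    unfolding definable_def by (intro bexI[of _ "Neg \<phi>"] exI[of _ v]) (auto simp: formulas_def)
qed

lemma definable_conj:
  assumes "definable L M V P" "definable L M V Q"
  shows "definable L M V (\<lambda>g. P g \<and> Q g)"
proof -
  from assms(1) obtain \<phi> v where p: "\<phi> \<in> formulas L" "v ` fv \<phi> \<subseteq> V" "\<And>g. P g = sat M (g \<circ> v) \<phi>"
    unfolding definable_def by blast
  from assms(2) obtain \<psi> w where q: "\<psi> \<in> formulas L" "w ` fv \<psi> \<subseteq> V" "\<And>g. Q g = sat M (g \<circ> w) \<psi>"
    unfolding definable_def by blast
  \<comment> \<open>The same variable may denote different indices in the two formulas, so
    \<open>\<phi>\<close> is moved to the even variables and \<open>\<psi>\<close> to the odd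
    ones.\<close>
  define u where "u k = (if even k then v (k div 2) else w (k div 2))" for k
  have u: "u \<circ> (\<lambda>k. 2 * k) = v" "u \<circ> (\<lambda>k. Suc (2 * k)) = w"
    by (auto simp: u_def fun_eq_iff)
  have "sat M (g \<circ> u) (Conj (ren (\<lambda>k. 2 * k) \<phi>) (ren (\<lambda>k. Suc (2 * k)) \<psi>)) = (P g \<and> Q g)" for g
    by (simp add: sat_ren p q comp_assoc u)
  moreover have "u ` fv (Conj (ren (\<lambda>k. 2 * k) \<phi>) (ren (\<lambda>k. Suc (2 * k)) \<psi>)) \<subseteq> V"
    using p(2) q(2) by (auto simp: fv_ren u_def)
  moreover have "Conj (ren (\<lambda>k. 2 * k) \<phi>) (ren (\<lambda>k. Suc (2 * k)) \<psi>) \<in> formulas L"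
    using p(1) q(1) by (simp add: formulas_def wf_ren)
  ultimately show ?thesis unfolding definable_def by blast
qed

lemma definable_iff:
  assumes "definable L M V P" "definable L M V Q"
  shows "definable L M V (\<lambda>g. P g = Q g)"
proof -
  have "definable L M V (\<lambda>g. \<not> (P g \<and> \<not> Q g) \<and> \<not> (Q g \<and> \<not> P g))"
    by (intro definable_conj definable_not assms)
  moreover have "(\<lambda>g. \<not> (P g \<and> \<not> Q g) \<and> \<not> (Q g \<and> \<not> P g)) = (\<lambda>g. P g = Q g)" by auto
  ultimately show ?thesis by simp
qed

lemma definable_True: "definable L M V (\<lambda>g. True)"
  unfolding definable_def formulas_def
  \<comment> \<open>A sentence is required here, since \<open>V\<close> may be empty.\<close>
  by (rule bexI[of _ "Neg (Conj (Ex 0 (Eq (Var 0) (Var 0))) (Neg (Ex 0 (Eq (Var 0) (Var 0)))))"]) auto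

lemma definable_ball:
  assumes "finite S" "\<And>s. s \<in> S \<Longrightarrow> definable L M V (P s)"
  shows "definable L M V (\<lambda>g. \<forall>s\<in>S. P s g)"
  using assms by (induction S) (auto intro: definable_True definable_conj)

lemma definable_Ex:
  assumes "definable L M V P"
  shows "definable L M (V - {i}) (\<lambda>g. \<exists>x\<in>univ M. P (g(i := x)))"
proof -
  from assms(1) obtain \<phi> v where p: "\<phi> \<in> formulas L" "v ` fv \<phi> \<subseteq> V" "\<And>g. P g = sat M (g \<circ> v) \<phi>"
    unfolding definable_def by blast
  \<comment> \<open>All variables denoting \<open>i\<close> become the quantified variable 0; the
    others are shifted by one to make room, and \<open>w\<close> undoes the shift.\<close>
  define s where "s k = (if v k = i then 0 else Suc k)" for k
  define w where "w k = v (k - 1)" for k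
  have "sat M ((g \<circ> w)(0 := x) \<circ> s) \<phi> = sat M (g(i := x) \<circ> v) \<phi>" for g x
    by (rule sat_cong) (auto simp: s_def w_def)
  then have "(\<exists>x\<in>univ M. P (g(i := x))) = sat M (g \<circ> w) (Ex 0 (ren s \<phi>))" for g
    by (simp add: sat_ren p)
  moreover have "w ` fv (Ex 0 (ren s \<phi>)) \<subseteq> V - {i}"
    using p(2) by (auto simp: fv_ren s_def w_def)
  moreover have "Ex 0 (ren s \<phi>) \<in> formulas L" using p(1) by (simp add: formulas_def wf_ren)
  ultimately show ?thesis unfolding definable_def by blast
qed

text \<open>Iterated quantification. The witnesses form an assignment \<open>h\<close> that agrees
  with \<open>g\<close> off \<open>X\<close>, so no order of the quantifiers has to be
  fixed.\<close>

lemma definable_Ex_finite: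
  assumes "finite X" "definable L M V P"
  shows "definable L M (V - X)
    (\<lambda>g. \<exists>h. (\<forall>i\<in>X. h i \<in> univ M) \<and> (\<forall>i. i \<notin> X \<longrightarrow> h i = g i) \<and> P h)"
  using assms(1)
proof induction
  case empty
  have "(\<lambda>g. \<exists>h. (\<forall>i. h i = g i) \<and> P h) = P" by (simp flip: fun_eq_iff)
  then show ?case using assms(2) by simp
next
  case (insert i X)
  let ?Q = "\<lambda>g. \<exists>h. (\<forall>i\<in>X. h i \<in> univ M) \<and> (\<forall>i. i \<notin> X \<longrightarrow> h i = g i) \<and> P h"
  have "(\<lambda>g. \<exists>x\<in>univ M. ?Q (g(i := x))) =
    (\<lambda>g. \<exists>h. (\<forall>i\<in>insert i X. h i \<in> univ M) \<and> (\<forall>j. j \<notin> insert i X \<longrightarrow> h j = g j) \<and> P h)"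
    (is "?A = ?B")
  proof
    fix g
    show "?A g = ?B g"
    proof
      assume "?A g"
      then obtain x h where "x \<in> univ M" and h: "\<forall>i\<in>X. h i \<in> univ M" "\<forall>j. j \<notin> X \<longrightarrow> h j = (g(i := x)) j" "P h"
        by blast
      then have "h i = x" using insert(2) by simp
      then show "?B g" using h \<open>x \<in> univ M\<close> by (intro exI[of _ h]) auto
    next
      assume "?B g"
      then obtain h where "\<forall>i\<in>insert i X. h i \<in> univ M" "\<forall>j. j \<notin> insert i X \<longrightarrow> h j = g j" "P h"
        by blast
      then show "?A g" by (intro bexI[of _ "h i"] exI[of _ h]) auto
    qed
  qed
  moreover have "V - insert i X = V - X - {i}" by auto
  ultimately show ?case using definable_Ex[OF insert.IH, of i] by simp
qed

lemma definable_holds: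
  assumes "\<phi> \<in> formulas L" "fv \<phi> \<subseteq> {..<length is}"
  shows "definable L M (set is) (\<lambda>g. holds M \<phi> (map g is))"
proof -
  have "holds M \<phi> (map g is) = sat M (g \<circ> (\<lambda>k. is ! k)) \<phi>" for g
    unfolding holds_def by (rule sat_cong) (use assms(2) in auto)
  moreover have "(\<lambda>k. is ! k) ` fv \<phi> \<subseteq> set is" using assms(2) by auto
  ultimately show ?thesis unfolding definable_def using assms(1) by blast
qed

text \<open>The way back to formulas with numbered variables, needed where saturation or types
  enter: each variable is sent to some position of its index in \<open>is\<close>, which may contain
  repetitions.\<close>

lemma definable_formula:
  assumes "definable L M (set is) P"
  obtains \<phi> where "\<phi> \<in> formulas L" "fv \<phi> \<subseteq> {..<length is}" "\<And>g. P g = holds M \<phi> (map g is)"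
proof -
  from assms obtain \<phi> v where p: "\<phi> \<in> formulas L" "v ` fv \<phi> \<subseteq> set is" "\<And>g. P g = sat M (g \<circ> v) \<phi>"
    unfolding definable_def by blast
  define s where "s k = (SOME j. j < length is \<and> is ! j = v k)" for k
  have s: "s k < length is \<and> is ! s k = v k" if "k \<in> fv \<phi>" for k
  proof -
    have "v k \<in> set is" using p(2) that by auto
    then have "\<exists>j. j < length is \<and> is ! j = v k" by (simp add: in_set_conv_nth)
    then show ?thesis unfolding s_def by (rule someI_ex)
  qed
  show thesis
  proof (rule that[of "ren s \<phi>"])
    show "P g = holds M (ren s \<phi>) (map g is)" for g
      unfolding holds_def sat_ren p by (rule sat_cong) (use s in auto)
  qed (use p s in \<open>auto simp: formulas_def wf_ren fv_ren\<close>)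
qed

section \<open>Transfer of definable predicates between tuples of equal type\<close>

lemma tp_empty_eqD:
  assumes "tp L M xs {} = tp L M ys {}" "length xs = length ys"
    and "\<phi> \<in> formulas L" "fv \<phi> \<subseteq> {..<length xs}"
  shows "holds M \<phi> xs = holds M \<phi> ys"
proof -
  have "(\<phi>, []) \<in> tp L M xs {} \<longleftrightarrow> (\<phi>, []) \<in> tp L M ys {}" using assms(1) by simp
  then show ?thesis using assms(2-4) by (simp add: tp_def formulas_over_def)
qed

lemma tp_empty_eqI:
  assumes "length xs = length ys"
    and "\<And>\<phi>. \<phi> \<in> formulas L \<Longrightarrow> fv \<phi> \<subseteq> {..<length xs} \<Longrightarrow> holds M \<phi> xs = holds M \<phi> ys"
  shows "tp L M xs {} = tp L M ys {}"
  using assms by (auto simp: tp_def formulas_over_def)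

lemma definable_transfer:
  assumes "tp L M (map g is) {} = tp L M (map h is) {}" "definable L M (set is) P"
  shows "P g = P h"
proof -
  from definable_formula[OF assms(2)] obtain \<phi> where p:
    "\<phi> \<in> formulas L" "fv \<phi> \<subseteq> {..<length is}" "\<And>g. P g = holds M \<phi> (map g is)" by blast
  then show ?thesis using tp_empty_eqD[OF assms(1)] by simp
qed

lemma definable_support_finite:
  assumes "finite S" "\<And>s. s \<in> S \<Longrightarrow> definable L M V (P s)"
  obtains F where "finite F" "F \<subseteq> V" "\<And>s. s \<in> S \<Longrightarrow> definable L M F (P s)"
proof -
  have "\<forall>s\<in>S. \<exists>F. finite F \<and> F \<subseteq> V \<and> definable L M F (P s)"
    using assms(2) by (meson definable_finite)
  then obtain F where F: "\<And>s. s \<in> S \<Longrightarrow> finite (F s) \<and> F s \<subseteq> V \<and> definable L M (F s) (P s)"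
    by metis
  show thesis
  proof (rule that[of "\<Union>s\<in>S. F s"])
    show "finite (\<Union>s\<in>S. F s)" using F assms(1) by blast
    show "(\<Union>s\<in>S. F s) \<subseteq> V" using F by blast
    show "definable L M (\<Union>s\<in>S. F s) (P s)" if "s \<in> S" for s
      using F[OF that] that definable_mono[of L M "F s" "P s"] by blast
  qed
qed

section \<open>Compactness\<close>

text \<open>A partial assignment is given by its graph, so that chains have plain unions as upper
  bounds. That the graph is single-valued is implied by the case \<open>S0 = {}\<close>.\<close>

definition extendible ::
  "('f, 'r, 'a) struct \<Rightarrow> 'i set \<Rightarrow> ('s \<Rightarrow> ('i \<Rightarrow> 'a) \<Rightarrow> bool) \<Rightarrow> 's set \<Rightarrow> ('i \<times> 'a) set \<Rightarrow> bool" where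
  "extendible M I P S R \<longleftrightarrow> R \<subseteq> I \<times> univ M \<and>
     (\<forall>S0\<subseteq>S. finite S0 \<longrightarrow>
        (\<exists>g. (\<forall>i\<in>I. g i \<in> univ M) \<and> (\<forall>(i, x)\<in>R. g i = x) \<and> (\<forall>s\<in>S0. P s g)))"

lemma extendibleD:
  assumes "extendible M I P S R" "S0 \<subseteq> S" "finite S0"
  shows "\<exists>g. (\<forall>i\<in>I. g i \<in> univ M) \<and> (\<forall>i x. (i, x) \<in> R \<longrightarrow> g i = x) \<and> (\<forall>s\<in>S0. P s g)"
proof -
  from assms(1) have "\<exists>g. (\<forall>i\<in>I. g i \<in> univ M) \<and> (\<forall>(i, x)\<in>R. g i = x) \<and> (\<forall>s\<in>S0. P s g)"
    using assms(2,3) unfolding extendible_def by simp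
  then show ?thesis by (simp add: split_beta Ball_def)
qed

lemma extendible_unique:
  assumes "extendible M I P S R" "(i, x) \<in> R" "(i, y) \<in> R"
  shows "x = y"
proof -
  obtain g where "\<And>i x. (i, x) \<in> R \<Longrightarrow> g i = x"
    using extendibleD[OF assms(1), of "{}"] by auto
  then show ?thesis using assms(2,3) by metis
qed

text \<open>Finitely many conditions depend on a finite set \<open>F\<close> of variables, and the
  values that the union prescribes on \<open>F\<close> already occur in one member of the
  chain.\<close>

lemma extendible_chain:
  assumes def: "\<And>s. s \<in> S \<Longrightarrow> definable L M I (P s)"
    and chain: "subset.chain {R. extendible M I P S R} \<C>" and "\<C> \<noteq> {}"
  shows "extendible M I P S (\<Union>\<C>)"
  unfolding extendible_def
proof (intro conjI allI impI)
  have ext: "extendible M I P S R" if "R \<in> \<C>" for R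
    using chain that unfolding subset.chain_def by blast
  then show sub: "\<Union>\<C> \<subseteq> I \<times> univ M" unfolding extendible_def by blast
  have fin: "\<exists>R\<in>\<C>. X \<subseteq> R" if "finite X" "X \<subseteq> \<Union>\<C>" for X
    using finite_subset_Union_chain[OF that \<open>\<C> \<noteq> {}\<close> chain] by blast
  have uniq: "x = y" if xy: "(i, x) \<in> \<Union>\<C>" "(i, y) \<in> \<Union>\<C>" for i x y
  proof -
    obtain R where "R \<in> \<C>" "{(i, x), (i, y)} \<subseteq> R" using fin[of "{(i, x), (i, y)}"] xy by auto
    then show ?thesis using extendible_unique[OF ext] by blast
  qed
  fix S0 assume S0: "S0 \<subseteq> S" "finite S0"
  obtain F where F: "finite F" "F \<subseteq> I" "\<And>s. s \<in> S0 \<Longrightarrow> definable L M F (P s)"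
    using definable_support_finite[OF S0(2), of L M I] def S0(1) by (metis subsetD)
  define f where "f i = (SOME x. (i, x) \<in> \<Union>\<C>)" for i
  have f: "f i = x" if "(i, x) \<in> \<Union>\<C>" for i x
    using uniq[OF that] someI[of "\<lambda>x. (i, x) \<in> \<Union>\<C>", OF that] unfolding f_def by metis
  have "finite {(i, f i) | i. i \<in> F}" using F(1) by simp
  then have "finite (\<Union>\<C> \<inter> {(i, f i) | i. i \<in> F})" by blast
  then obtain R where R: "R \<in> \<C>" "\<Union>\<C> \<inter> {(i, f i) | i. i \<in> F} \<subseteq> R" using fin by blast
  obtain g where g: "\<And>i. i \<in> I \<Longrightarrow> g i \<in> univ M" "\<And>i x. (i, x) \<in> R \<Longrightarrow> g i = x"
      "\<And>s. s \<in> S0 \<Longrightarrow> P s g"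
    using extendibleD[OF ext[OF R(1)] S0] by blast
  \<comment> \<open>\<open>h\<close> obeys the whole union; it agrees with \<open>g\<close> on
    \<open>F\<close>, which is all that the conditions in \<open>S0\<close> see.\<close>
  define h where "h i = (if i \<in> Domain (\<Union>\<C>) then f i else g i)" for i
  have hg: "h i = g i" if "i \<in> F" for i
  proof (cases "i \<in> Domain (\<Union>\<C>)")
    case True
    then obtain x where x: "(i, x) \<in> \<Union>\<C>" by blast
    then have "(i, f i) \<in> R" using R(2) f[OF x] that by blast
    then show ?thesis using g(2) True by (auto simp: h_def)
  qed (simp add: h_def)
  show "\<exists>g. (\<forall>i\<in>I. g i \<in> univ M) \<and> (\<forall>(i, x)\<in>\<Union>\<C>. g i = x) \<and> (\<forall>s\<in>S0. P s g)"
  proof (intro exI[of _ h] conjI ballI)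
    fix i assume "i \<in> I"
    show "h i \<in> univ M"
    proof (cases "i \<in> Domain (\<Union>\<C>)")
      case True
      then obtain x where "(i, x) \<in> \<Union>\<C>" by blast
      then show ?thesis using f sub True unfolding h_def by auto
    qed (use g(1) \<open>i \<in> I\<close> in \<open>simp add: h_def\<close>)
  next
    fix p assume "p \<in> \<Union>\<C>"
    moreover obtain i x where p: "p = (i, x)" by force
    ultimately have "i \<in> Domain (\<Union>\<C>)" "f i = x" using f[of i x] by (blast, simp)
    then show "case p of (i, x) \<Rightarrow> h i = x" using p by (simp add: h_def)
  next
    fix s assume "s \<in> S0"
    then show "P s h" using definable_cong[OF F(3), of s h g] hg g(3) by simp
  qed
qed

text \<open>The possible values of the variable \<open>i\<close> form a type over the values already
  assigned: for each finite \<open>S0\<close>, the formula saying that the remaining variables of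
  its support can be filled in. Saturation realizes this type.\<close>

lemma extendible_step:
  fixes \<mu> :: "'l rel" and I :: "'i set" and M :: "('f, 'r, 'a) struct"
  assumes def: "\<And>s. s \<in> S \<Longrightarrow> definable L M I (P s)"
    and sat: "saturated L M \<mu>" and ne: "univ M \<noteq> {}" and small: "|I| <o \<mu>"
    and R: "extendible M I P S R" and i: "i \<in> I" "i \<notin> Domain R"
  shows "\<exists>x. extendible M I P S (insert (i, x) R)"
proof -
  have sub: "R \<subseteq> I \<times> univ M" using R unfolding extendible_def by blast
  obtain u0 where u0: "u0 \<in> univ M" using ne by blast
  define f where "f k = (SOME x. (k, x) \<in> R)" for k
  have f: "f k = x" if "(k, x) \<in> R" for k x
    using extendible_unique[OF R that] someI[of "\<lambda>x. (k, x) \<in> R", OF that] unfolding f_def by metis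
  have fD: "f k \<in> univ M" "f k \<in> Range R" if "k \<in> Domain R" for k
    using that f sub by auto
  \<comment> \<open>The variables of a finite support that are still open apart from
    \<open>i\<close>; these get quantified.\<close>
  define X where "X F = F - insert i (Domain R)" for F
  define Q where "Q F S0 g \<longleftrightarrow>
    (\<exists>h. (\<forall>k\<in>X F. h k \<in> univ M) \<and> (\<forall>k. k \<notin> X F \<longrightarrow> h k = g k) \<and> (\<forall>s\<in>S0. P s h))" for F S0 g
  have "\<exists>F \<phi> js. finite F \<and> F \<subseteq> I \<and> (\<forall>s\<in>S0. definable L M F (P s)) \<and> \<phi> \<in> formulas L \<and>
      set js \<subseteq> Domain R \<and> fv \<phi> \<subseteq> {..<1 + length js} \<and>
      (\<forall>g. Q F S0 g = holds M \<phi> (map g (i # js)))"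
    if S0: "S0 \<subseteq> S" "finite S0" for S0
  proof -
    obtain F where F: "finite F" "F \<subseteq> I" "\<And>s. s \<in> S0 \<Longrightarrow> definable L M F (P s)"
      using definable_support_finite[OF S0(2), of L M I] def S0(1) by (metis subsetD)
    obtain js where js: "set js = F \<inter> Domain R" using F(1) finite_list[of "F \<inter> Domain R"] by auto
    have "definable L M F (\<lambda>g. \<forall>s\<in>S0. P s g)"
      using definable_ball[OF S0(2), of L M F P] F(3) by blast
    then have "definable L M (F - X F) (Q F S0)"
      unfolding Q_def using F(1) by (intro definable_Ex_finite) (auto simp: X_def)
    then have "definable L M (set (i # js)) (Q F S0)"
      by (rule definable_mono) (auto simp: X_def js)
    then obtain \<phi> where "\<phi> \<in> formulas L" "fv \<phi> \<subseteq> {..<length (i # js)}"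
        "\<And>g. Q F S0 g = holds M \<phi> (map g (i # js))"
      using definable_formula by blast
    then show ?thesis using F js by (intro exI[of _ F] exI[of _ \<phi>] exI[of _ js]) auto
  qed
  then obtain F \<phi> js where *: "\<And>S0. S0 \<subseteq> S \<Longrightarrow> finite S0 \<Longrightarrow> finite (F S0) \<and> F S0 \<subseteq> I \<and>
      (\<forall>s\<in>S0. definable L M (F S0) (P s)) \<and> \<phi> S0 \<in> formulas L \<and>
      set (js S0) \<subseteq> Domain R \<and> fv (\<phi> S0) \<subseteq> {..<1 + length (js S0)} \<and>
      (\<forall>g. Q (F S0) S0 g = holds M (\<phi> S0) (map g (i # js S0)))"
    by metis
  define fin where "fin = {S0. S0 \<subseteq> S \<and> finite S0}"
  define p where "p = (\<lambda>S0. (\<phi> S0, map f (js S0))) ` fin"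
  have "p \<subseteq> formulas_over L 1 (Range R)"
  proof
    fix y assume "y \<in> p"
    then obtain S0 where S: "S0 \<subseteq> S" "finite S0" "y = (\<phi> S0, map f (js S0))"
      unfolding p_def fin_def by blast
    have "set (js S0) \<subseteq> Domain R" using *[OF S(1,2)] by (elim conjE)
    then have "set (map f (js S0)) \<subseteq> Range R" using fD(2) by auto
    then show "y \<in> formulas_over L 1 (Range R)"
      using *[OF S(1,2)] by (simp add: S(3) formulas_over_def lists_eq_set)
  qed
  \<comment> \<open>Finitely many members of \<open>p\<close> come from finitely many sets
    \<open>S0\<close>. An assignment for their union satisfies all of these formulas with the single
    value \<open>g i\<close>.\<close>
  moreover have "consistent M 1 p" unfolding consistent_def
  proof (intro allI impI)
    fix q assume "q \<subseteq> p" "finite q"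
    then obtain \<F> where \<F>: "\<F> \<subseteq> fin" "finite \<F>" "q = (\<lambda>S0. (\<phi> S0, map f (js S0))) ` \<F>"
      unfolding p_def by (meson finite_subset_image)
    then have "\<Union>\<F> \<subseteq> S" "finite (\<Union>\<F>)" unfolding fin_def by auto
    from extendibleD[OF R this]
    obtain g where g0: "\<forall>k\<in>I. g k \<in> univ M" "\<forall>k x. (k, x) \<in> R \<longrightarrow> g k = x" "\<forall>s\<in>\<Union>\<F>. P s g"
      by (elim exE conjE)
    have g: "g k \<in> univ M" if "k \<in> I" for k using g0(1) that by simp
    have gR: "g k = x" if "(k, x) \<in> R" for k x using g0(2) that by simp
    have gP: "P s g" if "s \<in> S0" "S0 \<in> \<F>" for s S0
      using g0(3) that by blast
    have "holds M (\<phi> S0) ([g i] @ map f (js S0))" if "S0 \<in> \<F>" for S0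
    proof -
      have S: "S0 \<subseteq> S" "finite S0" using that \<F>(1) unfolding fin_def by auto
      note d = *[OF S]
      have "\<forall>k\<in>X (F S0). g k \<in> univ M" using d g unfolding X_def by blast
      moreover have "\<forall>s\<in>S0. P s g" using gP that by blast
      ultimately have "Q (F S0) S0 g"  unfolding Q_def by blast
      then have "holds M (\<phi> S0) (map g (i # js S0))" using d by simp
      moreover have "g k = f k" if "k \<in> Domain R" for k
        using that gR f by blast
      then have "map g (js S0) = map f (js S0)" using d by (simp add: subset_iff)
      ultimately show ?thesis by simp
    qed
    then have "realizes M [g i] q" unfolding realizes_def \<F>(3) by auto
    moreover have "[g i] \<in> tuples M 1" using g i(1) by (simp add: tuples_def)
    ultimately show "\<exists>b\<in>tuples M 1. realizes M b q" by blast
  qed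
  moreover have "Range R \<subseteq> univ M" using sub by blast
  moreover have "|Range R| <o \<mu>"
  proof -
    have "Range R \<subseteq> f ` I"
    proof
      fix x assume "x \<in> Range R"
      then obtain k where "(k, x) \<in> R" by blast
      then show "x \<in> f ` I" using f[of k x] sub by auto
    qed
    then have "|Range R| \<le>o |I|" using card_of_image card_of_mono1 ordLeq_transitive by metis
    then show ?thesis using small ordLeq_ordLess_trans by blast
  qed
  ultimately obtain b where b: "b \<in> tuples M 1" "realizes M b p"
    using sat unfolding saturated_def by blast
  then obtain x where x: "b = [x]" "x \<in> univ M"
    unfolding tuples_def by (auto simp: length_Suc_conv)
  have "extendible M I P S (insert (i, x) R)" unfolding extendible_def
  proof (intro conjI allI impI)
    show "insert (i, x) R \<subseteq> I \<times> univ M" using sub x i by auto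
    fix S0 assume S: "S0 \<subseteq> S" "finite S0"
    note d = *[OF S]
    have "(\<phi> S0, map f (js S0)) \<in> p" using S by (simp add: p_def fin_def)
    then have "holds M (\<phi> S0) ([x] @ map f (js S0))"
      using b(2) unfolding realizes_def x(1) by auto
    moreover have "set (js S0) \<subseteq> Domain R" using d by (elim conjE)
    then have "map (f(i := x)) (i # js S0) = [x] @ map f (js S0)" using i(2) by auto
    ultimately have "holds M (\<phi> S0) (map (f(i := x)) (i # js S0))" by (simp only:)
    then have "Q (F S0) S0 (f(i := x))" using d by simp
    then obtain h where h: "\<forall>k\<in>X (F S0). h k \<in> univ M"
        "\<forall>k. k \<notin> X (F S0) \<longrightarrow> h k = (f(i := x)) k" "\<forall>s\<in>S0. P s h"
      unfolding Q_def by (elim exE conjE)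
    \<comment> \<open>The witness \<open>h\<close> is trusted on the support only; the prescribed
      values are used elsewhere, and \<open>u0\<close> keeps the rest inside the universe.\<close>
    define g where "g k = (if k \<in> X (F S0) then h k else if k = i then x
      else if k \<in> Domain R then f k else u0)" for k
    have gh: "g k = h k" if "k \<in> F S0" for k
    proof (cases "k \<in> X (F S0)")
      case False
      then have "k \<in> insert i (Domain R)" using that by (simp add: X_def)
      then show ?thesis using False h(2) by (auto simp: g_def)
    qed (simp add: g_def)
    show "\<exists>g. (\<forall>k\<in>I. g k \<in> univ M) \<and> (\<forall>(k, x)\<in>insert (i, x) R. g k = x) \<and> (\<forall>s\<in>S0. P s g)"
    proof (intro exI[of _ g] conjI ballI)
      show "g k \<in> univ M" for k using h(1) x(2) fD(1) u0 by (simp add: g_def)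
    next
      fix y assume "y \<in> insert (i, x) R"
      then consider "y = (i, x)" | k z where "y = (k, z)" "(k, z) \<in> R" by (cases y) auto
      then show "case y of (k, x) \<Rightarrow> g k = x"
      proof cases
        case 2
        then have "k \<in> Domain R" "k \<noteq> i" using i(2) by auto
        then show ?thesis using 2 f[of k z] by (simp add: g_def X_def)
      qed (simp add: g_def X_def)
    next
      fix s assume s: "s \<in> S0"
      then have "definable L M (F S0) (P s)" using d by simp
      then have "P s g = P s h" by (rule definable_cong) (rule gh)
      then show "P s g" using h(3) s by blast
    qed
  qed
  then show ?thesis by blast
qed

text \<open>
  A maximal finitely extendible partial assignment is total, because saturation provides a value for
  one more variable.
\<close>

lemma saturated_realizes:
  fixes \<mu> :: "'l rel" and I :: "'i set" and M :: "('f, 'r, 'a) struct"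
  assumes def: "\<And>s. s \<in> S \<Longrightarrow> definable L M I (P s)"
    and sat: "saturated L M \<mu>" and ne: "univ M \<noteq> {}" and small: "|I| <o \<mu>"
    and J: "J \<subseteq> I"
    and fs: "\<And>S0. S0 \<subseteq> S \<Longrightarrow> finite S0 \<Longrightarrow>
      \<exists>g. (\<forall>i\<in>I. g i \<in> univ M) \<and> (\<forall>i\<in>J. g i = g0 i) \<and> (\<forall>s\<in>S0. P s g)"
  obtains g where "\<And>i. i \<in> I \<Longrightarrow> g i \<in> univ M" "\<And>i. i \<in> J \<Longrightarrow> g i = g0 i" "\<And>s. s \<in> S \<Longrightarrow> P s g"
proof -
  \<comment> \<open>The parameters are the assignment from which the maximal extension
    starts.\<close>
  define R0 where "R0 = {(i, g0 i) | i. i \<in> J}"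
  have "\<exists>g. (\<forall>i\<in>I. g i \<in> univ M) \<and> (\<forall>i\<in>J. g i = g0 i)" using fs[of "{}"] by auto
  then have "R0 \<subseteq> I \<times> univ M" using J unfolding R0_def by (smt (verit) SigmaI mem_Collect_eq subsetD subsetI)
  moreover have "(\<forall>(i, x)\<in>R0. g i = x) \<longleftrightarrow> (\<forall>i\<in>J. g i = g0 i)" for g
    unfolding R0_def by auto
  ultimately have R0: "extendible M I P S R0" using fs unfolding extendible_def by simp
  define \<A> where "\<A> = {R. extendible M I P S R \<and> R0 \<subseteq> R}"
  have "\<exists>R\<in>\<A>. \<forall>R'\<in>\<A>. R \<subseteq> R' \<longrightarrow> R' = R"
  proof (rule subset_Zorn_nonempty)
    show "\<A> \<noteq> {}" using R0 by (auto simp: \<A>_def)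
    fix \<C> assume c: "\<C> \<noteq> {}" "subset.chain \<A> \<C>"
    then have ch: "subset.chain {R. extendible M I P S R} \<C>" unfolding subset.chain_def \<A>_def by blast
    have "extendible M I P S (\<Union>\<C>)" by (rule extendible_chain[OF _ ch c(1)]) (rule def)
    moreover have "R0 \<subseteq> \<Union>\<C>" using c unfolding \<A>_def subset.chain_def by blast
    ultimately show "\<Union>\<C> \<in> \<A>" by (simp add: \<A>_def)
  qed
  then obtain R where RA: "R \<in> \<A>" "\<forall>R'\<in>\<A>. R \<subseteq> R' \<longrightarrow> R' = R" by (elim bexE)
  then have R: "extendible M I P S R" "R0 \<subseteq> R" by (simp_all add: \<A>_def)
  have max: "R' = R" if "extendible M I P S R'" "R \<subseteq> R'" for R'
  proof -
    have "R' \<in> \<A>" using that R(2) by (simp add: \<A>_def)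
    then show ?thesis using RA(2) that(2) by simp
  qed
  have dom: "Domain R = I"
  proof (rule ccontr)
    assume "Domain R \<noteq> I"
    moreover have "Domain R \<subseteq> I" using R(1) unfolding extendible_def by blast
    ultimately obtain i where i: "i \<in> I" "i \<notin> Domain R" by blast
    have "\<exists>x. extendible M I P S (insert (i, x) R)"
      by (rule extendible_step[OF _ sat ne small R(1) i]) (rule def)
    then obtain x where "extendible M I P S (insert (i, x) R)" by (elim exE)
    then have "insert (i, x) R = R" by (rule max) blast
    then show False using i(2) by blast
  qed
  obtain g where g: "\<And>i. i \<in> I \<Longrightarrow> g i \<in> univ M" "\<And>i x. (i, x) \<in> R \<Longrightarrow> g i = x"
    using extendibleD[OF R(1), of "{}"] by auto
  show thesis
  proof (rule that)
    show "g i \<in> univ M" if "i \<in> I" for i using g(1) that by blast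
    show "g i = g0 i" if "i \<in> J" for i using g(2) R(2) that unfolding R0_def by blast
    fix s assume "s \<in> S"
    then obtain h where h: "\<And>i x. (i, x) \<in> R \<Longrightarrow> h i = x" "P s h"
      using extendibleD[OF R(1), of "{s}"] by auto
    have "g i = h i" if "i \<in> I" for i
    proof -
      have "i \<in> Domain R" using dom that by simp
      then obtain x where "(i, x) \<in> R" by (elim DomainE)
      then show ?thesis using g(2) h(1) by simp
    qed
    then show "P s g" using definable_cong[OF def[OF \<open>s \<in> S\<close>], of g h] h(2) by blast
  qed
qed

section \<open>Ramsey theorems for sequences and trees\<close>

lemma ramsey_two_colours:
  "\<exists>n. \<forall>(Q :: nat set \<Rightarrow> bool) V. finite V \<longrightarrow> n \<le> card V \<longrightarrow>
     (\<exists>Y\<subseteq>V. card Y = N \<and>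
        (\<forall>X X'. X \<subseteq> Y \<and> X' \<subseteq> Y \<and> card X = m \<and> card X' = m \<longrightarrow> Q X = Q X'))"
proof -
  obtain n :: nat where n: "partn_lst {..<n} [N, N] m" using ramsey_full by blast
  show ?thesis
  proof (intro exI[of _ n] allI impI)
    fix Q :: "nat set \<Rightarrow> bool" and V :: "nat set"
    assume V: "finite V" "n \<le> card V"
    obtain e where e: "inj_on e {..<n}" "e ` {..<n} \<subseteq> V"
      using card_le_inj[of "{..<n}" V] V by auto
    define f where "f X = (if Q (e ` X) then 1 else 0 :: nat)" for X
    have "f \<in> nsets {..<n} m \<rightarrow> {..<2}" by (auto simp: f_def)
    then have "\<exists>i<2. \<exists>Z\<in>nsets {..<n} ([N, N] ! i). f ` nsets Z m \<subseteq> {i}"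
    proof (rule partn_lstE[OF n])
      fix i H assume "i < length [N, N]" "H \<in> nsets {..<n} ([N, N] ! i)" "f ` nsets H m \<subseteq> {i}"
      then show ?thesis by (intro exI[of _ i] conjI bexI[of _ H]) simp_all
    qed simp
    then obtain i Z where i: "i < 2" and Z: "Z \<in> nsets {..<n} ([N, N] ! i)" "f ` nsets Z m \<subseteq> {i}"
      by (elim exE bexE conjE)
    have card: "card Z = N" "Z \<subseteq> {..<n}" "finite Z"
      using Z(1) i by (auto simp: nsets_def less_2_cases_iff)
    have inj: "inj_on e Z" using e(1) card(2) inj_on_subset by blast
    have "Q X = (i = 1)" if X: "X \<subseteq> e ` Z" "card X = m" for X
    proof -
      obtain W where W: "W \<subseteq> Z" "X = e ` W" using X(1) by (auto simp: subset_image_iff)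
      then have "card W = m" using X(2) inj by (metis card_image inj_on_subset)
      then have "W \<in> nsets Z m" using W card by (auto simp: nsets_def intro: finite_subset)
      then have "f W = i" using Z(2) by blast
      then show ?thesis using W i by (auto simp: f_def split: if_splits)
    qed
    then have "\<forall>X X'. X \<subseteq> e ` Z \<and> X' \<subseteq> e ` Z \<and> card X = m \<and> card X' = m \<longrightarrow> Q X = Q X'"
      by simp
    moreover have "card (e ` Z) = N" using inj card by (simp add: card_image)
    moreover have "e ` Z \<subseteq> V" using e(2) card(2) by blast
    ultimately show "\<exists>Y\<subseteq>V. card Y = N \<and>
        (\<forall>X X'. X \<subseteq> Y \<and> X' \<subseteq> Y \<and> card X = m \<and> card X' = m \<longrightarrow> Q X = Q X')"
      by (intro exI[of _ "e ` Z"] conjI)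
  qed
qed

text \<open>One colouring at a time: the homogeneous set for \<open>S\<close> is made so large
  (\<open>n1\<close>) that it contains one of size \<open>N\<close> for the new colouring. Hence
  \<open>N\<close> varies in the induction.\<close>

lemma ramsey_finite_family:
  assumes "finite S"
  shows "\<exists>n. \<forall>(Q :: 's \<Rightarrow> nat set \<Rightarrow> bool) V. finite V \<longrightarrow> n \<le> card V \<longrightarrow>
     (\<exists>Y\<subseteq>V. card Y = N \<and>
        (\<forall>s\<in>S. \<forall>X X'. X \<subseteq> Y \<and> X' \<subseteq> Y \<and> card X = m s \<and> card X' = m s \<longrightarrow> Q s X = Q s X'))"
  using assms
proof (induction arbitrary: N)
  case empty
  have "\<exists>Y\<subseteq>V. card Y = N" if "N \<le> card V" for V :: "nat set"
    using that by (metis obtain_subset_with_card_n)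
  then show ?case by (intro exI[of _ N]) simp
next
  case (insert s S)
  obtain n1 where n1: "\<forall>(Q :: nat set \<Rightarrow> bool) V. finite V \<longrightarrow> n1 \<le> card V \<longrightarrow>
     (\<exists>Y\<subseteq>V. card Y = N \<and>
        (\<forall>X X'. X \<subseteq> Y \<and> X' \<subseteq> Y \<and> card X = m s \<and> card X' = m s \<longrightarrow> Q X = Q X'))"
    using ramsey_two_colours[of N "m s"] by (elim exE)
  obtain n2 where n2: "\<forall>(Q :: 's \<Rightarrow> nat set \<Rightarrow> bool) V. finite V \<longrightarrow> n2 \<le> card V \<longrightarrow>
     (\<exists>Y\<subseteq>V. card Y = n1 \<and>
        (\<forall>s\<in>S. \<forall>X X'. X \<subseteq> Y \<and> X' \<subseteq> Y \<and> card X = m s \<and> card X' = m s \<longrightarrow> Q s X = Q s X'))"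
    using insert.IH[of n1] by (elim exE)
  show ?case
  proof (intro exI[of _ n2] allI impI)
    fix Q :: "'s \<Rightarrow> nat set \<Rightarrow> bool" and V :: "nat set"
    assume "finite V" "n2 \<le> card V"
    from n2[rule_format, OF this, of Q] obtain Y where Y: "Y \<subseteq> V" "card Y = n1"
      "\<And>t X X'. t \<in> S \<Longrightarrow> X \<subseteq> Y \<Longrightarrow> X' \<subseteq> Y \<Longrightarrow> card X = m t \<Longrightarrow> card X' = m t \<Longrightarrow> Q t X = Q t X'"
      by blast
    have "finite Y" using Y(1) \<open>finite V\<close> finite_subset by blast
    from n1[rule_format, OF this, of "Q s"] Y(2)
    have "\<exists>Z\<subseteq>Y. card Z = N \<and> (\<forall>X X'. X \<subseteq> Z \<and> X' \<subseteq> Z \<and> card X = m s \<and> card X' = m s \<longrightarrow> Q s X = Q s X')"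
      by (simp only: order_refl)
    then obtain Z where Z: "Z \<subseteq> Y" "card Z = N"
      "\<And>X X'. X \<subseteq> Z \<Longrightarrow> X' \<subseteq> Z \<Longrightarrow> card X = m s \<Longrightarrow> card X' = m s \<Longrightarrow> Q s X = Q s X'"
      by (elim exE conjE) blast
    have hom: "Q t X = Q t X'"
      if "t \<in> insert s S" "X \<subseteq> Z" "X' \<subseteq> Z" "card X = m t" "card X' = m t" for t X X'
    proof (cases "t = s")
      case True
      show ?thesis unfolding True by (rule Z(3)) (use that True in simp_all)
    next
      case False
      then show ?thesis by (intro Y(3)) (use that Z(1) in auto)
    qed
    have "\<forall>s\<in>insert s S. \<forall>X X'. X \<subseteq> Z \<and> X' \<subseteq> Z \<and>
        card X = m s \<and> card X' = m s \<longrightarrow> Q s X = Q s X'"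
      by (intro ballI allI impI, elim conjE, rule hom)
    moreover have "Z \<subseteq> V" using Z(1) Y(1) by simp
    ultimately show "\<exists>Y\<subseteq>V. card Y = N \<and> (\<forall>s\<in>insert s S. \<forall>X X'. X \<subseteq> Y \<and> X' \<subseteq> Y \<and>
        card X = m s \<and> card X' = m s \<longrightarrow> Q s X = Q s X')"
      using Z(2) by (intro exI[of _ Z] conjI)
  qed
qed

lemma strict_mono_on_image_unique:
  fixes w w' :: "nat \<Rightarrow> nat"
  assumes "finite U" "strict_mono_on U w" "strict_mono_on U w'" "w ` U = w' ` U"
  shows "\<forall>u\<in>U. w u = w' u"
  using assms
proof (induction "card U" arbitrary: U)
  case 0
  then show ?case by simp
next
  case (Suc n)
  define u where "u = Max U"
  have u: "u \<in> U" "\<And>x. x \<in> U \<Longrightarrow> x \<le> u" using Suc.hyps(2) Suc.prems(1) unfolding u_def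
    by (auto intro: Max_in)
  have mx: "Max (v ` U) = v u" if "strict_mono_on U v" for v :: "nat \<Rightarrow> nat"
  proof (rule Max_eqI)
    fix y assume "y \<in> v ` U"
    then obtain x where "x \<in> U" "y = v x" by blast
    then show "y \<le> v u" using u that by (metis le_less strict_mono_onD)
  qed (use u Suc.prems(1) in auto)
  have eq: "w u = w' u" using mx Suc.prems by metis
  have img: "v ` (U - {u}) = v ` U - {v u}" if "strict_mono_on U v" for v :: "nat \<Rightarrow> nat"
    using inj_on_image_set_diff[OF strict_mono_on_imp_inj_on[OF that], of U "{u}"] u(1) by auto
  have "\<forall>x\<in>U - {u}. w x = w' x"
  proof (rule Suc.hyps(1))
    show "n = card (U - {u})" using Suc.hyps(2) Suc.prems(1) u by simp
    show "strict_mono_on (U - {u}) w" "strict_mono_on (U - {u}) w'"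
      using Suc.prems(2,3) unfolding strict_mono_on_def by blast+
    show "w ` (U - {u}) = w' ` (U - {u})"
      unfolding img[OF Suc.prems(2)] img[OF Suc.prems(3)] using Suc.prems(4) eq by simp
  qed (use Suc.prems in simp)
  then show ?case using eq by auto
qed

text \<open>On a finite set an increasing map is determined by its image, so colourings of
  increasing maps are colourings of sets of \<open>card (U s)\<close> numbers. Domains
  \<open>U s\<close> with gaps are allowed because the entries of a coded tree are indexed by such
  sets.\<close>

lemma ramsey_strict_mono:
  assumes "finite S" "\<And>s. s \<in> S \<Longrightarrow> finite (U s)"
  shows "\<exists>n. \<forall>(P :: 's \<Rightarrow> (nat \<Rightarrow> nat) \<Rightarrow> bool) V. finite V \<longrightarrow> n \<le> card V \<longrightarrow>
    (\<forall>s\<in>S. \<forall>w w'. (\<forall>u\<in>U s. w u = w' u) \<longrightarrow> P s w = P s w') \<longrightarrow>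
    (\<exists>Y\<subseteq>V. card Y = N \<and>
      (\<forall>s\<in>S. \<forall>w w'. strict_mono_on (U s) w \<and> strict_mono_on (U s) w' \<and>
         w ` U s \<subseteq> Y \<and> w' ` U s \<subseteq> Y \<longrightarrow> P s w = P s w'))"
proof -
  obtain n where n: "\<forall>(Q :: 's \<Rightarrow> nat set \<Rightarrow> bool) V. finite V \<longrightarrow> n \<le> card V \<longrightarrow>
     (\<exists>Y\<subseteq>V. card Y = N \<and> (\<forall>s\<in>S. \<forall>X X'. X \<subseteq> Y \<and> X' \<subseteq> Y \<and>
       card X = card (U s) \<and> card X' = card (U s) \<longrightarrow> Q s X = Q s X'))"
    using ramsey_finite_family[OF assms(1), of N "\<lambda>s. card (U s)"] by (elim exE)
  show ?thesis
  proof (intro exI[of _ n] allI impI)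
    fix P :: "'s \<Rightarrow> (nat \<Rightarrow> nat) \<Rightarrow> bool" and V :: "nat set"
    assume V: "finite V" "n \<le> card V"
      and P: "\<forall>s\<in>S. \<forall>w w'. (\<forall>u\<in>U s. w u = w' u) \<longrightarrow> P s w = P s w'"
    define Q where "Q s X = (\<exists>w. strict_mono_on (U s) w \<and> w ` U s = X \<and> P s w)" for s X
    have Q: "Q s (w ` U s) = P s w" if "s \<in> S" "strict_mono_on (U s) w" for s w
    proof
      assume "Q s (w ` U s)"
      then obtain w' where w': "strict_mono_on (U s) w'" "w' ` U s = w ` U s" "P s w'"
        unfolding Q_def by (elim exE conjE)
      then have "\<forall>u\<in>U s. w' u = w u"
        using strict_mono_on_image_unique[OF assms(2)[OF that(1)]] that(2) by simp
      then have "P s w' = P s w" using P that(1) by blast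
      then show "P s w" using w'(3) by simp
    qed (use that(2) in \<open>auto simp: Q_def\<close>)
    from n[rule_format, OF V, of Q] obtain Y where Y: "Y \<subseteq> V" "card Y = N" "\<And>s X X'. s \<in> S \<Longrightarrow> X \<subseteq> Y \<Longrightarrow>
       X' \<subseteq> Y \<Longrightarrow> card X = card (U s) \<Longrightarrow> card X' = card (U s) \<Longrightarrow> Q s X = Q s X'" by blast
    have hom: "P s w = P s w'" if "s \<in> S" and w: "strict_mono_on (U s) w" "strict_mono_on (U s) w'"
         "w ` U s \<subseteq> Y" "w' ` U s \<subseteq> Y" for s w w'
    proof -
      have "card (v ` U s) = card (U s)" if "strict_mono_on (U s) v" for v :: "nat \<Rightarrow> nat"
        using that strict_mono_on_imp_inj_on card_image by blast
      then have "Q s (w ` U s) = Q s (w' ` U s)" using Y(3)[OF \<open>s \<in> S\<close> w(3,4)] w(1,2) by blast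
      then show ?thesis using Q \<open>s \<in> S\<close> w by simp
    qed
    have "\<forall>s\<in>S. \<forall>w w'. strict_mono_on (U s) w \<and> strict_mono_on (U s) w' \<and>
         w ` U s \<subseteq> Y \<and> w' ` U s \<subseteq> Y \<longrightarrow> P s w = P s w'"
      by (intro ballI allI impI, elim conjE, rule hom)
    then show "\<exists>Y\<subseteq>V. card Y = N \<and>
      (\<forall>s\<in>S. \<forall>w w'. strict_mono_on (U s) w \<and> strict_mono_on (U s) w' \<and>
         w ` U s \<subseteq> Y \<and> w' ` U s \<subseteq> Y \<longrightarrow> P s w = P s w')"
      using Y(1,2) by (intro exI[of _ Y] conjI)
  qed
qed

section \<open>Codes of finite trees by sequences of natural numbers\<close>

text \<open>
  A finite tree listed in depth-first order: \<open>R i j\<close> says that the \<open>i\<close>-th node is an ancestor of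
  the \<open>j\<close>-th one (or equal to it).  Convexity says that subtrees are intervals.
\<close>

definition dfs :: "nat \<Rightarrow> (nat \<Rightarrow> nat \<Rightarrow> bool) \<Rightarrow> bool" where
  "dfs N R \<longleftrightarrow> (\<forall>i j. R i j \<longrightarrow> i \<le> j \<and> j < N) \<and> (\<forall>i<N. R i i) \<and>
     (\<forall>i j k. R i j \<longrightarrow> R j k \<longrightarrow> R i k) \<and>
     (\<forall>i j k. R i k \<longrightarrow> i \<le> j \<longrightarrow> j \<le> k \<longrightarrow> R i j)"

definition anc :: "(nat \<Rightarrow> nat \<Rightarrow> bool) \<Rightarrow> (nat \<Rightarrow> nat) \<Rightarrow> nat \<Rightarrow> nat \<Rightarrow> nat" where
  "anc R h k p = (LEAST i. R i k \<and> p \<le> h i)"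

text \<open>
  The node \<open>k\<close> becomes a sequence of length \<open>h k + 1\<close>; the segment between the level of the
  parent of \<open>i\<close> and the level of \<open>i\<close> is filled with values that belong to \<open>i\<close>.
\<close>

definition code :: "(nat \<Rightarrow> nat \<Rightarrow> bool) \<Rightarrow> nat \<Rightarrow> (nat \<Rightarrow> nat) \<Rightarrow> (nat \<Rightarrow> nat) \<Rightarrow> nat \<Rightarrow> nat list" where
  "code R n h w k = map (\<lambda>p. w (anc R h k p * n + p)) [0..<Suc (h k)]"

text \<open>The arguments at which the codes read \<open>w\<close>: entry \<open>p\<close> is stored
  at \<open>k * n + p\<close> for its owner \<open>k\<close>, the first ancestor whose level reaches
  \<open>p\<close>. For levels below \<open>n\<close> the order of these numbers is the
  lexicographic order of the pairs (owner, entry).\<close>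

definition used :: "nat \<Rightarrow> (nat \<Rightarrow> nat \<Rightarrow> bool) \<Rightarrow> nat \<Rightarrow> (nat \<Rightarrow> nat) \<Rightarrow> nat set" where
  "used q R n h = {k * n + p | k p. k < q \<and> p \<le> h k \<and> (\<forall>i. R i k \<and> i \<noteq> k \<longrightarrow> h i < p)}"

lemma dfsD:
  assumes "dfs N R"
  shows "R i j \<Longrightarrow> i \<le> j" "R i j \<Longrightarrow> j < N" "i < N \<Longrightarrow> R i i" "R i j \<Longrightarrow> R j k \<Longrightarrow> R i k"
    "R i k \<Longrightarrow> i \<le> j \<Longrightarrow> j \<le> k \<Longrightarrow> R i j"
  using assms unfolding dfs_def by blast+

lemma anc:
  assumes "dfs N R" "k < N" "p \<le> h k"
  shows "R (anc R h k p) k" "p \<le> h (anc R h k p)"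
    "\<And>i. R i k \<Longrightarrow> p \<le> h i \<Longrightarrow> anc R h k p \<le> i"
proof -
  have "R k k \<and> p \<le> h k" using assms(3) dfsD(3)[OF assms(1,2)] by simp
  then have "R (anc R h k p) k \<and> p \<le> h (anc R h k p)" unfolding anc_def by (rule LeastI)
  then show "R (anc R h k p) k" "p \<le> h (anc R h k p)" by simp_all
  show "anc R h k p \<le> i" if "R i k" "p \<le> h i" for i
    unfolding anc_def by (rule Least_le) (use that in simp)
qed

text \<open>By convexity an ancestor of \<open>j\<close> that is not after \<open>i\<close> is an
  ancestor of \<open>i\<close>. Hence \<open>i\<close> and \<open>j\<close> have the same owner of
  entry \<open>p\<close>, and the code of \<open>i\<close> becomes an initial segment of that of
  \<open>j\<close>.\<close>

lemma anc_eq: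
  assumes "dfs N R" "R i j" "p \<le> h i"
  shows "anc R h i p = anc R h j p"
proof -
  note D = dfsD[OF assms(1)]
  have ij: "i \<le> j" "j < N" "i < N" using D(1,2)[OF assms(2)] by auto
  note ai = anc[where R = R, OF assms(1) ij(3), of p h, OF assms(3)]
  have j: "R j j" "R i j" using D(3) ij assms(2) by auto
  have "R (anc R h j p) j \<and> p \<le> h (anc R h j p)"
    unfolding anc_def by (rule LeastI[of _ i]) (use assms in simp)
  moreover have "anc R h j p \<le> i" unfolding anc_def by (rule Least_le) (use assms in simp)
  ultimately have "R (anc R h j p) i" "p \<le> h (anc R h j p)" using D(5) ij(1) by blast+
  then have "anc R h i p \<le> anc R h j p" by (rule ai(3))
  moreover have "anc R h j p \<le> anc R h i p"
    unfolding anc_def[of R h j] by (rule Least_le) (use ai(1,2) D(4) assms(2) in blast)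
  ultimately show ?thesis by simp
qed

lemma code_cong:
  assumes R: "dfs q R" and k: "k < q" and w: "\<And>u. u \<in> used q R n h \<Longrightarrow> w u = w' u"
  shows "code R n h w k = code R n h w' k"
proof -
  have "w (anc R h k p * n + p) = w' (anc R h k p * n + p)" if "p \<le> h k" for p
  proof (rule w)
    note a = anc[where R = R, OF R k, of p h, OF that]
    have "h i < p" if "R i (anc R h k p)" "i \<noteq> anc R h k p" for i
      using a(3)[of i] dfsD(4)[OF R that(1) a(1)] dfsD(1)[OF R that(1)] that(2) by fastforce
    moreover have "anc R h k p < q" using dfsD(1)[OF R a(1)] k by simp
    ultimately show "anc R h k p * n + p \<in> used q R n h" unfolding used_def using a(2) by blast
  qed
  then show ?thesis unfolding code_def by auto
qed

lemma code_cong_level: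
  assumes R: "dfs q R" and k: "k < q" and h: "\<And>i. i < q \<Longrightarrow> h i = h' i"
  shows "code R n h w k = code R n h' w k" "used q R n h = used q R n h'"
proof -
  have "R i k \<and> p \<le> h i \<longleftrightarrow> R i k \<and> p \<le> h' i" for i p
    using dfsD(1)[OF R, of i k] k h[of i] by auto
  then have "anc R h k = anc R h' k" unfolding anc_def fun_eq_iff by simp
  then show "code R n h w k = code R n h' w k" unfolding code_def h[OF k] by simp
  have "k < q \<and> p \<le> h k \<and> (\<forall>i. R i k \<and> i \<noteq> k \<longrightarrow> h i < p) \<longleftrightarrow>
      k < q \<and> p \<le> h' k \<and> (\<forall>i. R i k \<and> i \<noteq> k \<longrightarrow> h' i < p)" for k p
    using dfsD(1)[OF R] h by (metis le_less_trans)
  then show "used q R n h = used q R n h'" unfolding used_def by simp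
qed

text \<open>Closure under meets without a meet operation: for the greatest common ancestor
  \<open>a\<close> of two selected nodes, \<open>a \<le> t l\<close> forces
  \<open>t l = a\<close>.\<close>

definition meet_closed :: "(nat \<Rightarrow> nat \<Rightarrow> bool) \<Rightarrow> nat \<Rightarrow> (nat \<Rightarrow> nat) \<Rightarrow> bool" where
  "meet_closed R q t \<longleftrightarrow> (\<forall>k<q. \<forall>k'<q. \<forall>a. R a (t k) \<longrightarrow> R a (t k') \<longrightarrow>
     (\<exists>l<q. R (t l) (t k) \<and> R (t l) (t k') \<and> a \<le> t l))"

definition pull_back :: "(nat \<Rightarrow> nat \<Rightarrow> bool) \<Rightarrow> nat \<Rightarrow> (nat \<Rightarrow> nat) \<Rightarrow> nat \<Rightarrow> nat \<Rightarrow> bool" where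
  "pull_back R q t i j \<longleftrightarrow> i < q \<and> j < q \<and> R (t i) (t j)"

lemma dfs_pull_back:
  assumes "dfs N R" "strict_mono_on {..<q} t" "t ` {..<q} \<subseteq> {..<N}"
  shows "dfs q (pull_back R q t)"
proof -
  note D = dfsD[OF assms(1)]
  have le: "t i \<le> t j \<longleftrightarrow> i \<le> j" if "i < q" "j < q" for i j
    using assms(2) that by (simp add: strict_mono_on_less_eq)
  have N: "t i < N" if "i < q" for i using assms(3) that by auto
  show ?thesis unfolding dfs_def
  proof (intro conjI allI impI)
    fix i j assume "pull_back R q t i j"
    then show "i \<le> j" "j < q" using D(1) le unfolding pull_back_def by auto
  next
    fix i assume "i < q"
    then show "pull_back R q t i i" using D(3) N unfolding pull_back_def by auto
  next
    fix i j k assume "pull_back R q t i j" "pull_back R q t j k"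
    then show "pull_back R q t i k" using D(4) unfolding pull_back_def by blast
  next
    fix i j k assume a: "pull_back R q t i k" "i \<le> j" "j \<le> k"
    then have "t i \<le> t j" "t j \<le> t k" "i < q" "j < q" "R (t i) (t k)"
      using le unfolding pull_back_def by auto
    then show "pull_back R q t i j" using D(5) unfolding pull_back_def by blast
  qed
qed

text \<open>The code of a subtree inside a large tree is a code of the subtree on its own, with the
  values re-indexed. The re-indexing is increasing because entries first used by a later node of the
  subtree have later owners in the large tree; this is what closure under meets is for. So the
  colour of a subtree can be computed from its shape, its levels and an increasing choice of
  values.\<close>

lemma code_restrict:
  assumes R: "dfs N R" and t: "strict_mono_on {..<q} t" "t ` {..<q} \<subseteq> {..<N}" "meet_closed R q t"
    and h: "strict_mono_on {..<N} h" "\<And>i. i < N \<Longrightarrow> h i < n"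
    and v: "strict_mono_on {..<N * n} v"
  obtains w where "\<And>k. k < q \<Longrightarrow> code R n h v (t k) = code (pull_back R q t) n (h \<circ> t) w k"
    and "strict_mono_on (used q (pull_back R q t) n (h \<circ> t)) w"
    and "w ` used q (pull_back R q t) n (h \<circ> t) \<subseteq> v ` {..<N * n}"
proof -
  note D = dfsD[OF R]
  let ?R = "pull_back R q t"
  note D' = dfsD[OF dfs_pull_back[OF R t(1,2)]]
  have N: "t i < N" if "i < q" for i using t(2) that by auto
  \<comment> \<open>\<open>W k p\<close> is the place where the large tree stores entry
    \<open>p\<close> of the node \<open>t k\<close>; \<open>w\<close> recovers \<open>k\<close> and
    \<open>p\<close> from \<open>k * n + p\<close>, as \<open>p < n\<close>.\<close>
  define W where "W k p = anc R h (t k) p * n + p" for k p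
  define w where "w u = v (W (u div n) (u mod n))" for u
  have w: "w (k * n + p) = v (W k p)" if "p < n" for k p
    using that by (simp add: w_def)
  have bound: "W k p < N * n" if "k < q" "p \<le> h (t k)" for k p
  proof -
    have "anc R h (t k) p < N" using D(1)[OF anc(1)[where h = h, OF R N[OF that(1)] that(2)]] N[OF that(1)] by simp
    moreover have "p < n" using h(2)[OF N[OF that(1)]] that(2) by simp
    ultimately have "W k p < Suc (anc R h (t k) p) * n" "Suc (anc R h (t k) p) * n \<le> N * n"
      unfolding W_def by (simp, simp only: mult_le_mono1 Suc_leI)
    then show ?thesis by linarith
  qed
  have code: "code R n h v (t k) = code ?R n (h \<circ> t) w k" if k: "k < q" for k
  proof -
    have "v (anc R h (t k) p * n + p) = w (anc ?R (h \<circ> t) k p * n + p)" if p: "p \<le> h (t k)" for p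
    proof -
      have p': "p \<le> (h \<circ> t) k" using p by simp
      note a = anc(1,2)[where R = ?R and h = "h \<circ> t", OF dfs_pull_back[OF R t(1,2)] k p']
      have "R (t (anc ?R (h \<circ> t) k p)) (t k)" using a(1) unfolding pull_back_def by simp
      moreover have "p \<le> h (t (anc ?R (h \<circ> t) k p))" using a(2) by simp
      ultimately have "anc R h (t (anc ?R (h \<circ> t) k p)) p = anc R h (t k) p" by (rule anc_eq[where h = h, OF R])
      moreover have "p < n" using p h(2)[OF N[OF k]] by simp
      ultimately show ?thesis by (simp add: w W_def)
    qed
    then show ?thesis unfolding code_def by simp
  qed
  have used: "\<exists>k p. u = k * n + p \<and> k < q \<and> p \<le> h (t k) \<and> p < n \<and> (\<forall>i. ?R i k \<and> i \<noteq> k \<longrightarrow> h (t i) < p)"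
    if "u \<in> used q ?R n (h \<circ> t)" for u
    using that h(2)[OF N] unfolding used_def by (auto intro: le_less_trans)
  have mono: "W k p < W k' p'"
    if k: "k < q" "p \<le> h (t k)" "p < n"
      and k': "k' < q" "p' \<le> h (t k')" "p' < n" "\<forall>i. ?R i k' \<and> i \<noteq> k' \<longrightarrow> h (t i) < p'"
      and less: "k * n + p < k' * n + p'" for k p k' p'
  proof -
    note a = anc[where h = h, OF R N[OF k(1)] k(2)] and a' = anc[where h = h, OF R N[OF k'(1)] k'(2)]
    consider "k = k'" "p < p'" | "k < k'"
    proof -
      have "k \<le> k'"
      proof (rule ccontr)
        assume "\<not> k \<le> k'"
        then have "Suc k' * n \<le> k * n" by (simp only: mult_le_mono1 Suc_leI not_le)
        then show False using less k'(3) by simp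
      qed
      then show thesis using that less by (cases "k = k'") auto
    qed
    then show ?thesis
    proof cases
      case 1
      have "anc R h (t k) p \<le> anc R h (t k') p'"
        using a(3)[of "anc R h (t k') p'"] a'(1,2) 1 by auto
      then show ?thesis unfolding W_def using 1(2) by (simp add: add_le_less_mono)
    next
      case 2
      have tk: "t k < t k'" using t(1) 2 k(1) k'(1) by (simp add: strict_mono_on_less)
      \<comment> \<open>Otherwise the owner of entry \<open>p'\<close> of \<open>t k'\<close> is a
        common ancestor of \<open>t k\<close> and \<open>t k'\<close>. Then some selected proper
        ancestor \<open>t l\<close> of \<open>t k'\<close> lies at least as high, so its level
        reaches \<open>p'\<close>, whereas the entry was used by \<open>k'\<close> and by none of
        its selected ancestors.\<close>
      have "anc R h (t k) p < anc R h (t k') p'"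
      proof (rule ccontr)
        let ?a = "anc R h (t k') p'"
        assume "\<not> ?thesis"
        then have "?a \<le> t k" using D(1)[OF a(1)] by simp
        then have "R ?a (t k)" using D(5)[OF a'(1)] tk by simp
        then obtain l where l: "l < q" "R (t l) (t k)" "R (t l) (t k')" "?a \<le> t l"
          using t(3) a'(1) k(1) k'(1) unfolding meet_closed_def by blast
        have "l \<noteq> k'" using D(1)[OF l(2)] tk by auto
        then have "h (t l) < p'" using k'(4) l(1,3) k'(1) unfolding pull_back_def by blast
        moreover have "h ?a \<le> h (t l)"
          using strict_mono_on_leD[OF h(1)] l(4) N[OF l(1)] by simp
        ultimately show False using a'(2) by simp
      qed
      then have "Suc (anc R h (t k) p) * n \<le> anc R h (t k') p' * n"
        by (simp only: mult_le_mono1 Suc_leI)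
      then show ?thesis unfolding W_def using k(3) by simp
    qed
  qed
  show thesis
  proof (rule that[OF code])
    show "strict_mono_on (used q ?R n (h \<circ> t)) w"
    proof (rule strict_mono_onI)
      fix u u' assume u: "u \<in> used q ?R n (h \<circ> t)" "u' \<in> used q ?R n (h \<circ> t)" "u < u'"
      obtain k p where k: "u = k * n + p" "k < q" "p \<le> h (t k)" "p < n" using used[OF u(1)] by blast
      obtain k' p' where k': "u' = k' * n + p'" "k' < q" "p' \<le> h (t k')" "p' < n"
        "\<forall>i. ?R i k' \<and> i \<noteq> k' \<longrightarrow> h (t i) < p'" using used[OF u(2)] by blast
      have "W k p < W k' p'" using mono[OF k(2-4) k'(2-5)] u(3) k(1) k'(1) by simp
      then show "w u < w u'"
        using strict_mono_onD[OF v, of "W k p" "W k' p'"] bound[OF k(2,3)] bound[OF k'(2,3)]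
        by (simp add: k(1) k'(1) w[OF k(4)] w[OF k'(4)])
    qed
    show "w ` used q ?R n (h \<circ> t) \<subseteq> v ` {..<N * n}"
    proof
      fix y assume "y \<in> w ` used q ?R n (h \<circ> t)"
      then obtain u where u: "u \<in> used q ?R n (h \<circ> t)" "y = w u" by blast
      obtain k p where k: "u = k * n + p" "k < q" "p \<le> h (t k)" "p < n" using used[OF u(1)] by blast
      then show "y \<in> v ` {..<N * n}" using u(2) w[OF k(4)] bound[OF k(2,3)] by auto
    qed
  qed
qed

text \<open>The last entry of a code is owned by the node itself, as the levels increase strictly.
  Since \<open>v\<close> is injective, a node whose code agrees with it there has that node among
  its ancestors.\<close>

lemma prefix_code_iff:
  assumes R: "dfs N R" and h: "strict_mono_on {..<N} h" "\<And>i. i < N \<Longrightarrow> h i < n"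
    and v: "strict_mono_on {..<N * n} v" and ij: "i < N" "j < N"
  shows "prefix (code R n h v i) (code R n h v j) \<longleftrightarrow> R i j"
proof
  note D = dfsD[OF R]
  have len: "length (code R n h v k) = Suc (h k)" for k by (simp add: code_def)
  have nth: "code R n h v k ! p = v (anc R h k p * n + p)" if "p \<le> h k" for k p
    using that by (simp add: code_def del: upt_Suc)
  {
    assume "R i j"
    then have "h i \<le> h j" using strict_mono_on_leD[OF h(1)] D(1) ij by simp
    show "prefix (code R n h v i) (code R n h v j)"
      unfolding prefix_def
    proof (intro exI nth_equalityI)
      let ?zs = "drop (Suc (h i)) (code R n h v j)"
      show "length (code R n h v j) = length (code R n h v i @ ?zs)"
        using \<open>h i \<le> h j\<close> by (simp add: len)
      fix p assume "p < length (code R n h v j)"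
      then have p: "p \<le> h j" by (simp add: len)
      show "code R n h v j ! p = (code R n h v i @ ?zs) ! p"
      proof (cases "p \<le> h i")
        case True
        then show ?thesis using anc_eq[where h = h, OF R \<open>R i j\<close> True] by (simp add: nth_append len nth p)
      next
        case False
        then show ?thesis using \<open>h i \<le> h j\<close> by (simp add: nth_append len)
      qed
    qed
  }
  assume pre: "prefix (code R n h v i) (code R n h v j)"
  then have "h i \<le> h j" using prefix_length_le len by fastforce
  then have "i \<le> j" using h(1) ij by (simp add: strict_mono_on_less_eq)
  have "code R n h v i ! h i = code R n h v j ! h i"
    using pre len[of i] by (auto simp: prefix_def nth_append)
  then have eq: "v (anc R h i (h i) * n + h i) = v (anc R h j (h i) * n + h i)"
    using nth \<open>h i \<le> h j\<close> by simp
  note ai = anc[OF R ij(1), of "h i" h, simplified] and aj = anc[where h = h, OF R ij(2) \<open>h i \<le> h j\<close>]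
  have lt: "anc R h i (h i) < N" "anc R h j (h i) < N" using D(1)[OF ai(1)] D(1)[OF aj(1)] ij by auto
  have b: "k * n + h i < N * n" if "k < N" for k
  proof -
    have "k * n + h i < Suc k * n" using h(2)[OF ij(1)] by simp
    also have "\<dots> \<le> N * n" using that by (simp only: mult_le_mono1 Suc_leI)
    finally show ?thesis .
  qed
  have "anc R h i (h i) * n + h i = anc R h j (h i) * n + h i"
    using strict_mono_on_imp_inj_on[OF v] eq b[OF lt(1)] b[OF lt(2)] by (auto dest: inj_onD)
  moreover have "n > 0" using h(2)[OF ij(1)] by simp
  ultimately have same: "anc R h i (h i) = anc R h j (h i)" by simp
  have "i \<le> anc R h i (h i)"
    using ai(2) strict_mono_on_less_eq[OF h(1), of i "anc R h i (h i)"] ij lt by simp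
  then have "anc R h i (h i) = i" using D(1)[OF ai(1)] by simp
  then show "R i j" using aj(1) same by simp
qed

lemma enum_nat_set:
  fixes Y :: "nat set"
  assumes "finite Y" "card Y = N"
  obtains v where "strict_mono_on {..<N} v" "v ` {..<N} = Y"
proof
  let ?v = "\<lambda>i. sorted_list_of_set Y ! i"
  show "strict_mono_on {..<N} ?v"
    using assms strict_sorted_list_of_set[of Y]
    by (auto simp: strict_mono_on_def sorted_wrt_iff_nth_less)
  show "?v ` {..<N} = Y"
    using assms by (metis atLeast_upt image_set length_sorted_list_of_set map_nth set_sorted_list_of_set)
qed

text \<open>
  Ramsey's theorem is used twice: first for the values of the sequences, for each of the finitely
  many choices of levels, and then for the levels.  The levels increase along the depth-first
  order, so that the order of the levels carries no information of its own.
\<close>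

lemma tree_ramsey:
  fixes \<chi> :: "'s \<Rightarrow> nat list list \<Rightarrow> bool"
  assumes R: "dfs N R" and S: "finite S"
    and t: "\<And>s. s \<in> S \<Longrightarrow> strict_mono_on {..<q s} (t s) \<and> t s ` {..<q s} \<subseteq> {..<N} \<and> meet_closed R (q s) (t s)"
    and t': "\<And>s. s \<in> S \<Longrightarrow> strict_mono_on {..<q s} (t' s) \<and> t' s ` {..<q s} \<subseteq> {..<N} \<and> meet_closed R (q s) (t' s)"
    and tt': "\<And>s. s \<in> S \<Longrightarrow> pull_back R (q s) (t s) = pull_back R (q s) (t' s)"
    and js: "\<And>s. s \<in> S \<Longrightarrow> set (js s) \<subseteq> {..<q s}"
  obtains F where "\<And>i j. i < N \<Longrightarrow> j < N \<Longrightarrow> prefix (F i) (F j) \<longleftrightarrow> R i j"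
    and "\<And>s. s \<in> S \<Longrightarrow> \<chi> s (map (\<lambda>j. F (t s j)) (js s)) = \<chi> s (map (\<lambda>j. F (t' s j)) (js s))"
proof -
  define R' where "R' s = pull_back R (q s) (t s)" for s
  have R': "dfs (q s) (R' s)" if "s \<in> S" for s
    unfolding R'_def using dfs_pull_back[OF R] t[OF that] by blast
  have ex1: "\<exists>n. \<forall>(P :: 's \<Rightarrow> (nat \<Rightarrow> nat) \<Rightarrow> bool) V. finite V \<longrightarrow> n \<le> card V \<longrightarrow>
    (\<forall>s\<in>S. \<forall>w w'. (\<forall>u\<in>{..<q s}. w u = w' u) \<longrightarrow> P s w = P s w') \<longrightarrow>
    (\<exists>Y\<subseteq>V. card Y = N \<and>
      (\<forall>s\<in>S. \<forall>w w'. strict_mono_on {..<q s} w \<and> strict_mono_on {..<q s} w' \<and>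
         w ` {..<q s} \<subseteq> Y \<and> w' ` {..<q s} \<subseteq> Y \<longrightarrow> P s w = P s w'))"
    by (rule ramsey_strict_mono[OF S]) simp
  obtain n where n: "\<forall>(P :: 's \<Rightarrow> (nat \<Rightarrow> nat) \<Rightarrow> bool) V. finite V \<longrightarrow> n \<le> card V \<longrightarrow>
    (\<forall>s\<in>S. \<forall>w w'. (\<forall>u\<in>{..<q s}. w u = w' u) \<longrightarrow> P s w = P s w') \<longrightarrow>
    (\<exists>Y\<subseteq>V. card Y = N \<and>
      (\<forall>s\<in>S. \<forall>w w'. strict_mono_on {..<q s} w \<and> strict_mono_on {..<q s} w' \<and>
         w ` {..<q s} \<subseteq> Y \<and> w' ` {..<q s} \<subseteq> Y \<longrightarrow> P s w = P s w'))"
    using ex1 by (elim exE)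
  \<comment> \<open>The bound \<open>n\<close> on the levels is fixed before the values are chosen:
    the colourings of the values are indexed by lists of levels, and only the bound makes these
    lists finite in number.\<close>
  define S2 where "S2 = (SIGMA s:S. {hs. set hs \<subseteq> {..<n} \<and> length hs = q s})"
  define U where "U = (\<lambda>(s, hs). used (q s) (R' s) n ((!) hs))"
  define P2 where "P2 = (\<lambda>(s, hs) w. \<chi> s (map (code (R' s) n ((!) hs) w) (js s)))"
  have S2: "finite S2" unfolding S2_def using S by (auto intro: finite_lists_length_eq)
  have "finite (used q0 R0 n h)" for q0 R0 h
  proof -
    have "used q0 R0 n h \<subseteq> (\<Union>k<q0. (\<lambda>p. k * n + p) ` {..h k})" unfolding used_def by auto
    then show ?thesis by (rule finite_subset) simp
  qed
  then have U: "finite (U x)" for x by (simp add: U_def split: prod.splits)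
  have ex2: "\<exists>m. \<forall>(P :: 's \<times> nat list \<Rightarrow> (nat \<Rightarrow> nat) \<Rightarrow> bool) V. finite V \<longrightarrow> m \<le> card V \<longrightarrow>
    (\<forall>x\<in>S2. \<forall>w w'. (\<forall>u\<in>U x. w u = w' u) \<longrightarrow> P x w = P x w') \<longrightarrow>
    (\<exists>Y\<subseteq>V. card Y = N * n \<and>
      (\<forall>x\<in>S2. \<forall>w w'. strict_mono_on (U x) w \<and> strict_mono_on (U x) w' \<and>
         w ` U x \<subseteq> Y \<and> w' ` U x \<subseteq> Y \<longrightarrow> P x w = P x w'))"
    by (rule ramsey_strict_mono[OF S2 U])
  obtain m where m: "\<forall>(P :: 's \<times> nat list \<Rightarrow> (nat \<Rightarrow> nat) \<Rightarrow> bool) V. finite V \<longrightarrow> m \<le> card V \<longrightarrow>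
    (\<forall>x\<in>S2. \<forall>w w'. (\<forall>u\<in>U x. w u = w' u) \<longrightarrow> P x w = P x w') \<longrightarrow>
    (\<exists>Y\<subseteq>V. card Y = N * n \<and>
      (\<forall>x\<in>S2. \<forall>w w'. strict_mono_on (U x) w \<and> strict_mono_on (U x) w' \<and>
         w ` U x \<subseteq> Y \<and> w' ` U x \<subseteq> Y \<longrightarrow> P x w = P x w'))"
    using ex2 by (elim exE)
  have P2: "\<forall>x\<in>S2. \<forall>w w'. (\<forall>u\<in>U x. w u = w' u) \<longrightarrow> P2 x w = P2 x w'"
  proof (intro ballI allI impI)
    fix x and w w' :: "nat \<Rightarrow> nat" assume x: "x \<in> S2" and w: "\<forall>u\<in>U x. w u = w' u"
    obtain s hs where s: "x = (s, hs)" by (cases x)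
    then have "s \<in> S" using x by (simp add: S2_def)
    have "code (R' s) n ((!) hs) w k = code (R' s) n ((!) hs) w' k" if "k < q s" for k
      by (rule code_cong[OF R'[OF \<open>s \<in> S\<close>] that]) (use w in \<open>simp add: U_def s\<close>)
    then have "map (code (R' s) n ((!) hs) w) (js s) = map (code (R' s) n ((!) hs) w') (js s)"
      using js[OF \<open>s \<in> S\<close>] by auto
    then show "P2 x w = P2 x w'" unfolding P2_def s by (simp only: prod.case)
  qed
  have "\<exists>Y\<subseteq>{..<m}. card Y = N * n \<and>
      (\<forall>x\<in>S2. \<forall>w w'. strict_mono_on (U x) w \<and> strict_mono_on (U x) w' \<and>
         w ` U x \<subseteq> Y \<and> w' ` U x \<subseteq> Y \<longrightarrow> P2 x w = P2 x w')"
    by (rule m[rule_format, of "{..<m}" P2, OF _ _ P2[rule_format]]) simp_all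
  then obtain Y2 where Y2: "Y2 \<subseteq> {..<m}" "card Y2 = N * n" and hom2:
      "\<forall>x\<in>S2. \<forall>w w'. strict_mono_on (U x) w \<and> strict_mono_on (U x) w' \<and>
         w ` U x \<subseteq> Y2 \<and> w' ` U x \<subseteq> Y2 \<longrightarrow> P2 x w = P2 x w'"
    by (elim exE conjE)
  obtain v where v: "strict_mono_on {..<N * n} v" "v ` {..<N * n} = Y2"
    using enum_nat_set[of Y2] Y2 finite_subset by blast
  \<comment> \<open>The colour that a choice of levels gives to the tree of \<open>s\<close>. By
    homogeneity of \<open>Y2\<close> it is the same for all increasing values \<open>w\<close> from
    \<open>Y2\<close>, so "some" amounts to "every".\<close>
  define P1 where "P1 s h \<longleftrightarrow> (\<exists>w. strict_mono_on (U (s, map h [0..<q s])) w \<and>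
    w ` U (s, map h [0..<q s]) \<subseteq> Y2 \<and> P2 (s, map h [0..<q s]) w)" for s h
  have P1: "\<forall>s\<in>S. \<forall>w w'. (\<forall>u\<in>{..<q s}. w u = w' u) \<longrightarrow> P1 s w = P1 s w'"
  proof (intro ballI allI impI)
    fix s and w w' :: "nat \<Rightarrow> nat" assume "\<forall>u\<in>{..<q s}. w u = (w' u :: nat)"
    then have "map w [0..<q s] = map w' [0..<q s]" by simp
    then show "P1 s w = P1 s w'" unfolding P1_def by (simp only:)
  qed
  have "\<exists>Y\<subseteq>{..<n}. card Y = N \<and>
      (\<forall>s\<in>S. \<forall>w w'. strict_mono_on {..<q s} w \<and> strict_mono_on {..<q s} w' \<and>
         w ` {..<q s} \<subseteq> Y \<and> w' ` {..<q s} \<subseteq> Y \<longrightarrow> P1 s w = P1 s w')"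
    by (rule n[rule_format, of "{..<n}" P1, OF _ _ P1[rule_format]]) simp_all
  then obtain Y1 where Y1: "Y1 \<subseteq> {..<n}" "card Y1 = N" and hom1:
      "\<forall>s\<in>S. \<forall>w w'. strict_mono_on {..<q s} w \<and> strict_mono_on {..<q s} w' \<and>
         w ` {..<q s} \<subseteq> Y1 \<and> w' ` {..<q s} \<subseteq> Y1 \<longrightarrow> P1 s w = P1 s w'"
    by (elim exE conjE)
  obtain h where h: "strict_mono_on {..<N} h" "h ` {..<N} = Y1"
    using enum_nat_set[of Y1] Y1 finite_subset by blast
  have hn: "h i < n" if "i < N" for i using h(2) Y1(1) that by auto
  \<comment> \<open>Inside the large code the colour of a subtree depends on its levels alone.
    Homogeneity of \<open>Y1\<close> then removes the levels, too.\<close>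
  have key: "\<chi> s (map (\<lambda>j. code R n h v (r j)) (js s)) = P1 s (h \<circ> r)"
    if s: "s \<in> S" and r: "strict_mono_on {..<q s} r" "r ` {..<q s} \<subseteq> {..<N}" "meet_closed R (q s) r"
      and rt: "pull_back R (q s) r = R' s" for s r
  proof -
    obtain w where w: "\<And>k. k < q s \<Longrightarrow> code R n h v (r k) = code (R' s) n (h \<circ> r) w k"
      "strict_mono_on (used (q s) (R' s) n (h \<circ> r)) w" "w ` used (q s) (R' s) n (h \<circ> r) \<subseteq> Y2"
      using code_restrict[OF R r h(1) hn v(1)] unfolding rt v(2) by metis
    define hs where "hs = map (h \<circ> r) [0..<q s]"
    have hs: "(h \<circ> r) i = hs ! i" if "i < q s" for i using that by (simp add: hs_def)
    have used_eq: "used (q s) (R' s) n (h \<circ> r) = U (s, hs)"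
    proof (cases "q s")
      case 0
      then show ?thesis by (simp add: U_def used_def)
    next
      case (Suc k)
      then show ?thesis unfolding U_def prod.case
        by (intro code_cong_level(2)[OF R'[OF s], of 0]) (simp, rule hs)
    qed
    have "code R n h v (r k) = code (R' s) n ((!) hs) w k" if "k < q s" for k
      unfolding w(1)[OF that] by (rule code_cong_level(1)[OF R'[OF s] that hs])
    then have "map (\<lambda>j. code R n h v (r j)) (js s) = map (code (R' s) n ((!) hs) w) (js s)"
      using js[OF s] by auto
    then have "\<chi> s (map (\<lambda>j. code R n h v (r j)) (js s)) = P2 (s, hs) w"
      unfolding P2_def prod.case by (rule arg_cong)
    also have "\<dots> = P1 s (h \<circ> r)"
    proof
      assume "P2 (s, hs) w"
      then show "P1 s (h \<circ> r)" unfolding P1_def hs_def[symmetric] using w(2,3) used_eq by auto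
    next
      assume "P1 s (h \<circ> r)"
      then obtain w' where w': "strict_mono_on (U (s, hs)) w'" "w' ` U (s, hs) \<subseteq> Y2" "P2 (s, hs) w'"
        unfolding P1_def hs_def by (elim exE conjE)
      have "h (r x) < n" if "x < q s" for x using hn r(2) that by auto
      then have "(s, hs) \<in> S2" using s by (auto simp: S2_def hs_def)
      then have "P2 (s, hs) w = P2 (s, hs) w'"
        using w' w(2,3) unfolding used_eq by (intro hom2[rule_format] conjI)
      then show "P2 (s, hs) w" using w'(3) by simp
    qed
    finally show ?thesis .
  qed
  show thesis
  proof (rule that[of "code R n h v"])
    show "prefix (code R n h v i) (code R n h v j) \<longleftrightarrow> R i j" if "i < N" "j < N" for i j
      using prefix_code_iff[OF R h(1) hn v(1) that] .
    fix s assume s: "s \<in> S"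
    have mono: "strict_mono_on {..<q s} (h \<circ> r)" if "strict_mono_on {..<q s} r" "r ` {..<q s} \<subseteq> {..<N}" for r
    proof (rule strict_mono_onI)
      fix i j assume ij: "i \<in> {..<q s}" "j \<in> {..<q s}" "i < j"
      then have "r i < r j" "r i \<in> {..<N}" "r j \<in> {..<N}"
        using strict_mono_onD[OF that(1) ij] that(2) by auto
      then show "(h \<circ> r) i < (h \<circ> r) j" using strict_mono_onD[OF h(1)] by simp
    qed
    note ts = t[OF s] t'[OF s]
    have img: "(h \<circ> r) ` {..<q s} \<subseteq> Y1" if "r ` {..<q s} \<subseteq> {..<N}" for r
      unfolding h(2)[symmetric] image_comp[symmetric] using that by (rule image_mono)
    have "P1 s (h \<circ> t s) = P1 s (h \<circ> t' s)"
      by (rule hom1[rule_format, OF s], intro conjI mono img) (simp_all only: ts)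
    then show "\<chi> s (map (\<lambda>j. code R n h v (t s j)) (js s)) = \<chi> s (map (\<lambda>j. code R n h v (t' s j)) (js s))"
      using key[OF s, of "t s"] key[OF s, of "t' s"] ts tt'[OF s] unfolding R'_def by metis
  qed
qed

section \<open>Meets and the lexicographic order\<close>

context
  fixes r :: "'o rel"
  assumes wo: "Well_order r"
begin

lemma wo_refl: "x \<in> Field r \<Longrightarrow> (x, x) \<in> r"
  using wo by (simp add: order_on_defs refl_on_def)

lemma wo_trans: "(x, y) \<in> r \<Longrightarrow> (y, z) \<in> r \<Longrightarrow> (x, z) \<in> r"
  using wo unfolding order_on_defs by (blast dest: transD)

lemma wo_antisym: "(x, y) \<in> r \<Longrightarrow> (y, x) \<in> r \<Longrightarrow> x = y"
  using wo unfolding order_on_defs by (blast dest: antisymD)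

lemma wo_total: "x \<in> Field r \<Longrightarrow> y \<in> Field r \<Longrightarrow> (x, y) \<in> r \<or> (y, x) \<in> r"
  using wo wo_refl[of x] unfolding order_on_defs total_on_def by (cases "x = y") simp_all

lemma wo_least:
  assumes "X \<subseteq> Field r" "X \<noteq> {}"
  obtains m where "m \<in> X" "\<And>x. x \<in> X \<Longrightarrow> (m, x) \<in> r"
proof -
  have "wf (r - Id)" using wo by (simp add: well_order_on_def)
  then obtain m where m: "m \<in> X" "\<And>y. (y, m) \<in> r - Id \<Longrightarrow> y \<notin> X"
    using assms(2) by (metis ex_in_conv wf_eq_minimal)
  then have "(m, x) \<in> r" if "x \<in> X" for x
    using that assms(1) wo_total[of m x] wo_refl[of m] by (cases "x = m") auto
  then show thesis using that m(1) by blast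
qed

lemma underS_less: "x \<in> underS r y \<longleftrightarrow> x \<noteq> y \<and> (x, y) \<in> r"
  by (auto simp: underS_def)

lemma underS_down: "x \<in> underS r a \<Longrightarrow> (y, x) \<in> r \<Longrightarrow> y \<in> underS r a"
  unfolding underS_less using wo_trans wo_antisym by blast

lemma underS_not: "x \<in> Field r \<Longrightarrow> y \<in> Field r \<Longrightarrow> x \<notin> underS r y \<longleftrightarrow> (y, x) \<in> r"
  unfolding underS_less using wo_total wo_antisym wo_refl by blast

lemma underS_inj: "x \<in> Field r \<Longrightarrow> y \<in> Field r \<Longrightarrow> underS r x = underS r y \<Longrightarrow> x = y"
  using underS_not underS_less by blast

lemma underS_Field: "underS r x \<subseteq> Field r"
  by (auto simp: underS_def Field_def)

lemma tree_dom: "\<eta> \<in> tree r \<Longrightarrow> x \<in> dom \<eta> \<Longrightarrow> x \<in> Field r"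
  unfolding tree_def using underS_Field by blast

lemma tree_down: "\<eta> \<in> tree r \<Longrightarrow> x \<in> dom \<eta> \<Longrightarrow> (y, x) \<in> r \<Longrightarrow> y \<in> dom \<eta>"
proof -
  assume a: "\<eta> \<in> tree r" "x \<in> dom \<eta>" "(y, x) \<in> r"
  then obtain \<alpha> where "dom \<eta> = underS r \<alpha>" unfolding tree_def by blast
  then show ?thesis using underS_down a(2,3) by blast
qed

lemma tree_notin_dom:
  assumes "\<eta> \<in> tree r" "l \<in> Field r" "l \<notin> dom \<eta>"
  shows "dom \<eta> \<subseteq> underS r l"
proof
  fix x assume x: "x \<in> dom \<eta>"
  then have "(l, x) \<notin> r" using tree_down[OF assms(1)] assms(3) by blast
  then show "x \<in> underS r l" using underS_not[of x l] tree_dom[OF assms(1) x] assms(2) by blast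
qed

definition splits :: "'o node \<Rightarrow> 'o node \<Rightarrow> 'o \<Rightarrow> bool" where
  "splits \<eta> \<nu> l \<longleftrightarrow> l \<in> dom \<eta> \<and> l \<in> dom \<nu> \<and> \<eta> l \<noteq> \<nu> l \<and> (\<forall>y\<in>underS r l. \<eta> y = \<nu> y)"

lemma tree_cases:
  assumes "\<eta> \<in> tree r" "\<nu> \<in> tree r"
  obtains "\<eta> \<subseteq>\<^sub>m \<nu>" | "\<nu> \<subseteq>\<^sub>m \<eta>" | l where "splits \<eta> \<nu> l"
proof (cases "\<forall>x\<in>dom \<eta> \<inter> dom \<nu>. \<eta> x = \<nu> x")
  case True
  have "dom \<eta> \<subseteq> dom \<nu> \<or> dom \<nu> \<subseteq> dom \<eta>"
  proof (rule ccontr)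
    assume "\<not> ?thesis"
    then obtain x y where "x \<in> dom \<eta>" "x \<notin> dom \<nu>" "y \<in> dom \<nu>" "y \<notin> dom \<eta>" by blast
    moreover from this have "(x, y) \<in> r \<or> (y, x) \<in> r" using tree_dom assms wo_total by blast
    ultimately show False using tree_down assms by blast
  qed
  then show thesis
  proof
    assume "dom \<eta> \<subseteq> dom \<nu>"
    then have "\<eta> \<subseteq>\<^sub>m \<nu>" using True unfolding map_le_def by blast
    then show thesis by (rule that(1))
  next
    assume "dom \<nu> \<subseteq> dom \<eta>"
    then have "\<nu> \<subseteq>\<^sub>m \<eta>" unfolding map_le_def using True by (metis IntI subsetD)
    then show thesis by (rule that(2))
  qed
next
  case False
  define X where "X = {x \<in> dom \<eta> \<inter> dom \<nu>. \<eta> x \<noteq> \<nu> x}"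
  have "X \<subseteq> Field r" using tree_dom[OF assms(1)] by (auto simp: X_def)
  moreover have "X \<noteq> {}" using False by (auto simp: X_def)
  ultimately obtain l where l: "l \<in> X" "\<And>x. x \<in> X \<Longrightarrow> (l, x) \<in> r"
    using wo_least by metis
  have "\<eta> y = \<nu> y" if "y \<in> underS r l" for y
  proof (rule ccontr)
    assume "\<eta> y \<noteq> \<nu> y"
    moreover have "l \<in> dom \<eta>" "l \<in> dom \<nu>" "(y, l) \<in> r" "y \<noteq> l"
      using l(1) that by (simp_all add: X_def underS_less)
    then have "y \<in> dom \<eta> \<inter> dom \<nu>" using tree_down assms by blast
    ultimately have "(l, y) \<in> r" using l(2) by (simp add: X_def)
    then show False using wo_antisym \<open>(y, l) \<in> r\<close> \<open>y \<noteq> l\<close> by blast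
  qed
  then show thesis using that(3)[of l] l(1) unfolding splits_def X_def by blast
qed

lemma splits_sym: "splits \<eta> \<nu> l \<Longrightarrow> splits \<nu> \<eta> l"
  by (auto simp: splits_def)

lemma splits_incomparable: "splits \<eta> \<nu> l \<Longrightarrow> incomparable \<eta> \<nu>"
  unfolding splits_def incomparable_def map_le_def by metis

lemma meet_le:
  assumes "\<eta> \<in> tree r" "\<eta> \<subseteq>\<^sub>m \<nu>"
  shows "meet r \<eta> \<nu> = \<eta>" "meet r \<nu> \<eta> = \<eta>"
proof -
  have eq: "\<eta> y = \<nu> y" if "x \<in> dom \<eta>" "y \<in> under r x" for x y
    using that assms tree_down[OF assms(1) that(1), of y] by (auto simp: map_le_def under_def)
  have s: "{x \<in> dom \<eta> \<inter> dom \<nu>. \<forall>y\<in>under r x. \<eta> y = \<nu> y} = dom \<eta>"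
      "{x \<in> dom \<nu> \<inter> dom \<eta>. \<forall>y\<in>under r x. \<nu> y = \<eta> y} = dom \<eta>"
  proof -
    have sub: "dom \<eta> \<subseteq> dom \<nu>" using map_le_implies_dom_le[OF assms(2)] .
    show "{x \<in> dom \<eta> \<inter> dom \<nu>. \<forall>y\<in>under r x. \<eta> y = \<nu> y} = dom \<eta>"
      using sub eq by blast
    show "{x \<in> dom \<nu> \<inter> dom \<eta>. \<forall>y\<in>under r x. \<nu> y = \<eta> y} = dom \<eta>"
      using sub eq[symmetric] by blast
  qed
  have "\<nu> |` dom \<eta> = \<eta>"
  proof
    fix x show "(\<nu> |` dom \<eta>) x = \<eta> x"
      using assms(2) by (cases "x \<in> dom \<eta>") (simp_all add: map_le_def restrict_map_def domIff)
  qed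
  moreover have "\<eta> |` dom \<eta> = \<eta>" by (auto simp: restrict_map_def fun_eq_iff domIff)
  ultimately show "meet r \<eta> \<nu> = \<eta>" "meet r \<nu> \<eta> = \<eta>" unfolding meet_def s by simp_all
qed

lemma meet_splits:
  assumes "\<eta> \<in> tree r" "splits \<eta> \<nu> l"
  shows "meet r \<eta> \<nu> = \<eta> |` underS r l" "dom (meet r \<eta> \<nu>) = underS r l"
proof -
  have l: "l \<in> Field r" using assms tree_dom unfolding splits_def by blast
  have sub: "underS r l \<subseteq> dom \<eta>" "underS r l \<subseteq> dom \<nu>"
  proof -
    have "l \<in> dom \<eta>" using assms(2) by (simp add: splits_def)
    then show "underS r l \<subseteq> dom \<eta>" using tree_down[OF assms(1)] unfolding underS_def by blast
    show "underS r l \<subseteq> dom \<nu>"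
    proof
      fix x assume x: "x \<in> underS r l"
      then have "\<eta> x \<noteq> None" "\<eta> x = \<nu> x"
        using \<open>underS r l \<subseteq> dom \<eta>\<close> assms(2) by (blast, simp add: splits_def)
      then show "x \<in> dom \<nu>" by (simp add: domIff)
    qed
  qed
  have "{x \<in> dom \<eta> \<inter> dom \<nu>. \<forall>y\<in>under r x. \<eta> y = \<nu> y} = underS r l" (is "?X = _")
  proof
    show "?X \<subseteq> underS r l"
    proof
      fix x assume x: "x \<in> ?X"
      then have "x \<in> Field r" using tree_dom[OF assms(1)] by blast
      moreover have "(l, x) \<notin> r" using x assms(2) by (auto simp: under_def splits_def)
      ultimately show "x \<in> underS r l" using underS_not l by blast
    qed
    show "underS r l \<subseteq> ?X"
      using sub assms(2) underS_down by (auto simp: splits_def under_def)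
  qed
  then show "meet r \<eta> \<nu> = \<eta> |` underS r l" unfolding meet_def by simp
  then show "dom (meet r \<eta> \<nu>) = underS r l" using sub by auto
qed

lemma meet_tree:
  assumes "\<eta> \<in> tree r" "\<nu> \<in> tree r"
  shows "meet r \<eta> \<nu> \<in> tree r"
  using assms
proof (rule tree_cases)
  fix l assume l: "splits \<eta> \<nu> l"
  then have "l \<in> Field r" using assms tree_dom unfolding splits_def by blast
  then show ?thesis using meet_splits(2)[OF assms(1) l] unfolding tree_def by blast
qed (use assms in \<open>simp_all add: meet_le\<close>)

lemma le_meet_iff:
  assumes "\<eta> \<in> tree r" "\<nu> \<in> tree r" "\<xi> \<in> tree r"
  shows "\<xi> \<subseteq>\<^sub>m meet r \<eta> \<nu> \<longleftrightarrow> \<xi> \<subseteq>\<^sub>m \<eta> \<and> \<xi> \<subseteq>\<^sub>m \<nu>"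
  using assms(1,2)
proof (rule tree_cases)
  fix l assume l: "splits \<eta> \<nu> l"
  have *: "\<eta> |` underS r l \<subseteq>\<^sub>m \<eta>" "\<eta> |` underS r l \<subseteq>\<^sub>m \<nu>"
    using l by (auto simp: map_le_def splits_def)
  have "\<xi> \<subseteq>\<^sub>m \<eta> |` underS r l" if le: "\<xi> \<subseteq>\<^sub>m \<eta>" "\<xi> \<subseteq>\<^sub>m \<nu>"
  proof -
    have "l \<notin> dom \<xi>" using l le by (auto simp: map_le_def splits_def)
    moreover have "l \<in> Field r" using l assms tree_dom unfolding splits_def by blast
    ultimately have "dom \<xi> \<subseteq> underS r l" using tree_notin_dom[OF assms(3)] by blast
    then show ?thesis using le(1) by (auto simp: map_le_def)
  qed
  then show ?thesis unfolding meet_splits(1)[OF assms(1) l] using * map_le_trans by blast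
qed (use assms map_le_trans in \<open>auto simp: meet_le\<close>)

lemma le_comparable:
  assumes "\<eta> \<in> tree r" "\<nu> \<in> tree r" "\<eta> \<subseteq>\<^sub>m \<xi>" "\<nu> \<subseteq>\<^sub>m \<xi>"
  shows "\<eta> \<subseteq>\<^sub>m \<nu> \<or> \<nu> \<subseteq>\<^sub>m \<eta>"
  using assms(1,2)
proof (rule tree_cases)
  fix l assume "splits \<eta> \<nu> l"
  moreover have "\<eta> l = \<xi> l" "\<nu> l = \<xi> l"
    using \<open>splits \<eta> \<nu> l\<close> assms(3,4) unfolding splits_def map_le_def by blast+
  ultimately show ?thesis by (simp add: splits_def)
qed simp_all

text \<open>One round of meets suffices. Let x be below a, y below c, and z the meet of a and c.
  Nodes below a common node are comparable: if x is below z, then x and y are both below c; if y is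
  below z, both are below a; otherwise z is below both and is their meet. Hence a finite set of
  nodes has a finite closure.\<close>

lemma meet_closure:
  assumes "A \<subseteq> tree r"
  defines "B \<equiv> (\<lambda>(a, b). meet r a b) ` (A \<times> A)"
  shows "A \<subseteq> B" "B \<subseteq> tree r" "\<And>x y. x \<in> B \<Longrightarrow> y \<in> B \<Longrightarrow> meet r x y \<in> B"
proof -
  have in_B: "meet r a b \<in> B" if "a \<in> A" "b \<in> A" for a b using that unfolding B_def by force
  show "A \<subseteq> B"
  proof
    fix a assume "a \<in> A"
    then have "meet r a a \<in> B" "meet r a a = a" using in_B meet_le(1)[of a a] assms(1) by auto
    then show "a \<in> B" by simp
  qed
  show Bt: "B \<subseteq> tree r" unfolding B_def using assms(1) meet_tree by auto
  fix x y assume "x \<in> B" "y \<in> B"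
  then obtain a b c d where abcd: "a \<in> A" "b \<in> A" "x = meet r a b" "c \<in> A" "d \<in> A" "y = meet r c d"
    unfolding B_def by auto
  then have t: "a \<in> tree r" "b \<in> tree r" "c \<in> tree r" "d \<in> tree r" using assms(1) by auto
  define z where "z = meet r a c"
  have tr: "x \<in> tree r" "y \<in> tree r" "z \<in> tree r" using t meet_tree abcd z_def by auto
  have le: "x \<subseteq>\<^sub>m a" "z \<subseteq>\<^sub>m a" "z \<subseteq>\<^sub>m c" "y \<subseteq>\<^sub>m c"
    using le_meet_iff t tr abcd z_def map_le_refl by metis+
  have z_in: "z \<in> B" using in_B abcd z_def by simp
  consider "x \<subseteq>\<^sub>m y" | "y \<subseteq>\<^sub>m x" | "z \<subseteq>\<^sub>m x" "z \<subseteq>\<^sub>m y"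
    using le_comparable[OF tr(1,3) le(1,2)] le_comparable[OF tr(3,2) le(3,4)]
      le_comparable[OF tr(1,2), of c] le map_le_trans by metis
  then show "meet r x y \<in> B"
  proof cases
    case 3
    have m: "meet r x y \<in> tree r" using meet_tree tr by blast
    then have "meet r x y \<subseteq>\<^sub>m x" "meet r x y \<subseteq>\<^sub>m y" using le_meet_iff[OF tr(1,2) m] map_le_refl by blast+
    then have "meet r x y \<subseteq>\<^sub>m z" using le_meet_iff[OF t(1,3) m] le map_le_trans z_def by metis
    moreover have "z \<subseteq>\<^sub>m meet r x y" using le_meet_iff[OF tr(1,2,3)] 3 by blast
    ultimately have "meet r x y = z" by (rule map_le_antisym)
    then show ?thesis using z_in by simp
  qed (use meet_le tr \<open>x \<in> B\<close> \<open>y \<in> B\<close> in auto)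
qed

lemma lex_iff:
  assumes "\<eta> \<in> tree r" "\<nu> \<in> tree r"
  shows "lex r \<eta> \<nu> \<longleftrightarrow> \<eta> \<subseteq>\<^sub>m \<nu> \<or> (\<exists>l. splits \<eta> \<nu> l \<and> \<eta> l = Some False \<and> \<nu> l = Some True)"
proof
  assume "lex r \<eta> \<nu>"
  then consider "\<eta> \<subseteq>\<^sub>m \<nu>" | l where "incomparable \<eta> \<nu>" "l \<in> Field r"
      "dom (meet r \<eta> \<nu>) = underS r l" "the (\<eta> l) < the (\<nu> l)"
    unfolding lex_def by blast
  then show "\<eta> \<subseteq>\<^sub>m \<nu> \<or> (\<exists>l. splits \<eta> \<nu> l \<and> \<eta> l = Some False \<and> \<nu> l = Some True)"
  proof cases
    case 2
    from assms show ?thesis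
    proof (rule tree_cases)
      fix l' assume l': "splits \<eta> \<nu> l'"
      then have "l' \<in> Field r" using assms tree_dom unfolding splits_def by blast
      then have "l' = l" using underS_inj meet_splits(2)[OF assms(1) l'] 2 by simp
      then show ?thesis using l' 2(4) by (auto simp: splits_def)
    qed (use 2(1) in \<open>auto simp: incomparable_def\<close>)
  qed simp
next
  assume "\<eta> \<subseteq>\<^sub>m \<nu> \<or> (\<exists>l. splits \<eta> \<nu> l \<and> \<eta> l = Some False \<and> \<nu> l = Some True)"
  then show "lex r \<eta> \<nu>"
  proof (elim disjE exE conjE)
    fix l assume l: "splits \<eta> \<nu> l" "\<eta> l = Some False" "\<nu> l = Some True"
    then have "l \<in> Field r" using assms tree_dom unfolding splits_def by blast
    then show ?thesis
      using splits_incomparable[OF l(1)] meet_splits(2)[OF assms(1) l(1)] l(2,3) unfolding lex_def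
      by (intro disjI2 conjI bexI[of _ l]) auto
  qed (simp add: lex_def)
qed

lemma splits_unique:
  assumes "\<eta> \<in> tree r" "splits \<eta> \<nu> l" "splits \<eta> \<nu> l'"
  shows "l = l'"
proof (rule underS_inj)
  show "l \<in> Field r" "l' \<in> Field r" using assms tree_dom unfolding splits_def by blast+
  show "underS r l = underS r l'" using meet_splits(2) assms by metis
qed

lemma lex_antisym:
  assumes "\<eta> \<in> tree r" "\<nu> \<in> tree r" "lex r \<eta> \<nu>" "lex r \<nu> \<eta>"
  shows "\<eta> = \<nu>"
proof -
  have "lex r \<eta> \<nu>" "lex r \<nu> \<eta>" by fact+
  then consider "\<eta> \<subseteq>\<^sub>m \<nu>" "\<nu> \<subseteq>\<^sub>m \<eta>" | "\<eta> \<subseteq>\<^sub>m \<nu>" "incomparable \<nu> \<eta>" | "\<nu> \<subseteq>\<^sub>m \<eta>" "incomparable \<eta> \<nu>"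
    | l l' where "splits \<eta> \<nu> l" "\<eta> l = Some False" "splits \<nu> \<eta> l'" "\<nu> l' = Some False" "\<eta> l' = Some True"
    unfolding lex_iff[OF assms(1,2)] lex_iff[OF assms(2,1)] using splits_incomparable by metis
  then show ?thesis
  proof cases
    case 4
    then show ?thesis using splits_unique[OF assms(1) 4(1) splits_sym[OF 4(3)]] by simp
  qed (auto simp: incomparable_def intro: map_le_antisym)
qed

lemma lex_total:
  assumes "\<eta> \<in> tree r" "\<nu> \<in> tree r"
  shows "lex r \<eta> \<nu> \<or> lex r \<nu> \<eta>"
  using assms
proof (rule tree_cases)
  fix l assume l: "splits \<eta> \<nu> l"
  then obtain x y where "\<eta> l = Some x" "\<nu> l = Some y" "x \<noteq> y" unfolding splits_def by auto
  then show ?thesis unfolding lex_iff[OF assms] lex_iff[OF assms(2,1)]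
    using l splits_sym[OF l] by (cases x; cases y) auto
qed (simp_all add: lex_def)

lemma lex_trans:
  assumes t: "a \<in> tree r" "b \<in> tree r" "c \<in> tree r" and ab: "lex r a b" and bc: "lex r b c"
  shows "lex r a c"
proof -
  have F: "l \<in> Field r" if "splits x y l" "x \<in> tree r" for x y l
    using that tree_dom unfolding splits_def by blast
  consider "a \<subseteq>\<^sub>m b" "b \<subseteq>\<^sub>m c"
    | l where "a \<subseteq>\<^sub>m b" "splits b c l" "b l = Some False" "c l = Some True"
    | l where "b \<subseteq>\<^sub>m c" "splits a b l" "a l = Some False" "b l = Some True"
    | l l' where "splits a b l" "a l = Some False" "b l = Some True"
       "splits b c l'" "b l' = Some False" "c l' = Some True"
    using ab bc unfolding lex_iff[OF t(1,2)] lex_iff[OF t(2,3)] by blast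
  then show ?thesis
  proof cases
    case 1
    then show ?thesis using map_le_trans unfolding lex_def by blast
  next
    case (2 l)
    show ?thesis
    proof (cases "l \<in> dom a")
      case True
      have "splits a c l" "a l = Some False"
      proof -
        show al: "a l = Some False" using 2(1,3) True by (auto simp: map_le_def)
        have "a y = c y" if "y \<in> underS r l" for y
        proof -
          have "y \<in> dom a" using tree_down[OF t(1) True] that by (auto simp: underS_less)
          then show ?thesis using 2(1,2) that by (auto simp: map_le_def splits_def)
        qed
        then show "splits a c l" using al 2(4) by (auto simp: splits_def)
      qed
      then show ?thesis using 2(4) lex_iff[OF t(1,3)] by blast
    next
      case False
      have "dom a \<subseteq> underS r l" using tree_notin_dom[OF t(1) F[OF 2(2) t(2)] False] .
      then have "a \<subseteq>\<^sub>m c" using 2(1,2) unfolding map_le_def splits_def by (metis subsetD)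
      then show ?thesis by (simp add: lex_def)
    qed
  next
    case (3 l)
    have "b y = c y" if "y = l \<or> y \<in> underS r l" for y
    proof -
      have "y \<in> dom b" using tree_down[OF t(2)] 3(2) that by (auto simp: underS_less splits_def)
      then show ?thesis using 3(1) by (simp add: map_le_def)
    qed
    then have "splits a c l" "c l = Some True" using 3 by (auto simp: splits_def)
    then show ?thesis using 3(3) lex_iff[OF t(1,3)] by blast
  next
    case (4 l l')
    have "l \<noteq> l'" using 4 by auto
    then consider "l \<in> underS r l'" | "l' \<in> underS r l"
      using wo_total[OF F[OF 4(1) t(1)] F[OF 4(4) t(2)]] by (auto simp: underS_less)
    then show ?thesis
    proof cases
      case 1
      then have "splits a c l" "c l = Some True"
        using 4 underS_down[OF 1] by (auto simp: splits_def underS_less)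
      then show ?thesis using 4(2) lex_iff[OF t(1,3)] by blast
    next
      case 2
      then have "splits a c l'" "a l' = Some False"
        using 4 underS_down[OF 2] by (auto simp: splits_def underS_less)
      then show ?thesis using 4(6) lex_iff[OF t(1,3)] by blast
    qed
  qed
qed

text \<open>If \<open>b\<close> branched off from \<open>a\<close>, it would do so to the right, and
  would thus be to the right of every extension of \<open>a\<close>. This makes a lexicographic
  listing a depth-first one.\<close>

lemma lex_convex:
  assumes t: "a \<in> tree r" "b \<in> tree r" "c \<in> tree r" and "a \<subseteq>\<^sub>m c" "lex r a b" "lex r b c"
  shows "a \<subseteq>\<^sub>m b"
proof (rule ccontr)
  assume n: "\<not> a \<subseteq>\<^sub>m b"
  then obtain l where l: "splits a b l" "a l = Some False" "b l = Some True"
    using assms(5) lex_iff[OF t(1,2)] by blast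
  have "a y = c y" if "y = l \<or> y \<in> underS r l" for y
  proof -
    have "y \<in> dom a" using tree_down[OF t(1)] l(1) that by (auto simp: underS_less splits_def)
    then show ?thesis using assms(4) by (simp add: map_le_def)
  qed
  then have "splits c b l" "c l = Some False" using l by (auto simp: splits_def)
  then have "lex r c b" using l(3) lex_iff[OF t(3,2)] by blast
  then have "b = c" using lex_antisym t assms(6) by blast
  then show False using n assms(4) by simp
qed

lemma lex_enumeration:
  assumes A: "finite A" "A \<subseteq> tree r"
  obtains e where "bij_betw e {..<card A} A"
    "\<And>i j. i < card A \<Longrightarrow> j < card A \<Longrightarrow> lex r (e i) (e j) \<longleftrightarrow> i \<le> j"
proof -
  define rank where "rank y = card {x \<in> A. lex r x y \<and> x \<noteq> y}" for y
  have less: "rank y < rank z" if "y \<in> A" "z \<in> A" "lex r y z" "y \<noteq> z" for y z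
    unfolding rank_def
  proof (rule psubset_card_mono)
    show "finite {x \<in> A. lex r x z \<and> x \<noteq> z}" using A by simp
    have "{x \<in> A. lex r x y \<and> x \<noteq> y} \<subseteq> {x \<in> A. lex r x z \<and> x \<noteq> z}"
      using that A(2) lex_trans lex_antisym by (smt (verit) Collect_mono subsetD)
    moreover have "y \<in> {x \<in> A. lex r x z \<and> x \<noteq> z}" using that by simp
    ultimately show "{x \<in> A. lex r x y \<and> x \<noteq> y} \<subset> {x \<in> A. lex r x z \<and> x \<noteq> z}" by blast
  qed
  have le: "rank y \<le> rank z \<longleftrightarrow> lex r y z" if "y \<in> A" "z \<in> A" for y z
  proof (cases "y = z")
    case True
    then show ?thesis by (simp add: lex_def)
  next
    case False
    have yz: "y \<in> tree r" "z \<in> tree r" using that A(2) by blast+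
    show ?thesis
    proof
      assume "rank y \<le> rank z"
      then have "\<not> lex r z y" using less[OF that(2,1)] False by fastforce
      then show "lex r y z" using lex_total[OF yz] by blast
    next
      assume "lex r y z"
      then show "rank y \<le> rank z" using less[OF that] False by simp
    qed
  qed
  have inj: "inj_on rank A"
    using le lex_antisym A(2) by (metis inj_onI order_refl subsetD)
  have "rank y < card A" if "y \<in> A" for y
    unfolding rank_def using that A(1) by (intro psubset_card_mono) auto
  then have "rank ` A \<subseteq> {..<card A}" by blast
  then have bij: "bij_betw rank A {..<card A}"
    using inj card_image[OF inj] unfolding bij_betw_def by (simp add: card_subset_eq)
  show thesis
  proof (rule that)
    show inv: "bij_betw (inv_into A rank) {..<card A} A" using bij by (rule bij_betw_inv_into)
    fix i j assume ij: "i < card A" "j < card A"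
    then have "rank (inv_into A rank i) = i" "rank (inv_into A rank j) = j"
      using bij_betw_inv_into_right[OF bij] by simp_all
    moreover have "inv_into A rank i \<in> A" "inv_into A rank j \<in> A"
      using inv ij by (auto dest: bij_betwE)
    ultimately show "lex r (inv_into A rank i) (inv_into A rank j) \<longleftrightarrow> i \<le> j" using le by metis
  qed
qed

lemma dfs_lex_enumeration:
  assumes "bij_betw e {..<N} A" "A \<subseteq> tree r"
    and "\<And>i j. i < N \<Longrightarrow> j < N \<Longrightarrow> lex r (e i) (e j) \<longleftrightarrow> i \<le> j"
  shows "dfs N (\<lambda>i j. i < N \<and> j < N \<and> e i \<subseteq>\<^sub>m e j)"
proof -
  have t: "e i \<in> tree r" if "i < N" for i using assms(1,2) that by (auto dest: bij_betwE)
  show ?thesis unfolding dfs_def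
  proof (intro conjI allI impI; (elim conjE)?)
    fix i j assume "i < N" "j < N" "e i \<subseteq>\<^sub>m e j"
    then show "i \<le> j" using assms(3)[of i j] lex_iff[OF t t, of i j] by blast
  next
    fix i j k assume "e i \<subseteq>\<^sub>m e j" "e j \<subseteq>\<^sub>m e k"
    then show "e i \<subseteq>\<^sub>m e k" by (rule map_le_trans)
  next
    fix i j k assume "i < N" "k < N" "e i \<subseteq>\<^sub>m e k" "i \<le> j" "j \<le> k"
    then show "e i \<subseteq>\<^sub>m e j"
      using lex_convex[OF t t t, of i j k] assms(3) by simp
  qed auto
qed

end

section \<open>Quantifier-free types in the tree language\<close>

text \<open>A calculator for patterns. Two tuples of nodes have the same quantifier-free type once
  both are images of one tuple of patterns under maps that respect the three symbols. Only
  quantifier-free formulas are evaluated here, so the universe may be the whole type.\<close>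

definition tree_like ::
  "('s \<Rightarrow> 's \<Rightarrow> 's) \<Rightarrow> ('s \<Rightarrow> 's \<Rightarrow> bool) \<Rightarrow> ('s \<Rightarrow> 's \<Rightarrow> bool) \<Rightarrow> (tree_fun, tree_rel, 's) struct" where
  "tree_like m lt lx =
     \<lparr>univ = UNIV,
      fun_int = (\<lambda>_ xs. m (xs ! 0) (xs ! 1)),
      rel_int = (\<lambda>R xs. case R of Initial \<Rightarrow> lt (xs ! 0) (xs ! 1) | Lex \<Rightarrow> lx (xs ! 0) (xs ! 1))\<rparr>"

lemma L0_args:
  assumes "Some 2 = Some (length ts)"
  obtains a b where "ts = [a, b]"
  using assms by (auto simp: numeral_2_eq_2 length_Suc_conv[symmetric] eq_commute[of "Suc (Suc 0)"] length_Suc_conv)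

lemma tm_val_embedding:
  assumes m: "\<And>s t. s \<in> S \<Longrightarrow> t \<in> S \<Longrightarrow> m s t \<in> S \<and> F (m s t) = meet r (F s) (F t)"
    and ss: "set ss \<subseteq> S"
    and t: "wf_tm L0 t" "fv_tm t \<subseteq> {..<length ss}"
  shows "tm_val (tree_like m lt lx) ((!) ss) t \<in> S \<and>
    tm_val (tree_struct r) ((!) (map F ss)) t = F (tm_val (tree_like m lt lx) ((!) ss) t)"
  using t
proof (induction t)
  case (Var i)
  then show ?case using ss by auto
next
  case (Fun f ts)
  then have "Some 2 = Some (length ts)" by (simp add: L0_def)
  then obtain a b where ts: "ts = [a, b]" by (rule L0_args)
  have "tm_val (tree_like m lt lx) ((!) ss) a \<in> S \<and>
    tm_val (tree_struct r) ((!) (map F ss)) a = F (tm_val (tree_like m lt lx) ((!) ss) a)"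
    by (rule Fun.IH) (use Fun.prems ts in auto)
  moreover have "tm_val (tree_like m lt lx) ((!) ss) b \<in> S \<and>
    tm_val (tree_struct r) ((!) (map F ss)) b = F (tm_val (tree_like m lt lx) ((!) ss) b)"
    by (rule Fun.IH) (use Fun.prems ts in auto)
  ultimately show ?case using m by (simp add: ts tree_like_def tree_struct_def)
qed

lemma sat_embedding:
  assumes m: "\<And>s t. s \<in> S \<Longrightarrow> t \<in> S \<Longrightarrow> m s t \<in> S \<and> F (m s t) = meet r (F s) (F t)"
    and lt: "\<And>s t. s \<in> S \<Longrightarrow> t \<in> S \<Longrightarrow> lt s t \<longleftrightarrow> F s \<subseteq>\<^sub>m F t"
    and lx: "\<And>s t. s \<in> S \<Longrightarrow> t \<in> S \<Longrightarrow> lx s t \<longleftrightarrow> lex r (F s) (F t)"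
    and inj: "inj_on F S" and ss: "set ss \<subseteq> S"
    and \<phi>: "wf_fm L0 \<phi>" "quantifier_free \<phi>" "fv \<phi> \<subseteq> {..<length ss}"
  shows "holds (tree_struct r) \<phi> (map F ss) = holds (tree_like m lt lx) \<phi> ss"
  using \<phi> unfolding holds_def
proof (induction \<phi>)
  case (Eq s t)
  have "tm_val (tree_like m lt lx) ((!) ss) u \<in> S \<and>
    tm_val (tree_struct r) ((!) (map F ss)) u = F (tm_val (tree_like m lt lx) ((!) ss) u)"
    if "u = s \<or> u = t" for u
    by (rule tm_val_embedding[where S = S and m = m and F = F and r = r, OF m ss]) (use that Eq in auto)
  then show ?case using inj by (auto dest: inj_onD)
next
  case (Rel R ts)
  then have "Some 2 = Some (length ts)" by (simp add: L0_def)
  then obtain a b where ts: "ts = [a, b]" by (rule L0_args)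
  have "tm_val (tree_like m lt lx) ((!) ss) u \<in> S \<and>
    tm_val (tree_struct r) ((!) (map F ss)) u = F (tm_val (tree_like m lt lx) ((!) ss) u)"
    if "u = a \<or> u = b" for u
    by (rule tm_val_embedding[where S = S and m = m and F = F and r = r, OF m ss]) (use that Rel ts in auto)
  then show ?case using lt lx by (cases R) (auto simp: ts tree_like_def tree_struct_def)
qed auto

lemma qf_tp_embedding:
  assumes "\<And>s t. s \<in> S \<Longrightarrow> t \<in> S \<Longrightarrow> m s t \<in> S \<and> F (m s t) = meet r (F s) (F t)"
    and "\<And>s t. s \<in> S \<Longrightarrow> t \<in> S \<Longrightarrow> lt s t \<longleftrightarrow> F s \<subseteq>\<^sub>m F t"
    and "\<And>s t. s \<in> S \<Longrightarrow> t \<in> S \<Longrightarrow> lx s t \<longleftrightarrow> lex r (F s) (F t)"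
    and "inj_on F S" "set ss \<subseteq> S"
  shows "qf_tp L0 (tree_struct r) (map F ss) = qf_tp L0 (tree_like m lt lx) ss"
  unfolding qf_tp_def formulas_def
  using sat_embedding[where S = S and F = F and m = m and lt = lt and lx = lx and ss = ss and r = r, OF assms]
  by auto

section \<open>Patterns given by lists of bits\<close>

definition list_lex :: "bool list \<Rightarrow> bool list \<Rightarrow> bool" where
  "list_lex s t \<longleftrightarrow> prefix s t \<or> (\<exists>p s' t'. s = p @ False # s' \<and> t = p @ True # t')"

lemma lcp_prefix: "prefix s t \<Longrightarrow> longest_common_prefix s t = s" "prefix s t \<Longrightarrow> longest_common_prefix t s = s"
  by (induction s t rule: longest_common_prefix.induct) auto

lemma lcp_split: "b \<noteq> c \<Longrightarrow> longest_common_prefix (p @ b # s) (p @ c # t) = p"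
  by (induction p) auto

lemma list_lex_split: "list_lex (p @ b # s) (p @ (\<not> b) # t) \<longleftrightarrow> \<not> b"
proof
  assume "list_lex (p @ b # s) (p @ (\<not> b) # t)"
  then show "\<not> b" unfolding list_lex_def
  proof (elim disjE exE conjE)
    fix p' s' t' assume e: "p @ b # s = p' @ False # s'" "p @ (\<not> b) # t = p' @ True # t'"
    have "p = p'"
      using lcp_split[of b "\<not> b" p s t] lcp_split[of False True p' s' t'] unfolding e by auto
    then show "\<not> b" using e by simp
  qed simp
qed (cases b; auto simp: list_lex_def)

lemma list_cases:
  fixes s t :: "bool list"
  obtains "prefix s t" | "prefix t s" | p b s' t' where "s = p @ b # s'" "t = p @ (\<not> b) # t'"
proof (cases "s \<parallel> t")
  case True
  then obtain p b s' c t' where "b \<noteq> c" "s = p @ b # s'" "t = p @ c # t'"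
    using parallel_decomp[OF True] by blast
  moreover from this have "c = (\<not> b)" by simp
  ultimately show thesis using that(3) by blast
qed (use that in \<open>auto simp: parallel_def\<close>)

text \<open>Bits are prescribed only where two lists of \<open>S\<close> really branch; elsewhere an
  extension may be any proper one. This lets a run of zeros stand for an arbitrary increasing chain
  of nodes.\<close>

definition list_embedding :: "'o rel \<Rightarrow> bool list set \<Rightarrow> (bool list \<Rightarrow> 'o node) \<Rightarrow> bool" where
  "list_embedding r S F \<longleftrightarrow> F ` S \<subseteq> tree r \<and>
     (\<forall>s\<in>S. \<forall>t\<in>S. strict_prefix s t \<longrightarrow> F s \<subseteq>\<^sub>m F t \<and> F s \<noteq> F t) \<and>
     (\<forall>p s t. p @ True # s \<in> S \<longrightarrow> p @ False # t \<in> S \<longrightarrow> p \<in> S \<and>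
        (\<exists>l\<in>Field r. dom (F p) = underS r l \<and>
           F (p @ True # s) l = Some True \<and> F (p @ False # t) l = Some False))"

lemma list_embeddingD:
  assumes "list_embedding r S F"
  shows "s \<in> S \<Longrightarrow> F s \<in> tree r"
    and "s \<in> S \<Longrightarrow> t \<in> S \<Longrightarrow> strict_prefix s t \<Longrightarrow> F s \<subseteq>\<^sub>m F t \<and> F s \<noteq> F t"
    and "p @ True # s \<in> S \<Longrightarrow> p @ False # t \<in> S \<Longrightarrow> p \<in> S \<and>
        (\<exists>l\<in>Field r. dom (F p) = underS r l \<and>
           F (p @ True # s) l = Some True \<and> F (p @ False # t) l = Some False)"
proof -
  note a = assms[unfolded list_embedding_def]
  show "s \<in> S \<Longrightarrow> F s \<in> tree r" using a[THEN conjunct1] by blast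
  show "s \<in> S \<Longrightarrow> t \<in> S \<Longrightarrow> strict_prefix s t \<Longrightarrow> F s \<subseteq>\<^sub>m F t \<and> F s \<noteq> F t"
    by (rule a[THEN conjunct2, THEN conjunct1, rule_format])
  show "p @ True # s \<in> S \<Longrightarrow> p @ False # t \<in> S \<Longrightarrow> p \<in> S \<and>
        (\<exists>l\<in>Field r. dom (F p) = underS r l \<and>
           F (p @ True # s) l = Some True \<and> F (p @ False # t) l = Some False)"
    by (rule a[THEN conjunct2, THEN conjunct2, rule_format])
qed

lemma list_embedding_splits:
  assumes wo: "Well_order r" and F: "list_embedding r S F"
    and S: "p @ b # s \<in> S" "p @ (\<not> b) # t \<in> S"
  shows "p \<in> S \<and> meet r (F (p @ b # s)) (F (p @ (\<not> b) # t)) = F p \<and>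
    incomparable (F (p @ b # s)) (F (p @ (\<not> b) # t)) \<and>
    (lex r (F (p @ b # s)) (F (p @ (\<not> b) # t)) \<longleftrightarrow> \<not> b)"
proof -
  let ?a = "F (p @ b # s)" and ?b = "F (p @ (\<not> b) # t)"
  have tree: "?a \<in> tree r" "?b \<in> tree r" using list_embeddingD(1)[OF F] S by blast+
  have "\<exists>l\<in>Field r. p \<in> S \<and> dom (F p) = underS r l \<and> ?a l = Some b \<and> ?b l = Some (\<not> b)"
  proof (cases b)
    case True
    then show ?thesis using list_embeddingD(3)[OF F, of p s t] S by auto
  next
    case False
    then show ?thesis using list_embeddingD(3)[OF F, of p t s] S by auto
  qed
  then obtain l where l: "l \<in> Field r" "p \<in> S" "dom (F p) = underS r l" "?a l = Some b" "?b l = Some (\<not> b)"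
    by blast
  have "strict_prefix p (p @ c # u)" for c u by (simp add: strict_prefix_def)
  then have le: "F p \<subseteq>\<^sub>m ?a" "F p \<subseteq>\<^sub>m ?b" using list_embeddingD(2)[OF F l(2)] S by blast+
  have eq: "F p y = ?a y \<and> F p y = ?b y" if "y \<in> underS r l" for y
    using le that unfolding map_le_def l(3) by blast
  then have "?a y = ?b y" if "y \<in> underS r l" for y using that by metis
  then have sp: "splits r ?a ?b l" unfolding splits_def[OF wo] using l by (auto simp: domIff)
  have "?a |` underS r l = F p"
  proof
    fix y show "(?a |` underS r l) y = F p y"
      using eq[of y] l(3) domIff[of y "F p"] by (cases "y \<in> underS r l") (simp_all add: restrict_map_def)
  qed
  then have "meet r ?a ?b = F p" using meet_splits(1)[OF wo tree(1) sp] by simp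
  moreover have "incomparable ?a ?b" by (rule splits_incomparable[OF wo sp])
  moreover have "lex r ?a ?b \<longleftrightarrow> \<not> b"
  proof -
    have "\<not> ?a \<subseteq>\<^sub>m ?b" using \<open>incomparable ?a ?b\<close> by (simp add: incomparable_def)
    moreover have "(\<exists>l'. splits r ?a ?b l' \<and> ?a l' = Some False \<and> ?b l' = Some True) \<longleftrightarrow>
        ?a l = Some False \<and> ?b l = Some True"
      using splits_unique[OF wo tree(1) sp] sp by blast
    ultimately show ?thesis unfolding lex_iff[OF wo tree] by (simp add: l(4,5))
  qed
  ultimately show ?thesis using l(2) by simp
qed

lemma list_embedding_prefix:
  assumes F: "list_embedding r S F" and S: "s \<in> S" "t \<in> S" and p: "prefix s t"
  shows "F s \<subseteq>\<^sub>m F t" "F s = F t \<longleftrightarrow> s = t"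
proof -
  have "s = t \<or> strict_prefix s t" using p by (auto simp: strict_prefix_def)
  then show "F s \<subseteq>\<^sub>m F t" "F s = F t \<longleftrightarrow> s = t" using list_embeddingD(2)[OF F S] by auto
qed

text \<open>The right-hand side does not mention \<open>F\<close>: any two embeddings of the same
  lists give tuples of the same type. The three symbols are compared separately for prefix pairs and
  for branching pairs.\<close>

lemma list_embedding_qf_tp:
  assumes wo: "Well_order r" and F: "list_embedding r S F" and ss: "set ss \<subseteq> S"
  shows "qf_tp L0 (tree_struct r) (map F ss) =
    qf_tp L0 (tree_like longest_common_prefix prefix list_lex) ss"
proof (rule qf_tp_embedding[OF _ _ _ _ ss])
  have tree: "F s \<in> tree r" if "s \<in> S" for s using list_embeddingD(1)[OF F that] .
  note pre = list_embedding_prefix[OF F]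
  have "(longest_common_prefix s t \<in> S \<and> F (longest_common_prefix s t) = meet r (F s) (F t)) \<and>
      (prefix s t \<longleftrightarrow> F s \<subseteq>\<^sub>m F t) \<and> (list_lex s t \<longleftrightarrow> lex r (F s) (F t)) \<and> (F s = F t \<longrightarrow> s = t)"
    if st: "s \<in> S" "t \<in> S" for s t
  proof (cases rule: list_cases[of s t])
    case 1
    have "F s \<subseteq>\<^sub>m F t" "lex r (F s) (F t)" "list_lex s t"
      using pre(1)[OF st 1] 1 by (simp_all add: lex_def list_lex_def)
    then show ?thesis
      using st 1 pre(2)[OF st 1] meet_le(1)[OF wo tree[OF st(1)]] by (simp add: lcp_prefix)
  next
    case 2
    note le = pre[OF st(2,1) 2]
    have "F s \<subseteq>\<^sub>m F t \<longleftrightarrow> prefix s t"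
    proof
      assume "F s \<subseteq>\<^sub>m F t"
      then have "F s = F t" using le(1) by (rule map_le_antisym)
      then show "prefix s t" using le(2) by simp
    qed (use pre(1) st in blast)
    moreover have "list_lex s t \<longleftrightarrow> lex r (F s) (F t)"
    proof (cases "s = t")
      case False
      have "\<not> lex r (F s) (F t)"
      proof
        assume "lex r (F s) (F t)"
        moreover have "lex r (F t) (F s)" using le(1) by (simp add: lex_def)
        ultimately have "F s = F t" by (intro lex_antisym[OF wo tree tree]) (use st in auto)
        then show False using le(2) False by simp
      qed
      moreover have "\<not> list_lex s t"
      proof
        assume "list_lex s t"
        then consider "prefix s t" | p s' t' where "s = p @ False # s'" "t = p @ True # t'"
          unfolding list_lex_def by blast
        then show False
        proof cases
          case 1
          then show False using 2 False prefix_order.antisym by blast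
        qed (use 2 in simp)
      qed
      ultimately show ?thesis by simp
    qed (simp add: lex_def list_lex_def)
    moreover have "longest_common_prefix s t = t" "meet r (F s) (F t) = F t"
      using 2 meet_le(2)[OF wo tree[OF st(2)] le(1)] by (simp_all add: lcp_prefix)
    ultimately show ?thesis using st le(2) by auto
  next
    case (3 p b s' t')
    note sp = list_embedding_splits[OF wo F st[unfolded 3]]
    have "F s \<noteq> F t" "\<not> F s \<subseteq>\<^sub>m F t" using sp unfolding 3 incomparable_def by auto
    moreover have "\<not> prefix s t" unfolding 3 by simp
    moreover have "longest_common_prefix s t = p" unfolding 3 by (rule lcp_split) simp
    moreover have "list_lex s t \<longleftrightarrow> \<not> b" unfolding 3 by (rule list_lex_split)
    moreover have "lex r (F s) (F t) \<longleftrightarrow> \<not> b" "p \<in> S" "meet r (F s) (F t) = F p"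
      using sp unfolding 3 by auto
    ultimately show ?thesis by simp
  qed
  note all = this
  show "longest_common_prefix s t \<in> S \<and> F (longest_common_prefix s t) = meet r (F s) (F t)"
    if "s \<in> S" "t \<in> S" for s t using all[OF that] by blast
  show "prefix s t \<longleftrightarrow> F s \<subseteq>\<^sub>m F t" if "s \<in> S" "t \<in> S" for s t using all[OF that] by blast
  show "list_lex s t = lex r (F s) (F t)" if "s \<in> S" "t \<in> S" for s t using all[OF that] by blast
  show "inj_on F S" using all by (auto intro: inj_onI)
qed

lemma qf_tp_eqD:
  assumes "qf_tp L T J = qf_tp L T J'" "length J = length J'"
    and "\<phi> \<in> formulas L" "quantifier_free \<phi>" "fv \<phi> \<subseteq> {..<length J}"
  shows "holds T \<phi> J = holds T \<phi> J'"
proof -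
  have "\<phi> \<in> qf_tp L T J \<longleftrightarrow> \<phi> \<in> qf_tp L T J'" using assms(1) by simp
  then show ?thesis using assms(2-5) by (simp add: qf_tp_def)
qed

text \<open>Equality of the types says that sending the value of each term at \<open>J\<close> to
  its value at \<open>J'\<close> is an isomorphism of the generated substructures. In the
  enumeration \<open>e\<close> both substructures become meet-closed sets of positions with the same
  ancestor relation, the input of \<open>tree_ramsey\<close>.\<close>

lemma qf_tp_eq_positions:
  assumes wo: "Well_order r" and A: "A \<subseteq> tree r" "\<And>x y. x \<in> A \<Longrightarrow> y \<in> A \<Longrightarrow> meet r x y \<in> A"
    and e: "bij_betw e {..<N} A" "\<And>i j. i < N \<Longrightarrow> j < N \<Longrightarrow> lex r (e i) (e j) \<longleftrightarrow> i \<le> j"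
    and J: "set J \<subseteq> A" "set J' \<subseteq> A" "length J = length J'"
      "qf_tp L0 (tree_struct r) J = qf_tp L0 (tree_struct r) J'"
  defines "R \<equiv> \<lambda>i j. i < N \<and> j < N \<and> e i \<subseteq>\<^sub>m e j"
  obtains q t t' js where
    "strict_mono_on {..<q} t" "t ` {..<q} \<subseteq> {..<N}" "meet_closed R q t"
    "strict_mono_on {..<q} t'" "t' ` {..<q} \<subseteq> {..<N}" "meet_closed R q t'"
    "pull_back R q t = pull_back R q t'" "set js \<subseteq> {..<q}"
    "J = map (\<lambda>j. e (t j)) js" "J' = map (\<lambda>j. e (t' j)) js"
proof -
  let ?T = "tree_struct r"
  define Tm where "Tm = {u. wf_tm L0 u \<and> fv_tm u \<subseteq> {..<length J}}"
  define val where "val K u = tm_val ?T ((!) K) u" for K u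
  have val_A: "val K u \<in> A" if "u \<in> Tm" "set K \<subseteq> A" "length K = length J" for K u
    using that unfolding Tm_def val_def
  proof (induction u)
    case (Var i)
    then show ?case using nth_mem[of i K] by auto
  next
    case (Fun f ts)
    then have "Some 2 = Some (length ts)" by (simp add: L0_def)
    then obtain a b where ts: "ts = [a, b]" by (rule L0_args)
    have "tm_val ?T ((!) K) a \<in> A" "tm_val ?T ((!) K) b \<in> A" using Fun ts by auto
    then show ?case using A(2) by (simp add: ts tree_struct_def)
  qed
  have valJ: "val J u \<in> A" "val J' u \<in> A" if "u \<in> Tm" for u using val_A that J by auto
  have Meet: "Fun Meet [u, u'] \<in> Tm" "val K (Fun Meet [u, u']) = meet r (val K u) (val K u')"
    if "u \<in> Tm" "u' \<in> Tm" for u u' K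
    using that by (auto simp: Tm_def L0_def val_def tree_struct_def)
  have atomic: "holds ?T \<phi> J = holds ?T \<phi> J'"
    if "wf_fm L0 \<phi>" "quantifier_free \<phi>" "fv \<phi> \<subseteq> {..<length J}" for \<phi>
    using qf_tp_eqD[OF J(4,3)] that by (simp add: formulas_def)
  have eqT: "val J u = val J u' \<longleftrightarrow> val J' u = val J' u'" if "u \<in> Tm" "u' \<in> Tm" for u u'
    using atomic[of "Eq u u'"] that by (simp add: Tm_def holds_def val_def)
  have leT: "val J u \<subseteq>\<^sub>m val J u' \<longleftrightarrow> val J' u \<subseteq>\<^sub>m val J' u'" if "u \<in> Tm" "u' \<in> Tm" for u u'
    using atomic[of "Rel Initial [u, u']"] that
    by (simp add: Tm_def holds_def val_def L0_def tree_struct_def)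
  have lexT: "lex r (val J u) (val J u') \<longleftrightarrow> lex r (val J' u) (val J' u')" if "u \<in> Tm" "u' \<in> Tm" for u u'
    using atomic[of "Rel Lex [u, u']"] that
    by (simp add: Tm_def holds_def val_def L0_def tree_struct_def)
  \<comment> \<open>The positions of the substructure generated by \<open>J\<close>;
    \<open>t\<close> lists them increasingly and \<open>tt\<close> names each by a term.\<close>
  define I where "I = {i. i < N \<and> e i \<in> val J ` Tm}"
  have I: "finite I" "I \<subseteq> {..<N}" by (auto simp: I_def)
  obtain t where t: "strict_mono_on {..<card I} t" "t ` {..<card I} = I"
    using enum_nat_set[OF I(1) refl] by blast
  define q where "q = card I"
  have tN: "t k < N" if "k < q" for k using t(2) I(2) that unfolding q_def by auto
  have "\<exists>u\<in>Tm. val J u = e (t k)" if "k < q" for k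
  proof -
    have "t k \<in> t ` {..<q}" using that by simp
    then have "t k \<in> I" using t(2) by (simp add: q_def)
    then show ?thesis unfolding I_def by auto
  qed
  then obtain tt where tt: "\<And>k. k < q \<Longrightarrow> tt k \<in> Tm \<and> val J (tt k) = e (t k)" by metis
  have hit: "\<exists>k<q. val J u = e (t k)" if "u \<in> Tm" for u
  proof -
    have "val J u \<in> e ` {..<N}" using valJ(1)[OF that] e(1) by (simp add: bij_betw_def)
    then obtain i where i: "i < N" "val J u = e i" by blast
    then have "i \<in> I" using imageI[OF that, of "val J"] by (simp add: I_def)
    then have "i \<in> t ` {..<q}" using t(2) by (simp add: q_def)
    then obtain k where "k < q" "i = t k" by auto
    then show ?thesis using i(2) by auto
  qed
  \<comment> \<open>The corresponding positions for \<open>J'\<close>. They do not depend on the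
    chosen terms, since equations between terms have the same truth values at \<open>J\<close> and
    \<open>J'\<close>.\<close>
  define t' where "t' k = inv_into {..<N} e (val J' (tt k))" for k
  have et': "e (t' k) = val J' (tt k)" "t' k < N" if "k < q" for k
  proof -
    have "val J' (tt k) \<in> e ` {..<N}" using valJ(2) tt[OF that] e(1) by (simp add: bij_betw_def)
    from f_inv_into_f[OF this] inv_into_into[OF this]
    show "e (t' k) = val J' (tt k)" "t' k < N" by (simp_all add: t'_def)
  qed
  have et'_val: "e (t' k) = val J' u" if "k < q" "u \<in> Tm" "val J u = e (t k)" for k u
    using eqT[of "tt k" u] tt[OF that(1)] that et' by simp
  have R_t: "R (t i) (t j) \<longleftrightarrow> R (t' i) (t' j)" if "i < q" "j < q" for i j
    unfolding R_def using that tN et' leT[of "tt i" "tt j"] tt by simp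
  have mono': "strict_mono_on {..<q} t'"
  proof (rule strict_mono_onI)
    fix k k' assume k: "k \<in> {..<q}" "k' \<in> {..<q}" "k < k'"
    then have lt: "t k < t k'" using strict_mono_onD[OF t(1)] by (simp add: q_def)
    have kq: "k < q" "k' < q" using k by auto
    have "lex r (e (t k)) (e (t k'))" "\<not> lex r (e (t k')) (e (t k))" using e(2) tN kq lt by auto
    then have "lex r (e (t' k)) (e (t' k'))" "\<not> lex r (e (t' k')) (e (t' k))"
      using lexT[of "tt k" "tt k'"] lexT[of "tt k'" "tt k"] tt kq et' by simp_all
    then show "t' k < t' k'" using e(2) et'(2) kq by (meson not_le)
  qed
  have e_tree: "e i \<in> tree r" if "i < N" for i using e(1) A(1) that by (auto dest: bij_betwE)
  have R_le: "i \<le> j" if "R i j" for i j using that e(2)[of i j] by (simp add: R_def lex_def)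
  \<comment> \<open>Proved for a general tuple \<open>K\<close> in order to apply to
    \<open>J\<close> and \<open>J'\<close> alike; the meet of two values is the value of the
    \<open>Meet\<close> term.\<close>
  have closed: "meet_closed R q s"
    if s: "\<And>k. k < q \<Longrightarrow> e (s k) = val K (tt k) \<and> s k < N"
      and K: "\<And>k u. k < q \<Longrightarrow> u \<in> Tm \<Longrightarrow> val J u = e (t k) \<Longrightarrow> e (s k) = val K u" for s K
    unfolding meet_closed_def
  proof (intro allI impI)
    fix k k' a assume k: "k < q" "k' < q" and a: "R a (s k)" "R a (s k')"
    have T: "tt k \<in> Tm" "tt k' \<in> Tm" using tt k by auto
    obtain l where l: "l < q" "val J (Fun Meet [tt k, tt k']) = e (t l)" using hit[OF Meet(1)[OF T]] by blast
    then have el: "e (s l) = meet r (e (s k)) (e (s k'))"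
      using K[OF l(1) Meet(1)[OF T] l(2)] Meet(2)[OF T] s k by simp
    have tr: "e (s k) \<in> tree r" "e (s k') \<in> tree r" "e (s l) \<in> tree r"
      using e_tree s[OF k(1)] s[OF k(2)] s[OF l(1)] by metis+
    have "e (s l) \<subseteq>\<^sub>m e (s k)" "e (s l) \<subseteq>\<^sub>m e (s k')"
      using le_meet_iff[OF wo tr(1,2,3)] map_le_refl[of "e (s l)"] unfolding el by auto
    moreover have "e a \<subseteq>\<^sub>m e (s l)"
      using a le_meet_iff[OF wo tr(1,2) e_tree[of a]] unfolding el R_def by blast
    moreover have "s k < N" "s k' < N" "s l < N" "a < N" using s k l(1) a by (auto simp: R_def)
    ultimately have "R (s l) (s k)" "R (s l) (s k')" "R a (s l)" unfolding R_def by auto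
    then show "\<exists>l<q. R (s l) (s k) \<and> R (s l) (s k') \<and> a \<le> s l" using l(1) R_le by blast
  qed
  define js where "js = map (\<lambda>i. SOME k. k < q \<and> J ! i = e (t k)) [0..<length J]"
  have js: "js ! i < q \<and> J ! i = e (t (js ! i))" if "i < length J" for i
  proof -
    have "Var i \<in> Tm" using that by (simp add: Tm_def)
    then have "\<exists>k. k < q \<and> J ! i = e (t k)" using hit[of "Var i"] by (simp add: val_def)
    then have "(SOME k. k < q \<and> J ! i = e (t k)) < q \<and> J ! i = e (t (SOME k. k < q \<and> J ! i = e (t k)))"
      by (rule someI_ex)
    then show ?thesis using that by (simp add: js_def)
  qed
  have js': "J' ! i = e (t' (js ! i))" if "i < length J" for i
    using et'_val[of "js ! i" "Var i"] js[OF that] that by (simp add: Tm_def val_def)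
  have len: "length js = length J" by (simp add: js_def)
  show thesis
  proof (rule that[of q t t' js])
    show "strict_mono_on {..<q} t" "t ` {..<q} \<subseteq> {..<N}" using t I(2) by (simp_all add: q_def)
    show "strict_mono_on {..<q} t'" by (rule mono')
    show "t' ` {..<q} \<subseteq> {..<N}" using et'(2) by auto
    show "meet_closed R q t" by (rule closed[of t J]) (use tt tN in auto)
    show "meet_closed R q t'" by (rule closed[of t' J']) (use et' et'_val in auto)
    show "pull_back R q t = pull_back R q t'" unfolding pull_back_def using R_t by blast
    show "set js \<subseteq> {..<q}" using js len by (auto simp: in_set_conv_nth)
    show "J = map (\<lambda>j. e (t j)) js" using js len by (auto intro: nth_equalityI)
    show "J' = map (\<lambda>j. e (t' j)) js" using js' len J(3) by (auto intro: nth_equalityI)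
  qed
qed

section \<open>Concatenation with zeros\<close>

context
  fixes r :: "'o rel"
  assumes card: "Card_order r" and inf: "infinite (Field r)"
begin

lemma card_wo: "Well_order r"
  using card by (simp add: card_order_on_well_order_on)

text \<open>A set smaller than the cardinal omits an element, and the least omitted element is
  \<open>a\<close>.\<close>

lemma down_closed_underS:
  assumes "D \<subseteq> Field r" "\<And>x y. x \<in> D \<Longrightarrow> (y, x) \<in> r \<Longrightarrow> y \<in> D" "|D| <o r"
  obtains a where "a \<in> Field r" "D = underS r a"
proof -
  have "D \<noteq> Field r"
    using assms(3) card_of_Field_ordIso[OF card] not_ordLess_ordIso by blast
  then have ne: "Field r - D \<noteq> {}" using assms(1) by blast
  obtain m where m: "m \<in> Field r - D" "\<And>x. x \<in> Field r - D \<Longrightarrow> (m, x) \<in> r"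
    using wo_least[OF card_wo _ ne] by auto
  have "D = underS r m"
  proof
    show "D \<subseteq> underS r m"
    proof
      fix x assume x: "x \<in> D"
      then have "(m, x) \<notin> r" using assms(2) m(1) by blast
      then show "x \<in> underS r m" using underS_not[OF card_wo, of x m] x m(1) assms(1) by blast
    qed
    show "underS r m \<subseteq> D"
    proof
      fix x assume x: "x \<in> underS r m"
      then have "x \<in> Field r" using underS_Field[OF card_wo] by blast
      moreover have "(m, x) \<notin> r" using x wo_antisym[OF card_wo] by (auto simp: underS_def)
      ultimately show "x \<in> D" using m(2) by blast
    qed
  qed
  then show thesis using that m(1) by blast
qed

lemma segment_less_iff:
  assumes "x \<in> Field r" "y \<in> Field r"
  shows "Restr r (underS r x) \<le>o Restr r (underS r y) \<longleftrightarrow> (x, y) \<in> r"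
proof -
  have of: "wo_rel.ofilter r (underS r z)" for z
    using card_wo by (simp add: wo_rel_def wo_rel.underS_ofilter)
  have "underS r x \<subseteq> underS r y \<longleftrightarrow> (x, y) \<in> r"
  proof
    assume "underS r x \<subseteq> underS r y"
    then have "y \<notin> underS r x" by (auto simp: underS_def)
    then show "(x, y) \<in> r" using underS_not[OF card_wo] assms by blast
  next
    assume "(x, y) \<in> r"
    then show "underS r x \<subseteq> underS r y"
      using wo_trans[OF card_wo] wo_antisym[OF card_wo] unfolding underS_def by blast
  qed
  then show ?thesis using ofilter_subset_ordLeq[OF card_wo of of] by simp
qed

lemma segment_unique:
  assumes "x \<in> Field r" "y \<in> Field r" "Restr r (underS r x) =o Restr r (underS r y)"
  shows "x = y"
  using assms segment_less_iff wo_antisym[OF card_wo] by (meson ordIso_iff_ordLeq)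

context
  fixes a :: 'o
  assumes a: "a \<in> Field r"
begin

text \<open>The difference lies inside an initial segment of the cardinal \<open>r\<close>. It is
  smaller than \<open>r\<close>, so its order type is that of a proper initial segment, and such a
  segment is determined by its type.\<close>

lemma ord_minus_ex:
  assumes "x \<in> Field r"
  shows "ord_minus r (underS r a) x \<in> Field r \<and>
    Restr r (underS r x - underS r a) =o Restr r (underS r (ord_minus r (underS r a) x))"
proof -
  let ?W = "Restr r (underS r x - underS r a)"
  have W: "Well_order ?W" by (rule Well_order_Restr[OF card_wo])
  have "?W <o r"
  proof (rule ccontr)
    assume "\<not> ?W <o r"
    then have "r \<le>o ?W" using ordLess_or_ordLeq[OF W card_wo] by blast
    then have "|Field r| \<le>o |Field ?W|" by (rule card_of_mono2)
    also have "|Field ?W| \<le>o |underS r x|" by (rule card_of_mono1) (auto simp: Field_def)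
    also have "|underS r x| <o r" by (rule card_of_underS[OF card assms])
    finally show False using card_of_Field_ordIso[OF card] not_ordLess_ordIso by blast
  qed
  then obtain y where y: "y \<in> Field r" "?W =o Restr r (underS r y)"
    using ordLess_iff_ordIso_Restr[OF card_wo W] by blast
  have "\<exists>!y. y \<in> Field r \<and> ?W =o Restr r (underS r y)"
  proof (rule ex1I[of _ y])
    fix z assume "z \<in> Field r \<and> ?W =o Restr r (underS r z)"
    then show "z = y"
      using segment_unique y ordIso_transitive ordIso_symmetric by blast
  qed (use y in blast)
  then show ?thesis unfolding ord_minus_def by (rule theI')
qed

lemma rest_ofilter:
  "wo_rel.ofilter (Restr r (Field r - underS r a)) (underS r x - underS r a)"
  "Restr (Restr r (Field r - underS r a)) (underS r x - underS r a) = Restr r (underS r x - underS r a)"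
proof -
  let ?r = "Restr r (Field r - underS r a)"
  have F: "Field ?r = Field r - underS r a"
    using wo_refl[OF card_wo] by (auto simp: Field_def)
  have w: "wo_rel ?r" using Well_order_Restr[OF card_wo] by (simp add: wo_rel_def)
  show "wo_rel.ofilter ?r (underS r x - underS r a)"
    unfolding wo_rel.ofilter_def[OF w] F using underS_Field[OF card_wo, of x] underS_down[OF card_wo, of _ x]
    by (auto simp: under_def)
  show "Restr ?r (underS r x - underS r a) = Restr r (underS r x - underS r a)"
    using underS_Field[OF card_wo, of x] by auto
qed

lemma ord_minus_mono:
  assumes "(x, y) \<in> r"
  shows "(ord_minus r (underS r a) x, ord_minus r (underS r a) y) \<in> r"
proof -
  have xy: "x \<in> Field r" "y \<in> Field r" using assms by (auto simp: Field_def)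
  have "underS r x \<subseteq> underS r y"
    using assms wo_trans[OF card_wo] wo_antisym[OF card_wo] unfolding underS_def by blast
  then have "underS r x - underS r a \<subseteq> underS r y - underS r a" by blast
  then have "Restr r (underS r x - underS r a) \<le>o Restr r (underS r y - underS r a)"
    using ofilter_subset_ordLeq[OF Well_order_Restr[OF card_wo] rest_ofilter(1) rest_ofilter(1), of x y]
    by (simp add: rest_ofilter(2))
  then show ?thesis
    using ord_minus_ex[OF xy(1)] ord_minus_ex[OF xy(2)] segment_less_iff
    by (meson ordIso_ordLeq_trans ordIso_symmetric ordLeq_ordIso_trans)
qed

lemma ord_minus_inj:
  assumes "(a, x) \<in> r" "(x, y) \<in> r" "x \<noteq> y"
  shows "ord_minus r (underS r a) x \<noteq> ord_minus r (underS r a) y"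
proof
  assume eq: "ord_minus r (underS r a) x = ord_minus r (underS r a) y"
  have xy: "x \<in> Field r" "y \<in> Field r" using assms by (auto simp: Field_def)
  have "underS r x \<subseteq> underS r y"
    using assms wo_trans[OF card_wo] wo_antisym[OF card_wo] unfolding underS_def by blast
  moreover have "x \<in> underS r y" "x \<notin> underS r x" "x \<notin> underS r a"
    using assms wo_antisym[OF card_wo] by (auto simp: underS_def)
  ultimately have "underS r x - underS r a \<subset> underS r y - underS r a" by blast
  then have "Restr r (underS r x - underS r a) <o Restr r (underS r y - underS r a)"
    using ofilter_subset_ordLess[OF Well_order_Restr[OF card_wo] rest_ofilter(1) rest_ofilter(1), of x y]
    by (simp add: rest_ofilter(2))
  moreover have "Restr r (underS r x - underS r a) =o Restr r (underS r y - underS r a)"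
    using ord_minus_ex[OF xy(1)] ord_minus_ex[OF xy(2)] eq ordIso_transitive ordIso_symmetric by metis
  ultimately show False using not_ordLess_ordIso by blast
qed

text \<open>An infinite cardinal is not a union of two smaller sets. Hence the part from
  \<open>a\<close> onwards has an order type of at least \<open>r\<close>, and every
  \<open>i\<close> occurs as a difference. This makes the nodes \<open>\<rho> 0\<^sup>i\<close> grow
  strictly with \<open>i\<close>.\<close>

lemma ord_minus_surj:
  assumes i: "i \<in> Field r"
  obtains x where "x \<in> Field r" "(a, x) \<in> r" "ord_minus r (underS r a) x = i"
proof -
  let ?r = "Restr r (Field r - underS r a)"
  have w: "Well_order ?r" by (rule Well_order_Restr[OF card_wo])
  have F: "Field ?r = Field r - underS r a"
    using wo_refl[OF card_wo] by (auto simp: Field_def)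
  have "r \<le>o ?r"
  proof (rule ccontr)
    assume "\<not> r \<le>o ?r"
    then have "?r <o r" using not_ordLeq_iff_ordLess[OF w card_wo] by blast
    have "|Field r - underS r a| \<le>o ?r"
      using card_of_least[of "Field r - underS r a" ?r] w unfolding F .
    then have "|Field r - underS r a| <o r" using \<open>?r <o r\<close> ordLeq_ordLess_trans by blast
    then have "|(Field r - underS r a) \<union> underS r a| <o r"
      using card_of_underS[OF card a] card_of_Un_ordLess_infinite_Field[OF inf card] by blast
    moreover have "(Field r - underS r a) \<union> underS r a = Field r" using underS_Field[OF card_wo] by blast
    ultimately show False using card_of_Field_ordIso[OF card] not_ordLess_ordIso by metis
  qed
  moreover have "Restr r (underS r i) <o r"
    using underS_Restr_ordLess[OF card_wo] i by blast
  ultimately have "Restr r (underS r i) <o ?r" by (metis ordLess_ordLeq_trans)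
  then obtain x where x: "x \<in> Field ?r" "Restr r (underS r i) =o Restr ?r (underS ?r x)"
    using ordLess_iff_ordIso_Restr[OF w Well_order_Restr[OF card_wo]] by blast
  have xF: "x \<in> Field r" "x \<notin> underS r a" using x(1) unfolding F by blast+
  have "underS ?r x = underS r x - underS r a"
    using xF underS_Field[OF card_wo, of x] by (auto simp: underS_def)
  then have iso: "Restr r (underS r i) =o Restr r (underS r x - underS r a)"
    using x(2) rest_ofilter(2)[of x] by simp
  then have "ord_minus r (underS r a) x = i"
    using ord_minus_ex[OF xF(1)] i segment_unique by (meson ordIso_symmetric ordIso_transitive)
  moreover have "(a, x) \<in> r" using underS_not[OF card_wo xF(1) a] xF(2) by blast
  ultimately show thesis using that xF(1) by blast
qed

lemma dom_concat_zeros: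
  assumes \<rho>: "dom \<rho> = underS r a" and i: "i \<in> Field r"
  defines "c \<equiv> concat_node r \<rho> (zeros r i)"
  shows "dom c = underS r a \<union> {x \<in> Field r. (a, x) \<in> r \<and> ord_minus r (underS r a) x \<in> underS r i}"
    and "\<And>x. x \<in> underS r a \<Longrightarrow> c x = \<rho> x"
    and "\<And>x. x \<in> dom c \<Longrightarrow> x \<notin> underS r a \<Longrightarrow> c x = Some False"
proof -
  have c: "c x = (if x \<in> underS r a then \<rho> x
      else if x \<in> Field r \<and> ord_minus r (underS r a) x \<in> underS r i then Some False else None)" for x
    by (simp add: c_def concat_node_def zeros_def \<rho>)
  show "\<And>x. x \<in> underS r a \<Longrightarrow> c x = \<rho> x" by (simp add: c)
  show "\<And>x. x \<in> dom c \<Longrightarrow> x \<notin> underS r a \<Longrightarrow> c x = Some False"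
    by (auto simp: c split: if_splits)
  have "c x \<noteq> None \<longleftrightarrow> x \<in> underS r a \<or> x \<in> Field r \<and> (a, x) \<in> r \<and> ord_minus r (underS r a) x \<in> underS r i" for x
    using \<rho> underS_not[OF card_wo _ a, of x] by (auto simp: c dom_def)
  then show "dom c = underS r a \<union> {x \<in> Field r. (a, x) \<in> r \<and> ord_minus r (underS r a) x \<in> underS r i}"
    by blast
qed

text \<open>The sum of two ordinals below an infinite cardinal stays below it: the domain is
  down-closed and a union of two small sets.\<close>

lemma concat_zeros_tree:
  assumes \<rho>: "dom \<rho> = underS r a" and i: "i \<in> Field r"
  shows "concat_node r \<rho> (zeros r i) \<in> tree r"
proof -
  let ?D = "{x \<in> Field r. (a, x) \<in> r \<and> ord_minus r (underS r a) x \<in> underS r i}"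
  let ?m = "ord_minus r (underS r a)"
  have "inj_on ?m ?D"
  proof (rule inj_onI)
    fix x y assume xy: "x \<in> ?D" "y \<in> ?D" "?m x = ?m y"
    then consider "(x, y) \<in> r" | "(y, x) \<in> r" using wo_total[OF card_wo] by blast
    then show "x = y"
      using ord_minus_inj[of x y] ord_minus_inj[of y x] xy by cases auto
  qed
  then have "|?D| \<le>o |underS r i|" by (rule card_of_ordLeqI) blast
  then have "|?D| <o r" using card_of_underS[OF card i] ordLeq_ordLess_trans by blast
  then have small: "|underS r a \<union> ?D| <o r"
    using card_of_underS[OF card a] card_of_Un_ordLess_infinite_Field[OF inf card] by blast
  have sub: "underS r a \<union> ?D \<subseteq> Field r" using underS_Field[OF card_wo] by blast
  have down: "y \<in> underS r a \<union> ?D" if x: "x \<in> underS r a \<union> ?D" and "(y, x) \<in> r" for x y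
  proof (cases "y \<in> underS r a")
    case False
    have yF: "y \<in> Field r" using that(2) by (auto simp: Field_def)
    then have "(a, y) \<in> r" using False underS_not[OF card_wo _ a] by blast
    moreover have "x \<notin> underS r a" using False underS_down[OF card_wo] that(2) by blast
    then have "?m x \<in> underS r i" using x by blast
    then have "?m y \<in> underS r i" using underS_down[OF card_wo] ord_minus_mono[OF that(2)] by blast
    ultimately show ?thesis using yF by blast
  qed blast
  obtain b where b: "b \<in> Field r" "underS r a \<union> ?D = underS r b"
    by (rule down_closed_underS[OF sub down small])
  have "dom (concat_node r \<rho> (zeros r i)) = underS r b"
    unfolding dom_concat_zeros(1)[OF \<rho> i] by (rule b(2))
  then show ?thesis using b(1) unfolding tree_def by blast
qed

lemma concat_zeros_less:
  assumes \<rho>: "dom \<rho> = underS r a" and ij: "(i, j) \<in> r" "i \<noteq> j"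
  shows "concat_node r \<rho> (zeros r i) \<subseteq>\<^sub>m concat_node r \<rho> (zeros r j)"
    and "concat_node r \<rho> (zeros r i) \<noteq> concat_node r \<rho> (zeros r j)"
proof -
  have F: "i \<in> Field r" "j \<in> Field r" using ij by (auto simp: Field_def)
  note ci = dom_concat_zeros[OF \<rho> F(1)] and cj = dom_concat_zeros[OF \<rho> F(2)]
  have "underS r i \<subseteq> underS r j"
    using ij wo_trans[OF card_wo] wo_antisym[OF card_wo] unfolding underS_def by blast
  then have sub: "dom (concat_node r \<rho> (zeros r i)) \<subseteq> dom (concat_node r \<rho> (zeros r j))"
    unfolding ci(1) cj(1) by blast
  show "concat_node r \<rho> (zeros r i) \<subseteq>\<^sub>m concat_node r \<rho> (zeros r j)"
    unfolding map_le_def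
  proof
    fix x assume x: "x \<in> dom (concat_node r \<rho> (zeros r i))"
    show "concat_node r \<rho> (zeros r i) x = concat_node r \<rho> (zeros r j) x"
    proof (cases "x \<in> underS r a")
      case True
      show ?thesis unfolding ci(2)[OF True] cj(2)[OF True] ..
    next
      case False
      show ?thesis unfolding ci(3)[OF x False] cj(3)[OF subsetD[OF sub x] False] ..
    qed
  qed
  obtain x where x: "x \<in> Field r" "(a, x) \<in> r" "ord_minus r (underS r a) x = i"
    using ord_minus_surj[OF F(1)] by blast
  have "x \<notin> underS r a" using x(2) wo_antisym[OF card_wo] by (auto simp: underS_def)
  moreover have "i \<in> underS r j" "i \<notin> underS r i" using ij by (auto simp: underS_def)
  ultimately have "x \<in> dom (concat_node r \<rho> (zeros r j))" "x \<notin> dom (concat_node r \<rho> (zeros r i))"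
    unfolding ci(1) cj(1) using x by blast+
  then show "concat_node r \<rho> (zeros r i) \<noteq> concat_node r \<rho> (zeros r j)" by metis
qed

lemma concat_zeros_zero:
  assumes \<rho>: "dom \<rho> = underS r a" and i: "i \<in> Field r" "underS r i = {}"
  shows "concat_node r \<rho> (zeros r i) = \<rho>"
proof -
  note c = dom_concat_zeros[OF \<rho> i(1)]
  show ?thesis
  proof
    fix x show "concat_node r \<rho> (zeros r i) x = \<rho> x"
    proof (cases "x \<in> underS r a")
      case False
      then have "x \<notin> dom (concat_node r \<rho> (zeros r i))" "x \<notin> dom \<rho>" unfolding c(1) \<rho> i(2) by blast+
      then show ?thesis by (simp add: domIff)
    qed (rule c(2))
  qed
qed

end

end

section \<open>Indiscernible sequences\<close>

abbreviation ascending :: "'o rel \<Rightarrow> 'o list \<Rightarrow> bool" where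
  "ascending r \<equiv> sorted_wrt (\<lambda>x y. x \<noteq> y \<and> (x, y) \<in> r)"

lemma ascending_enumeration:
  assumes wo: "Well_order r" and X: "finite X" "X \<subseteq> Field r"
  obtains l where "set l = X" "length l = card X" "ascending r l"
proof -
  have "\<exists>l. set l = X \<and> length l = card X \<and> ascending r l" using X
  proof (induction "card X" arbitrary: X)
    case (Suc n)
    then have "X \<noteq> {}" by auto
    then obtain m where m: "m \<in> X" "\<And>x. x \<in> X \<Longrightarrow> (m, x) \<in> r" using wo_least[OF wo Suc.prems(2)] by blast
    have "n = card (X - {m})" using Suc.hyps(2) Suc.prems(1) m(1) by simp
    then obtain l where l: "set l = X - {m}" "length l = card (X - {m})" "ascending r l"
      using Suc.hyps(1)[of "X - {m}"] Suc.prems by auto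
    then have "set (m # l) = X" "length (m # l) = card X" "ascending r (m # l)"
      using m \<open>n = card (X - {m})\<close> Suc.hyps(2) by auto
    then show ?case by blast
  qed simp
  then show thesis using that by blast
qed

lemma ascending_positions:
  assumes wo: "Well_order r" and l: "ascending r l" and "is": "ascending r is" "set is \<subseteq> set l"
  obtains f where "strict_mono_on {..<length is} f" "f ` {..<length is} \<subseteq> {..<length l}"
    "is = map (\<lambda>k. l ! f k) [0..<length is]"
proof -
  have less: "k < k'" if "k < length l" "k' < length l" "l ! k \<noteq> l ! k'" "(l ! k, l ! k') \<in> r" for k k'
  proof (rule ccontr)
    assume "\<not> k < k'"
    then have "k' < k" using that(3) by (metis linorder_neqE_nat)
    then have "(l ! k', l ! k) \<in> r" using l that(1) by (auto simp: sorted_wrt_iff_nth_less)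
    then show False using wo_antisym[OF wo] that by blast
  qed
  have "\<forall>k<length is. \<exists>j<length l. is ! k = l ! j"
    using "is"(2) by (metis in_set_conv_nth nth_mem subsetD)
  then obtain f where f: "\<And>k. k < length is \<Longrightarrow> f k < length l \<and> is ! k = l ! f k" by metis
  show thesis
  proof (rule that)
    show "strict_mono_on {..<length is} f"
    proof (rule strict_mono_onI)
      fix k k' assume k: "k \<in> {..<length is}" "k' \<in> {..<length is}" "k < k'"
      then have "is ! k \<noteq> is ! k' \<and> (is ! k, is ! k') \<in> r"
        using "is"(1) by (auto simp: sorted_wrt_iff_nth_less)
      then show "f k < f k'" using less[of "f k" "f k'"] f k by auto
    qed
    show "f ` {..<length is} \<subseteq> {..<length l}" using f by auto
    show "is = map (\<lambda>k. l ! f k) [0..<length is]" using f by (auto intro: nth_equalityI)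
  qed
qed

lemma ascending_map:
  assumes l: "ascending r l" and f: "strict_mono_on {..<n} f" "f ` {..<n} \<subseteq> {..<length l}"
  shows "ascending r (map (\<lambda>k. l ! f k) [0..<n])"
  unfolding sorted_wrt_iff_nth_less
proof (intro allI impI)
  fix i j assume ij: "i < j" "j < length (map (\<lambda>k. l ! f k) [0..<n])"
  then have "f i < f j" using strict_mono_onD[OF f(1)] by simp
  moreover have "f j < length l" using f(2) ij by auto
  ultimately show "map (\<lambda>k. l ! f k) [0..<n] ! i \<noteq> map (\<lambda>k. l ! f k) [0..<n] ! j \<and>
      (map (\<lambda>k. l ! f k) [0..<n] ! i, map (\<lambda>k. l ! f k) [0..<n] ! j) \<in> r"
    using l ij by (simp add: sorted_wrt_iff_nth_less)
qed

lemma tuples_iff: "xs \<in> tuples M n \<longleftrightarrow> set xs \<subseteq> univ M \<and> length xs = n"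
  by (auto simp: tuples_def lists_eq_set)

text \<open>The parameters of a type over \<open>set b\<close> are lists that may permute, repeat or
  omit entries of \<open>b\<close>. Renaming reduces them to \<open>b\<close> itself, so that
  equality of types can be tested with one fixed parameter list.\<close>

lemma holds_parameters:
  fixes M :: "('a, 'b, 'c) struct" and b :: "'c list"
  assumes \<phi>: "\<phi> \<in> formulas L" "fv \<phi> \<subseteq> {..<N + length c}" and c: "set c \<subseteq> set b"
  obtains \<theta> where "\<theta> \<in> formulas L" "fv \<theta> \<subseteq> {..<N + length b}"
    "\<And>xs. length xs = N \<Longrightarrow> holds M \<theta> (xs @ b) = holds M \<phi> (xs @ c)"
proof -
  define pos where "pos x = (SOME k. k < length b \<and> b ! k = x)" for x
  have pos: "pos x < length b \<and> b ! pos x = x" if "x \<in> set c" for x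
  proof -
    have "\<exists>k. k < length b \<and> b ! k = x" using that c by (metis in_set_conv_nth subsetD)
    then show ?thesis unfolding pos_def by (rule someI_ex)
  qed
  define s where "s k = (if k < N then k else N + pos (c ! (k - N)))" for k
  have s: "s k < N + length b \<and> (length xs = N \<longrightarrow> (xs @ b) ! s k = (xs @ c) ! k)" if "k \<in> fv \<phi>" for k and xs :: "'c list"
  proof (cases "k < N")
    case False
    then have "k - N < length c" using that \<phi>(2) by auto
    then show ?thesis using pos[of "c ! (k - N)"] False by (simp add: s_def nth_append)
  qed (simp add: s_def nth_append)
  show thesis
  proof (rule that[of "ren s \<phi>"])
    show "ren s \<phi> \<in> formulas L" using \<phi>(1) by (simp add: formulas_def wf_ren)
    show "fv (ren s \<phi>) \<subseteq> {..<N + length b}" using s by (auto simp: fv_ren)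
    fix xs :: "'c list" assume "length xs = N"
    then show "holds M (ren s \<phi>) (xs @ b) = holds M \<phi> (xs @ c)"
      unfolding holds_def sat_ren by (intro sat_cong) (use s in simp)
  qed
qed

lemma tp_eq_parametersI:
  assumes len: "length xs = length ys"
    and eq: "\<And>\<theta>. \<theta> \<in> formulas L \<Longrightarrow> fv \<theta> \<subseteq> {..<length xs + length b} \<Longrightarrow>
      holds M \<theta> (xs @ b) = holds M \<theta> (ys @ b)"
  shows "tp L M xs (set b) = tp L M ys (set b)"
proof -
  have "holds M \<phi> (xs @ c) = holds M \<phi> (ys @ c)"
    if \<phi>: "\<phi> \<in> formulas L" "fv \<phi> \<subseteq> {..<length xs + length c}" "set c \<subseteq> set b" for \<phi> c
  proof -
    show ?thesis
    proof (rule holds_parameters[OF \<phi>])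
      fix \<theta> assume t: "\<theta> \<in> formulas L" "fv \<theta> \<subseteq> {..<length xs + length b}"
        "\<And>zs. length zs = length xs \<Longrightarrow> holds M \<theta> (zs @ b) = holds M \<phi> (zs @ c)"
      show ?thesis using eq[OF t(1,2)] t(3)[of xs] t(3)[of ys] len by simp
    qed
  qed
  then show ?thesis unfolding tp_def formulas_over_def using len by (auto simp: lists_eq_set)
qed

lemma holds_finite_conj:
  fixes M :: "('a, 'b, 'c) struct"
  assumes "finite \<Phi>" "\<And>\<phi>. \<phi> \<in> \<Phi> \<Longrightarrow> \<phi> \<in> formulas L \<and> fv \<phi> \<subseteq> {..<n}"
  obtains \<psi> where "\<psi> \<in> formulas L" "fv \<psi> \<subseteq> {..<n}"
    "\<And>xs. length xs = n \<Longrightarrow> holds M \<psi> xs \<longleftrightarrow> (\<forall>\<phi>\<in>\<Phi>. holds M \<phi> xs)"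
proof -
  have "definable L M (set [0..<n]) (\<lambda>g. \<forall>\<phi>\<in>\<Phi>. holds M \<phi> (map g [0..<n]))"
    by (rule definable_ball[OF assms(1)], rule definable_holds) (use assms(2) in auto)
  then show thesis
  proof (rule definable_formula)
    fix \<psi> assume p: "\<psi> \<in> formulas L" "fv \<psi> \<subseteq> {..<length [0..<n]}"
      "\<And>g. (\<forall>\<phi>\<in>\<Phi>. holds M \<phi> (map g [0..<n])) = holds M \<psi> (map g [0..<n])"
    show thesis
    proof (rule that[OF p(1)])
      fix xs :: "'c list" assume "length xs = n"
      then have "map ((!) xs) [0..<n] = xs" using map_nth[of xs] by simp
      then show "holds M \<psi> xs \<longleftrightarrow> (\<forall>\<phi>\<in>\<Phi>. holds M \<phi> xs)" using p(3)[of "(!) xs"] by simp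
    qed (use p(2) in simp)
  qed
qed

text \<open>
  Any finitely many formulas that express indiscernibility hold along a subsequence given by
  Ramsey's theorem, and the sequence is indiscernible, so compactness applies.
\<close>

lemma indiscernible_realization:
  fixes \<mu> :: "'l rel" and r :: "'o rel" and s :: "'o \<Rightarrow> 'a list" and M :: "('f, 'r, 'a) struct"
  assumes sat: "saturated L M \<mu>" and ne: "univ M \<noteq> {}"
    and wo: "Well_order r" and inf: "infinite (Field r)"
    and small: "|Inl ` {..<m} \<union> Inr ` (Field r \<times> {..<n}) :: (nat + 'o \<times> nat) set| <o \<mu>"
    and s: "\<And>i. i \<in> Field r \<Longrightarrow> s i \<in> tuples M n"
    and ind: "indiscernible_seq L M r s {}"
    and b: "b \<in> tuples M m" and i0: "i0 \<in> Field r"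
    and cons: "\<And>\<phi> I. \<phi> \<in> formulas L \<Longrightarrow> fv \<phi> \<subseteq> {..<m + n} \<Longrightarrow> holds M \<phi> (b @ s i0) \<Longrightarrow>
      finite I \<Longrightarrow> I \<subseteq> Field r \<Longrightarrow> \<exists>x\<in>tuples M m. \<forall>i\<in>I. holds M \<phi> (x @ s i)"
  obtains b' where "b' \<in> tuples M m" "indiscernible_seq L M r s (set b')"
    "tp L M b (set (s i0)) = tp L M b' (set (s i0))"
proof -
  \<comment> \<open>The variables \<open>Inl k\<close> are the unknown entries of \<open>b'\<close>,
    and \<open>Inr (i, j)\<close> is the given entry \<open>j\<close> of \<open>s i\<close>.
    \<open>\<Phi>\<close> expresses that \<open>b'\<close> has the type of \<open>b\<close> over
    \<open>s i0\<close>, and \<open>\<Theta>\<close> the indiscernibility over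
    \<open>b'\<close>.\<close>
  define xs :: "(nat + 'o \<times> nat) list" where "xs = map Inl [0..<m]"
  define ys where "ys i = map (\<lambda>j. Inr (i, j) :: nat + 'o \<times> nat) [0..<n]" for i
  define V where "V = (Inl ` {..<m} \<union> Inr ` (Field r \<times> {..<n}) :: (nat + 'o \<times> nat) set)"
  define g0 where "g0 v = (case v of Inl k \<Rightarrow> b ! k | Inr (i, j) \<Rightarrow> s i ! j)" for v
  define \<Theta> where "\<Theta> = {(\<theta>, is, js). \<theta> \<in> formulas L \<and> set is \<subseteq> Field r \<and> set js \<subseteq> Field r \<and>
     length is = length js \<and> ascending r is \<and> ascending r js \<and> fv \<theta> \<subseteq> {..<length is * n + m}}"
  define \<Phi> where "\<Phi> = {\<phi> \<in> formulas L. fv \<phi> \<subseteq> {..<m + n} \<and> holds M \<phi> (b @ s i0)}"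
  define P where "P c g \<longleftrightarrow> (case c of Inl \<phi> \<Rightarrow> holds M \<phi> (map g (xs @ ys i0))
     | Inr (\<theta>, is, js) \<Rightarrow> holds M \<theta> (map g (concat (map ys is) @ xs)) =
         holds M \<theta> (map g (concat (map ys js) @ xs)))" for c g
  define C where "C = Inl ` \<Phi> \<union> Inr ` \<Theta>"
  have len_ys: "length (concat (map ys is)) = length is * n" for "is"
    by (induction "is") (auto simp: ys_def)
  have set_ys: "set (concat (map ys is)) = Inr ` (set is \<times> {..<n})" for "is"
    by (auto simp: ys_def)
  have defP: "definable L M V (P c)" if "c \<in> C" for c
  proof -
    consider \<phi> where "c = Inl \<phi>" "\<phi> \<in> \<Phi>" | \<theta> "is" js where "c = Inr (\<theta>, is, js)" "(\<theta>, is, js) \<in> \<Theta>"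
    proof (cases c)
      case (Inr y)
      then show ?thesis using that(2) \<open>c \<in> C\<close> by (cases y) (auto simp: C_def)
    qed (use that(1) \<open>c \<in> C\<close> in \<open>auto simp: C_def\<close>)
    then show ?thesis
    proof cases
      case 1
      have "definable L M (set (xs @ ys i0)) (\<lambda>g. holds M \<phi> (map g (xs @ ys i0)))"
        by (rule definable_holds) (use 1(2) in \<open>auto simp: \<Phi>_def xs_def ys_def\<close>)
      then show ?thesis unfolding P_def 1(1) sum.case
        by (rule definable_mono) (use i0 in \<open>auto simp: xs_def ys_def V_def\<close>)
    next
      case 2
      have "definable L M V (\<lambda>g. holds M \<theta> (map g (concat (map ys ks) @ xs)))" if "ks = is \<or> ks = js" for ks
      proof -
        have "definable L M (set (concat (map ys ks) @ xs)) (\<lambda>g. holds M \<theta> (map g (concat (map ys ks) @ xs)))"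
          by (rule definable_holds) (use 2(2) that in \<open>auto simp: \<Theta>_def len_ys xs_def\<close>)
        then show ?thesis
          by (rule definable_mono) (use 2(2) that in \<open>auto simp: \<Theta>_def set_ys xs_def V_def simp del: set_concat\<close>)
      qed
      then show ?thesis unfolding P_def 2(1) sum.case prod.case by (intro definable_iff) auto
    qed
  qed
  have map_ys: "map g (concat (map ys is)) = concat (map (\<lambda>i. map (\<lambda>j. g (Inr (i, j))) [0..<n]) is)" for g "is"
    by (induction "is") (auto simp: ys_def)
  have s_nth: "map (\<lambda>j. s i ! j) [0..<n] = s i" if "i \<in> Field r" for i
    using s[OF that] map_nth[of "s i"] by (simp add: tuples_iff)
  have g0_ys: "map g (concat (map ys is)) = concat (map s is)"
    if "set is \<subseteq> Field r" and g: "\<And>i j. i \<in> Field r \<Longrightarrow> j < n \<Longrightarrow> g (Inr (i, j)) = s i ! j" for g "is"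
  proof -
    have "map (\<lambda>j. g (Inr (i, j))) [0..<n] = s i" if "i \<in> Field r" for i
    proof -
      have "map (\<lambda>j. g (Inr (i, j))) [0..<n] = map (\<lambda>j. s i ! j) [0..<n]" using g[OF that] by simp
      then show ?thesis using s_nth[OF that] by simp
    qed
    then have "map (\<lambda>i. map (\<lambda>j. g (Inr (i, j))) [0..<n]) is = map s is"
      using \<open>set is \<subseteq> Field r\<close> by auto
    then show ?thesis unfolding map_ys by (rule arg_cong)
  qed
  have univ_g0: "s i ! j \<in> univ M" if "i \<in> Field r" "j < n" for i j
    using s[OF that(1)] that(2) unfolding tuples_iff by (metis nth_mem subsetD)
  have fs: "\<exists>g. (\<forall>v\<in>V. g v \<in> univ M) \<and> (\<forall>v\<in>Inr ` (Field r \<times> {..<n}). g v = g0 v) \<and> (\<forall>c\<in>S0. P c g)"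
    if S0: "S0 \<subseteq> C" "finite S0" for S0
  proof -
    define \<Phi>0 where "\<Phi>0 = {\<phi>. Inl \<phi> \<in> S0}"
    define \<Theta>0 where "\<Theta>0 = {x. Inr x \<in> S0}"
    have fin: "finite \<Phi>0" "finite \<Theta>0"
      unfolding \<Phi>0_def \<Theta>0_def using S0(2) by (auto intro: finite_vimageI[of S0 Inl, unfolded vimage_def] finite_vimageI[of S0 Inr, unfolded vimage_def])
    have \<Phi>0: "\<phi> \<in> \<Phi>" if "\<phi> \<in> \<Phi>0" for \<phi> using that S0(1) by (auto simp: \<Phi>0_def C_def)
    have \<Theta>0: "x \<in> \<Theta>" if "x \<in> \<Theta>0" for x using that S0(1) by (auto simp: \<Theta>0_def C_def)
    obtain \<psi> where \<psi>: "\<psi> \<in> formulas L" "fv \<psi> \<subseteq> {..<m + n}"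
        "\<And>zs. length zs = m + n \<Longrightarrow> holds M \<psi> zs \<longleftrightarrow> (\<forall>\<phi>\<in>\<Phi>0. holds M \<phi> zs)"
      using holds_finite_conj[OF fin(1), of L "m + n" M] \<Phi>0 unfolding \<Phi>_def by blast
    have lens: "length (x @ s i) = m + n" if "x \<in> tuples M m" "i \<in> Field r" for x i
      using that(1) s[OF that(2)] by (simp add: tuples_iff)
    have "holds M \<psi> (b @ s i0)" using \<psi>(3)[OF lens[OF b i0]] \<Phi>0 by (auto simp: \<Phi>_def)
    define I0 where "I0 = insert i0 (\<Union>(\<theta>, is, js)\<in>\<Theta>0. set is \<union> set js)"
    have "set is \<union> set js \<subseteq> Field r" if "(\<theta>, is, js) \<in> \<Theta>0" for \<theta> "is" js
      using \<Theta>0[OF that] by (simp add: \<Theta>_def)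
    then have I0: "finite I0" "I0 \<subseteq> Field r"
      using fin(2) i0 unfolding I0_def by (auto, blast+)
    obtain l where l: "set l = I0" "length l = card I0" "ascending r l"
      by (rule ascending_enumeration[OF wo I0])
    let ?U = "\<lambda>(\<theta> :: ('f, 'r) fm, is :: 'o list, js :: 'o list). {..<length is}"
    have "\<exists>n. \<forall>(Q :: ('f, 'r) fm \<times> 'o list \<times> 'o list \<Rightarrow> (nat \<Rightarrow> nat) \<Rightarrow> bool) V. finite V \<longrightarrow> n \<le> card V \<longrightarrow>
      (\<forall>x\<in>\<Theta>0. \<forall>w w'. (\<forall>u\<in>?U x. w u = w' u) \<longrightarrow> Q x w = Q x w') \<longrightarrow>
      (\<exists>Y\<subseteq>V. card Y = length l \<and>
        (\<forall>x\<in>\<Theta>0. \<forall>w w'. strict_mono_on (?U x) w \<and> strict_mono_on (?U x) w' \<and>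
         w ` ?U x \<subseteq> Y \<and> w' ` ?U x \<subseteq> Y \<longrightarrow> Q x w = Q x w'))"
      by (rule ramsey_strict_mono[OF fin(2)]) auto
    then obtain q where q: "\<forall>(Q :: ('f, 'r) fm \<times> 'o list \<times> 'o list \<Rightarrow> (nat \<Rightarrow> nat) \<Rightarrow> bool) V. finite V \<longrightarrow> q \<le> card V \<longrightarrow>
      (\<forall>x\<in>\<Theta>0. \<forall>w w'. (\<forall>u\<in>?U x. w u = w' u) \<longrightarrow> Q x w = Q x w') \<longrightarrow>
      (\<exists>Y\<subseteq>V. card Y = length l \<and>
        (\<forall>x\<in>\<Theta>0. \<forall>w w'. strict_mono_on (?U x) w \<and> strict_mono_on (?U x) w' \<and>
         w ` ?U x \<subseteq> Y \<and> w' ` ?U x \<subseteq> Y \<longrightarrow> Q x w = Q x w'))"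
      by (elim exE)
    \<comment> \<open>\<open>D\<close> has as many indices as Ramsey's theorem asks for;
      \<open>cons\<close> provides one \<open>x\<close> that satisfies \<open>\<psi>\<close> along
      all of \<open>D\<close>.\<close>
    obtain D where D: "D \<subseteq> Field r" "finite D" "card D = q"
      using infinite_arbitrarily_large[OF inf] by blast
    obtain d where d: "set d = D" "length d = q" "ascending r d"
      by (rule ascending_enumeration[OF wo D(2,1)]) (simp add: D(3))
    obtain x where x: "x \<in> tuples M m" "\<forall>i\<in>D. holds M \<psi> (x @ s i)"
      using cons[OF \<psi>(1,2) \<open>holds M \<psi> (b @ s i0)\<close> D(2,1)] by (elim bexE)
    define Q where "Q = (\<lambda>(\<theta> :: ('f, 'r) fm, is :: 'o list, js :: 'o list) w.
      holds M \<theta> (concat (map (\<lambda>k. s (d ! w k)) [0..<length is]) @ x))"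
    have Q: "\<forall>y\<in>\<Theta>0. \<forall>w w'. (\<forall>u\<in>?U y. w u = w' u) \<longrightarrow> Q y w = Q y w'"
    proof (intro ballI allI impI)
      fix y :: "('f, 'r) fm \<times> 'o list \<times> 'o list" and w w' :: "nat \<Rightarrow> nat" assume w: "\<forall>u\<in>?U y. w u = w' u"
      obtain \<theta> "is" js where y: "y = (\<theta>, is, js)" by (cases y)
      have "map (\<lambda>k. s (d ! w k)) [0..<length is] = map (\<lambda>k. s (d ! w' k)) [0..<length is]"
        using w by (simp add: y)
      then show "Q y w = Q y w'" unfolding Q_def y prod.case by (simp only:)
    qed
    have "\<exists>Y\<subseteq>{..<q}. card Y = length l \<and>
        (\<forall>x\<in>\<Theta>0. \<forall>w w'. strict_mono_on (?U x) w \<and> strict_mono_on (?U x) w' \<and>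
         w ` ?U x \<subseteq> Y \<and> w' ` ?U x \<subseteq> Y \<longrightarrow> Q x w = Q x w')"
      by (rule q[rule_format, of "{..<q}" Q, OF _ _ Q[rule_format]]) simp_all
    then obtain Y where Y: "Y \<subseteq> {..<q}" "card Y = length l"
      and hom: "\<forall>x\<in>\<Theta>0. \<forall>w w'. strict_mono_on (?U x) w \<and> strict_mono_on (?U x) w' \<and>
         w ` ?U x \<subseteq> Y \<and> w' ` ?U x \<subseteq> Y \<longrightarrow> Q x w = Q x w'"
      by (elim exE conjE)
    obtain v where v: "strict_mono_on {..<length l} v" "v ` {..<length l} = Y"
      using enum_nat_set[of Y "length l"] Y finite_subset by blast
    define l' where "l' = map (\<lambda>k. d ! v k) [0..<length l]"
    have vq: "v k < q" if "k < length l" for k using v(2) Y(1) that by auto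
    have l': "ascending r l'" "set l' \<subseteq> D"
    proof -
      show "ascending r l'" unfolding l'_def
        by (rule ascending_map[OF d(3) v(1)]) (use vq d(2) in auto)
      have "d ! v k \<in> D" if "k < length l" for k
        using vq[OF that] d(1,2) nth_mem[of "v k" d] by simp
      then show "set l' \<subseteq> D" by (auto simp: l'_def)
    qed
    define pos where "pos i = (SOME k. k < length l \<and> l ! k = i)" for i
    have dist: "distinct l" using l(1,2) I0(1) by (simp add: card_distinct)
    have pos: "pos (l ! k) = k" if "k < length l" for k
    proof -
      have "pos (l ! k) < length l \<and> l ! pos (l ! k) = l ! k"
        unfolding pos_def by (rule someI[of _ k]) (use that in simp)
      then show ?thesis using dist that nth_eq_iff_index_eq by blast
    qed
    \<comment> \<open>The entries belonging to the indices in \<open>I0\<close> are replaced by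
      those along the homogeneous subsequence \<open>l'\<close>. There \<open>x\<close> satisfies
      the finitely many conditions, though for the wrong members of the sequence.\<close>
    define g' where "g' v = (case v of Inl k \<Rightarrow> x ! k | Inr (i, j) \<Rightarrow>
        if i \<in> I0 then s (l' ! pos i) ! j else s i ! j)" for v
    have len_l': "length l' = length l" by (simp add: l'_def)
    have l'D: "l' ! k \<in> D" if "k < length l" for k
      using subsetD[OF l'(2) nth_mem[of k l']] that len_l' by simp
    have l'F: "l' ! k \<in> Field r" if "k < length l" for k
      using subsetD[OF D(1) l'D[OF that]] .
    have g'_l: "map (\<lambda>j. g' (Inr (l ! k, j))) [0..<n] = s (l' ! k)" if "k < length l" for k
    proof -
      have "l ! k \<in> I0" using that l(1) nth_mem by blast
      then show ?thesis using s_nth[OF l'F[OF that]] pos[OF that] by (simp add: g'_def)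
    qed
    have g'_xs: "map g' xs = x"
      using x(1) map_nth[of x] by (simp add: g'_def xs_def comp_def tuples_iff)
    have g'_is: "map g' (concat (map ys (map (\<lambda>k. l ! f k) [0..<p]))) = concat (map (\<lambda>k. s (d ! v (f k))) [0..<p])"
      if f: "f ` {..<p} \<subseteq> {..<length l}" for f p
    proof -
      have "map (\<lambda>i. map (\<lambda>j. g' (Inr (i, j))) [0..<n]) (map (\<lambda>k. l ! f k) [0..<p]) =
          map (\<lambda>k. s (d ! v (f k))) [0..<p]"
        using f g'_l by (auto simp: l'_def image_subset_iff)
      then show ?thesis unfolding map_ys by (simp only:)
    qed
    have P': "P c g'" if c: "c \<in> S0" for c
    proof -
      consider \<phi> where "c = Inl \<phi>" "\<phi> \<in> \<Phi>0" | \<theta> "is" js where "c = Inr (\<theta>, is, js)" "(\<theta>, is, js) \<in> \<Theta>0"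
      proof (cases c)
        case (Inr y)
        then show thesis using that(2) c by (cases y) (auto simp: \<Theta>0_def)
      qed (use that(1) c in \<open>auto simp: \<Phi>0_def\<close>)
      then show ?thesis
      proof cases
        case 1
        have "i0 \<in> set l" using l(1) by (simp add: I0_def)
        then obtain k where k: "k < length l" "i0 = l ! k" by (auto simp: in_set_conv_nth)
        have "map g' (ys i0) = s (l' ! k)" using g'_l[OF k(1)] k(2) by (simp add: ys_def comp_def)
        moreover have "holds M \<phi> (x @ s (l' ! k))"
          using bspec[OF x(2) l'D[OF k(1)]] \<psi>(3)[OF lens[OF x(1) l'F[OF k(1)]]] 1(2) by simp
        ultimately show ?thesis unfolding P_def 1(1) sum.case by (simp add: g'_xs)
      next
        case 2
        have \<theta>: "length is = length js" "ascending r is" "ascending r js" "set is \<subseteq> set l" "set js \<subseteq> set l"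
          using \<Theta>0[OF 2(2)] 2(2) unfolding l(1) \<Theta>_def I0_def by auto
        obtain f where f: "strict_mono_on {..<length is} f" "f ` {..<length is} \<subseteq> {..<length l}"
          "is = map (\<lambda>k. l ! f k) [0..<length is]" using ascending_positions[OF wo l(3) \<theta>(2,4)] by blast
        obtain f' where f': "strict_mono_on {..<length js} f'" "f' ` {..<length js} \<subseteq> {..<length l}"
          "js = map (\<lambda>k. l ! f' k) [0..<length js]" using ascending_positions[OF wo l(3) \<theta>(3,5)] by blast
        have comp: "strict_mono_on {..<p} (v \<circ> f) \<and> (v \<circ> f) ` {..<p} \<subseteq> Y"
          if "strict_mono_on {..<p} f" "f ` {..<p} \<subseteq> {..<length l}" for f p
        proof
          show "strict_mono_on {..<p} (v \<circ> f)"
          proof (rule strict_mono_onI)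
            fix i j assume ij: "i \<in> {..<p}" "j \<in> {..<p}" "i < j"
            then have "f i < f j" "f i \<in> {..<length l}" "f j \<in> {..<length l}"
              using strict_mono_onD[OF that(1) ij] that(2) by auto
            then show "(v \<circ> f) i < (v \<circ> f) j" using strict_mono_onD[OF v(1)] by simp
          qed
          show "(v \<circ> f) ` {..<p} \<subseteq> Y" using that(2) v(2) unfolding image_comp[symmetric] by blast
        qed
        have "Q (\<theta>, is, js) (v \<circ> f) = Q (\<theta>, is, js) (v \<circ> f')"
          by (rule hom[rule_format, OF 2(2)]) (use comp[OF f(1,2)] comp[OF f'(1,2)] \<theta>(1) in simp)
        moreover have "map g' (concat (map ys is)) = concat (map (\<lambda>k. s (d ! v (f k))) [0..<length is])"
          using g'_is[OF f(2)] f(3) by simp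
        moreover have "map g' (concat (map ys js)) = concat (map (\<lambda>k. s (d ! v (f' k))) [0..<length is])"
          using g'_is[OF f'(2)] f'(3) \<theta>(1) by simp
        ultimately show ?thesis unfolding P_def 2(1) sum.case prod.case Q_def
          by (simp add: g'_xs comp_def)
      qed
    qed
    \<comment> \<open>The statement that some tuple fulfils the conditions depends only on the
      entries at \<open>I0\<close>. As \<open>s\<close> is indiscernible over the empty set, it
      passes from \<open>l'\<close> back to \<open>l\<close>, that is, from \<open>g'\<close> to
      \<open>g0\<close>.\<close>
    define R where "R g \<longleftrightarrow> (\<exists>h. (\<forall>v\<in>Inl ` {..<m}. h v \<in> univ M) \<and>
        (\<forall>v. v \<notin> Inl ` {..<m} \<longrightarrow> h v = g v) \<and> (\<forall>c\<in>S0. P c h))" for g :: "nat + 'o \<times> nat \<Rightarrow> 'a"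
    have "definable L M (Inl ` {..<m} \<union> Inr ` (I0 \<times> {..<n})) (P c)" if c: "c \<in> S0" for c
    proof -
      consider \<phi> where "c = Inl \<phi>" "\<phi> \<in> \<Phi>0" | \<theta> "is" js where "c = Inr (\<theta>, is, js)" "(\<theta>, is, js) \<in> \<Theta>0"
      proof (cases c)
        case (Inr y)
        then show thesis using that(2) c by (cases y) (auto simp: \<Theta>0_def)
      qed (use that(1) c in \<open>auto simp: \<Phi>0_def\<close>)
      then show ?thesis
      proof cases
        case 1
        have "definable L M (set (xs @ ys i0)) (\<lambda>g. holds M \<phi> (map g (xs @ ys i0)))"
          by (rule definable_holds) (use \<Phi>0[OF 1(2)] in \<open>auto simp: \<Phi>_def xs_def ys_def\<close>)
        then show ?thesis unfolding P_def 1(1) sum.case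
          by (rule definable_mono) (auto simp: xs_def ys_def I0_def)
      next
        case 2
        have "definable L M (Inl ` {..<m} \<union> Inr ` (I0 \<times> {..<n})) (\<lambda>g. holds M \<theta> (map g (concat (map ys ks) @ xs)))"
          if "ks = is \<or> ks = js" for ks
        proof -
          have "definable L M (set (concat (map ys ks) @ xs)) (\<lambda>g. holds M \<theta> (map g (concat (map ys ks) @ xs)))"
            by (rule definable_holds) (use \<Theta>0[OF 2(2)] that in \<open>auto simp: \<Theta>_def len_ys xs_def\<close>)
          moreover have "set ks \<subseteq> I0" using that 2(2) by (auto simp: I0_def)
          ultimately show ?thesis
            by (elim definable_mono) (auto simp: set_ys xs_def simp del: set_concat)
        qed
        then show ?thesis unfolding P_def 2(1) sum.case prod.case by (intro definable_iff) auto
      qed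
    qed
    then have "definable L M (Inl ` {..<m} \<union> Inr ` (I0 \<times> {..<n})) (\<lambda>g. \<forall>c\<in>S0. P c g)"
      by (rule definable_ball[OF S0(2)])
    then have "definable L M ((Inl ` {..<m} \<union> Inr ` (I0 \<times> {..<n})) - Inl ` {..<m}) R"
      unfolding R_def by (intro definable_Ex_finite) auto
    then have defR: "definable L M (set (concat (map ys l))) R"
      by (rule definable_mono) (auto simp: set_ys l(1) simp del: set_concat)
    have "R g'" unfolding R_def
    proof (intro exI[of _ g'] conjI ballI allI impI P')
      fix v :: "nat + 'o \<times> nat" assume "v \<in> Inl ` {..<m}"
      then show "g' v \<in> univ M" using x(1) by (auto simp: g'_def tuples_iff)
    qed simp_all
    moreover have "map g' (concat (map ys l)) = concat (map s l')"
    proof -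
      have "map (\<lambda>k. l ! k) [0..<length l] = l" by (rule map_nth)
      then show ?thesis using g'_is[of "\<lambda>k. k" "length l"] by (simp add: l'_def comp_def)
    qed
    moreover have "map g0 (concat (map ys l)) = concat (map s l)"
      by (rule g0_ys) (use l(1) I0(2) in \<open>auto simp: g0_def\<close>)
    moreover have "tp L M (concat (map s l')) {} = tp L M (concat (map s l)) {}"
      using ind[unfolded indiscernible_seq_def, rule_format, of l' l] l'(1,2) l(1,3) I0(2) D(1) len_l'
      by (auto simp: lists_eq_set)
    ultimately have "R g0" using definable_transfer[OF _ defR, of g' g0] by simp
    then obtain h where h: "\<forall>v\<in>Inl ` {..<m}. h v \<in> univ M"
        "\<forall>v. v \<notin> Inl ` {..<m} \<longrightarrow> h v = g0 v" "\<forall>c\<in>S0. P c h"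
      unfolding R_def by (elim exE conjE)
    have "h v = g0 v" if "v \<in> Inr ` (Field r \<times> {..<n})" for v using h(2) that by auto
    moreover have "h v \<in> univ M" if v: "v \<in> V" for v
    proof (cases "v \<in> Inl ` {..<m}")
      case False
      then obtain i j where "v = Inr (i, j)" "i \<in> Field r" "j < n" using v unfolding V_def by auto
      moreover from this have "h v = g0 v" using h(2) by blast
      ultimately show ?thesis using univ_g0 by (simp add: g0_def)
    qed (use h(1) in blast)
    ultimately show ?thesis using h(3) by (intro exI[of _ h]) auto
  qed
  obtain g where g: "\<And>v. v \<in> V \<Longrightarrow> g v \<in> univ M" "\<And>v. v \<in> Inr ` (Field r \<times> {..<n}) \<Longrightarrow> g v = g0 v"
      "\<And>c. c \<in> C \<Longrightarrow> P c g"
    by (rule saturated_realizes[where S = C and P = P and I = V and J = "Inr ` (Field r \<times> {..<n})" and ?g0.0 = g0,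
        OF defP sat ne small[folded V_def] _ fs]) (auto simp: V_def)
  define b' where "b' = map g xs"
  have b': "b' \<in> tuples M m" using g(1) by (auto simp: b'_def tuples_iff xs_def V_def)
  have g_ys: "map g (concat (map ys is)) = concat (map s is)" if "set is \<subseteq> Field r" for "is"
    by (rule g0_ys[OF that]) (use g(2) in \<open>auto simp: g0_def\<close>)
  have len_s: "length (concat (map s is)) = length is * n" if "set is \<subseteq> Field r" for "is"
    using g_ys[OF that, symmetric] len_ys by simp
  show thesis
  proof (rule that[OF b'])
    show "indiscernible_seq L M r s (set b')"
      unfolding indiscernible_seq_def
    proof (intro ballI impI, elim conjE)
      fix "is" js assume ij: "is \<in> lists (Field r)" "js \<in> lists (Field r)" "length is = length js"
        "ascending r is" "ascending r js"
      then have F: "set is \<subseteq> Field r" "set js \<subseteq> Field r" by auto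
      show "tp L M (concat (map s is)) (set b') = tp L M (concat (map s js)) (set b')"
      proof (rule tp_eq_parametersI)
        show "length (concat (map s is)) = length (concat (map s js))"
          using len_s F ij(3) by simp
        fix \<theta> assume t: "\<theta> \<in> formulas L" "fv \<theta> \<subseteq> {..<length (concat (map s is)) + length b'}"
        have "fv \<theta> \<subseteq> {..<length is * n + m}" using t(2) len_s[OF F(1)] b' by (simp add: tuples_iff)
        then have "Inr (\<theta>, is, js) \<in> C" unfolding C_def \<Theta>_def using t(1) ij F by auto
        then have "P (Inr (\<theta>, is, js)) g" by (rule g(3))
        then show "holds M \<theta> (concat (map s is) @ b') = holds M \<theta> (concat (map s js) @ b')"
          unfolding P_def sum.case prod.case map_append g_ys[OF F(1)] g_ys[OF F(2)] b'_def .
      qed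
    qed
    have gy: "map g (ys i0) = s i0" using g_ys[of "[i0]"] i0 by simp
    have len: "length b = m" "length b' = m" "length (s i0) = n" using b b' s[OF i0] by (auto simp: tuples_iff)
    have imp: "holds M \<theta> (b' @ s i0)" if "\<theta> \<in> formulas L" "fv \<theta> \<subseteq> {..<m + n}" "holds M \<theta> (b @ s i0)" for \<theta>
    proof -
      have "Inl \<theta> \<in> C" using that by (simp add: C_def \<Phi>_def)
      then have "P (Inl \<theta>) g" by (rule g(3))
      then show ?thesis unfolding P_def sum.case map_append gy b'_def .
    qed
    show "tp L M b (set (s i0)) = tp L M b' (set (s i0))"
    proof (rule tp_eq_parametersI)
      fix \<theta> assume t: "\<theta> \<in> formulas L" "fv \<theta> \<subseteq> {..<length b + length (s i0)}"
      then show "holds M \<theta> (b @ s i0) = holds M \<theta> (b' @ s i0)"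
        using imp[of \<theta>] imp[of "Neg \<theta>"] len by (auto simp: formulas_def holds_def)
    qed (simp add: len)
  qed
qed

section \<open>Consistency along chains and antichains\<close>

definition snoc :: "'o rel \<Rightarrow> 'o node \<Rightarrow> bool \<Rightarrow> 'o node" where
  "snoc r \<eta> b = \<eta>((THE x. x \<in> Field r \<and> dom \<eta> = underS r x) \<mapsto> b)"

definition append_list :: "'o rel \<Rightarrow> 'o node \<Rightarrow> bool list \<Rightarrow> 'o node" where
  "append_list r \<eta> s = foldl (snoc r) \<eta> s"

definition antichain_list :: "bool list set \<Rightarrow> bool" where
  "antichain_list X \<longleftrightarrow> (\<forall>s\<in>X. \<forall>t\<in>X. prefix s t \<longrightarrow> s = t)"

text \<open>How the chains climb and how far they start above the copy of \<open>\<zeta>\<close> is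
  left open on purpose; by \<open>chains_qf_tp\<close> the type does not depend on it.\<close>

definition chains_above :: "'o rel \<Rightarrow> 'o node \<Rightarrow> bool list set \<Rightarrow> nat \<Rightarrow> (bool list \<Rightarrow> nat \<Rightarrow> 'o node) \<Rightarrow> bool" where
  "chains_above r \<nu> X d e \<longleftrightarrow> (\<forall>\<zeta>\<in>X. \<forall>i<d. e \<zeta> i \<in> tree r \<and> append_list r \<nu> \<zeta> \<subseteq>\<^sub>m e \<zeta> i \<and>
     (\<forall>j<i. e \<zeta> j \<subseteq>\<^sub>m e \<zeta> i \<and> e \<zeta> j \<noteq> e \<zeta> i))"

context
  fixes r :: "'o rel"
  assumes card: "Card_order r" and inf: "infinite (Field r)"
begin

lemma snoc_eq:
  assumes "x \<in> Field r" "dom \<eta> = underS r x"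
  shows "snoc r \<eta> b = \<eta>(x \<mapsto> b)"
proof -
  have "(THE x. x \<in> Field r \<and> dom \<eta> = underS r x) = x"
    by (rule the_equality) (use assms underS_inj[OF card_wo[OF card inf]] in auto)
  then show ?thesis by (simp add: snoc_def)
qed

lemma successor:
  assumes x: "x \<in> Field r"
  obtains y where "y \<in> Field r" "insert x (underS r x) = underS r y"
    "\<And>z. z \<in> Field r \<Longrightarrow> x \<in> underS r z \<Longrightarrow> (y, z) \<in> r"
proof -
  note wo = card_wo[OF card inf]
  obtain z where z: "z \<in> Field r" "x \<noteq> z" "(x, z) \<in> r"
    using infinite_Card_order_limit[OF card inf x] by blast
  have sub: "insert x (underS r x) \<subseteq> underS r z" if "x \<noteq> z" "(x, z) \<in> r" for z
    using that wo_trans[OF wo] wo_antisym[OF wo] unfolding underS_def by blast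
  have "|insert x (underS r x)| <o r"
    using card_of_mono1[OF sub[OF z(2,3)]] card_of_underS[OF card z(1)] ordLeq_ordLess_trans by blast
  moreover have "insert x (underS r x) \<subseteq> Field r" using x underS_Field[OF wo] by blast
  moreover have "y \<in> insert x (underS r x)" if "w \<in> insert x (underS r x)" "(y, w) \<in> r" for w y
    using that wo_trans[OF wo] wo_antisym[OF wo] unfolding underS_def by blast
  ultimately obtain y where y: "y \<in> Field r" "insert x (underS r x) = underS r y"
    using down_closed_underS[OF card inf] by metis
  have "(y, z) \<in> r" if "z \<in> Field r" "x \<in> underS r z" for z
  proof -
    have "underS r y \<subseteq> underS r z" using sub[of z] that(2) unfolding y(2) by (auto simp: underS_def)
    then have "z \<notin> underS r y" by (auto simp: underS_def)
    then show ?thesis using underS_not[OF wo that(1) y(1)] by blast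
  qed
  then show thesis using that y by blast
qed

lemma snoc_props:
  assumes "\<eta> \<in> tree r"
  shows "snoc r \<eta> b \<in> tree r" "\<eta> \<subseteq>\<^sub>m snoc r \<eta> b" "snoc r \<eta> b \<noteq> \<eta>"
proof -
  obtain x where x: "x \<in> Field r" "dom \<eta> = underS r x" using assms unfolding tree_def by blast
  note eq = snoc_eq[OF x]
  have nx: "x \<notin> dom \<eta>" unfolding x(2) by (simp add: underS_def)
  obtain y where "y \<in> Field r" "insert x (underS r x) = underS r y"
    by (rule successor[OF x(1)])
  then show "snoc r \<eta> b \<in> tree r" unfolding tree_def eq using x(2) by auto
  show "\<eta> \<subseteq>\<^sub>m snoc r \<eta> b" unfolding eq map_le_def using nx by auto
  have "snoc r \<eta> b x \<noteq> \<eta> x" using nx by (simp add: eq domIff)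
  then show "snoc r \<eta> b \<noteq> \<eta>" by metis
qed

lemma append_list_append: "append_list r \<eta> (s @ t) = append_list r (append_list r \<eta> s) t"
  by (simp add: append_list_def)

lemma append_list_tree: "\<eta> \<in> tree r \<Longrightarrow> append_list r \<eta> s \<in> tree r"
  unfolding append_list_def by (induction s arbitrary: \<eta>) (simp_all add: snoc_props(1))

lemma append_list_le: "\<eta> \<in> tree r \<Longrightarrow> \<eta> \<subseteq>\<^sub>m append_list r \<eta> s"
  unfolding append_list_def
proof (induction s arbitrary: \<eta>)
  case (Cons b s)
  then show ?case using snoc_props(1,2)[OF Cons.prems, of b] map_le_trans by (metis foldl_Cons)
qed simp

lemma append_list_prefix:
  assumes "\<eta> \<in> tree r" "prefix s t"
  shows "append_list r \<eta> s \<subseteq>\<^sub>m append_list r \<eta> t"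
proof -
  obtain u where "t = s @ u" using assms(2) by (auto simp: prefix_def)
  then show ?thesis using append_list_le[OF append_list_tree[OF assms(1)]] by (simp add: append_list_append)
qed

lemma append_list_Cons:
  assumes "\<eta> \<in> tree r" "l \<in> Field r" "dom (append_list r \<eta> p) = underS r l"
  shows "append_list r \<eta> (p @ b # t) l = Some b"
proof -
  let ?p = "append_list r \<eta> p"
  have p: "?p \<in> tree r" by (rule append_list_tree[OF assms(1)])
  have "append_list r \<eta> (p @ b # t) = append_list r (snoc r ?p b) t"
    by (simp add: append_list_def)
  then have "snoc r ?p b \<subseteq>\<^sub>m append_list r \<eta> (p @ b # t)"
    using append_list_le[OF snoc_props(1)[OF p]] by simp
  moreover have "snoc r ?p b l = Some b" using snoc_eq[OF assms(2,3)] by simp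
  ultimately show ?thesis unfolding map_le_def by (metis domI)
qed

lemma append_list_strict:
  assumes "\<eta> \<in> tree r" "strict_prefix s t"
  shows "append_list r \<eta> s \<noteq> append_list r \<eta> t"
proof -
  obtain b u where t: "t = s @ b # u" using assms(2) by (rule strict_prefixE')
  obtain l where l: "l \<in> Field r" "dom (append_list r \<eta> s) = underS r l"
    using append_list_tree[OF assms(1)] unfolding tree_def by blast
  have "l \<notin> dom (append_list r \<eta> s)" unfolding l(2) by (simp add: underS_def)
  moreover have "append_list r \<eta> t l = Some b" unfolding t by (rule append_list_Cons[OF assms(1) l])
  ultimately show ?thesis by (metis domI)
qed

text \<open>Meets of nodes on different chains lie strictly below the copies of members of
  \<open>X\<close>, where the nodes are prescribed; on one chain only the order matters. So the
  lists \<open>\<zeta>\<close> followed by \<open>i\<close> zeros are patterns for the nodes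
  \<open>e \<zeta> i\<close>.\<close>

lemma chains_qf_tp:
  assumes \<nu>: "\<nu> \<in> tree r" and X: "antichain_list X" and e: "chains_above r \<nu> X d e"
    and ps: "set ps \<subseteq> X \<times> {..<d}"
  shows "qf_tp L0 (tree_struct r) (map (\<lambda>(\<zeta>, i). e \<zeta> i) ps) =
    qf_tp L0 (tree_like longest_common_prefix prefix list_lex) (map (\<lambda>(\<zeta>, i). \<zeta> @ replicate i False) ps)"
proof -
  note wo = card_wo[OF card inf]
  \<comment> \<open>The proper initial segments of members of \<open>X\<close>. They contain every
    meet of two different chains.\<close>
  define below where "below p \<longleftrightarrow> (\<exists>\<zeta>\<in>X. strict_prefix p \<zeta>)" for p
  define S where "S = {p. below p} \<union> {\<zeta> @ replicate i False | \<zeta> i. \<zeta> \<in> X \<and> i < d}"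
  \<comment> \<open>The remaining lists extend exactly one member \<open>\<zeta>\<close> of the
    antichain, and the surplus length tells the place on its chain.\<close>
  define F where "F p = (if below p then append_list r \<nu> p
    else let \<zeta> = THE \<zeta>. \<zeta> \<in> X \<and> prefix \<zeta> p in e \<zeta> (length p - length \<zeta>))" for p
  have comparable: "\<zeta> = \<zeta>'" if "\<zeta> \<in> X" "\<zeta>' \<in> X" "prefix \<zeta> p" "prefix \<zeta>' p" for \<zeta> \<zeta>' p
    using prefix_same_cases[OF that(3,4)] X that(1,2) unfolding antichain_list_def by metis
  have not_below: "\<not> below p" if "\<zeta> \<in> X" "prefix \<zeta> p" for \<zeta> p
  proof
    assume "below p"
    then obtain \<zeta>' where z: "\<zeta>' \<in> X" "strict_prefix p \<zeta>'" unfolding below_def by blast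
    then have "strict_prefix \<zeta> \<zeta>'" using that(2) by (metis prefix_order.le_less_trans)
    then show False using X that(1) z(1) unfolding antichain_list_def by (auto simp: strict_prefix_def)
  qed
  have F_below: "F p = append_list r \<nu> p" if "below p" for p using that by (simp add: F_def)
  have F_top: "F (\<zeta> @ replicate i False) = e \<zeta> i" if "\<zeta> \<in> X" for \<zeta> i
  proof -
    have pre: "prefix \<zeta> (\<zeta> @ replicate i False)" by simp
    have "(THE \<zeta>'. \<zeta>' \<in> X \<and> prefix \<zeta>' (\<zeta> @ replicate i False)) = \<zeta>"
      by (rule the_equality) (use that pre comparable[OF _ that _ pre] in auto)
    then show ?thesis using not_below[OF that pre] by (simp add: F_def)
  qed
  have e': "e \<zeta> i \<in> tree r" "append_list r \<nu> \<zeta> \<subseteq>\<^sub>m e \<zeta> i"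
    "\<And>j. j < i \<Longrightarrow> e \<zeta> j \<subseteq>\<^sub>m e \<zeta> i \<and> e \<zeta> j \<noteq> e \<zeta> i" if "\<zeta> \<in> X" "i < d" for \<zeta> i
    using e that unfolding chains_above_def by blast+
  have S_cases: "(below p \<Longrightarrow> thesis) \<Longrightarrow> (\<And>\<zeta> i. p = \<zeta> @ replicate i False \<Longrightarrow> \<zeta> \<in> X \<Longrightarrow> i < d \<Longrightarrow> thesis) \<Longrightarrow> thesis"
    if "p \<in> S" for p thesis using that unfolding S_def by blast
  have tree: "F p \<in> tree r" if "p \<in> S" for p
    by (rule S_cases[OF that]) (simp_all add: F_below F_top e' append_list_tree \<nu>)
  have above: "append_list r \<nu> q \<subseteq>\<^sub>m F p \<and> below q"
    if p: "p \<in> S" and q: "prefix q p" and nb: "below p \<or> \<not> (\<exists>\<zeta>\<in>X. prefix \<zeta> q)" and "q \<noteq> p" for p q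
  proof (rule S_cases[OF p])
    assume b: "below p"
    then have "below q" unfolding below_def using q by (metis prefix_order.le_less_trans)
    then show ?thesis using F_below[OF b] append_list_prefix[OF \<nu> q] by simp
  next
    fix \<zeta> i assume z: "p = \<zeta> @ replicate i False" "\<zeta> \<in> X" "i < d"
    then have nb': "\<not> below p" using not_below[of \<zeta> p] by simp
    have "prefix q \<zeta> \<or> prefix \<zeta> q"
      using prefix_same_cases[OF q, of \<zeta>] z(1) by auto
    then have "strict_prefix q \<zeta>" using nb nb' z(2) by (auto simp: strict_prefix_def)
    then have "below q" "prefix q \<zeta>" using z(2) unfolding below_def by auto
    then show ?thesis
      using append_list_prefix[OF \<nu> \<open>prefix q \<zeta>\<close>] e'(2)[OF z(2,3)] F_top[OF z(2)] z(1) map_le_trans by metis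
  qed
  have "list_embedding r S F" unfolding list_embedding_def
  proof (intro conjI ballI allI impI)
    show "F ` S \<subseteq> tree r" using tree by blast
  next
    fix s t assume st: "s \<in> S" "t \<in> S" "strict_prefix s t"
    then have pre: "prefix s t" "s \<noteq> t" by (auto simp: strict_prefix_def)
    have "F s \<subseteq>\<^sub>m F t \<and> F s \<noteq> F t"
    proof (rule S_cases[OF st(1)])
      assume bs: "below s"
      show ?thesis
      proof (rule S_cases[OF st(2)])
        assume bt: "below t"
        show ?thesis using F_below[OF bs] F_below[OF bt] append_list_prefix[OF \<nu> pre(1)]
          append_list_strict[OF \<nu> st(3)] by simp
      next
        fix \<zeta> i assume z: "t = \<zeta> @ replicate i False" "\<zeta> \<in> X" "i < d"
        have "prefix s \<zeta> \<or> prefix \<zeta> s" using prefix_same_cases[OF pre(1), of \<zeta>] z(1) by auto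
        then have "strict_prefix s \<zeta>" using not_below[OF z(2), of s] bs by (auto simp: strict_prefix_def)
        then have "append_list r \<nu> s \<subseteq>\<^sub>m append_list r \<nu> \<zeta>" "append_list r \<nu> s \<noteq> append_list r \<nu> \<zeta>"
          using append_list_prefix[OF \<nu>, of s \<zeta>] append_list_strict[OF \<nu>] by (auto simp: strict_prefix_def)
        moreover have "append_list r \<nu> \<zeta> \<subseteq>\<^sub>m F t" using e'(2)[OF z(2,3)] F_top[OF z(2)] z(1) by simp
        ultimately show ?thesis unfolding F_below[OF bs] by (metis map_le_antisym map_le_trans)
      qed
    next
      fix \<zeta> i assume z: "s = \<zeta> @ replicate i False" "\<zeta> \<in> X" "i < d"
      have pz: "prefix \<zeta> s" by (simp add: z(1))
    then have pz: "prefix \<zeta> s" "prefix \<zeta> t" using prefix_order.trans[OF _ pre(1)] by blast+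
      show ?thesis
      proof (rule S_cases[OF st(2)])
        assume "below t"
        then show ?thesis using not_below[OF z(2) pz(2)] by blast
      next
        fix \<zeta>' j assume z': "t = \<zeta>' @ replicate j False" "\<zeta>' \<in> X" "j < d"
        have "\<zeta>' = \<zeta>" by (rule comparable[OF z'(2) z(2) _ pz(2)]) (simp add: z'(1))
        moreover from this have "i < j" using pre prefix_length_less[OF st(3)] z(1) z'(1) by simp
        ultimately show ?thesis using e'(3)[OF z(2), of j i] z' z F_top by simp
      qed
    qed
    then show "F s \<subseteq>\<^sub>m F t" "F s \<noteq> F t" by blast+
  next
    fix p s t assume st: "p @ True # s \<in> S" "p @ False # t \<in> S"
    \<comment> \<open>Nothing branches at or beyond a member of \<open>X\<close>, since only zeros
      follow there.\<close>
    have nb: "\<not> (\<exists>\<zeta>\<in>X. prefix \<zeta> p)"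
    proof
      assume "\<exists>\<zeta>\<in>X. prefix \<zeta> p"
      then obtain \<zeta> where z: "\<zeta> \<in> X" "prefix \<zeta> p" by blast
      then have "prefix \<zeta> (p @ True # s)" by simp
      show False
      proof (rule S_cases[OF st(1)])
        assume "below (p @ True # s)"
        then show False using not_below[OF z(1) \<open>prefix \<zeta> (p @ True # s)\<close>] by blast
      next
        fix \<zeta>' i assume z': "p @ True # s = \<zeta>' @ replicate i False" "\<zeta>' \<in> X"
        have "\<zeta>' = \<zeta>" by (rule comparable[OF z'(2) z(1) _ \<open>prefix \<zeta> (p @ True # s)\<close>]) (simp add: z'(1))
        then obtain u where "p = \<zeta>' @ u" using z(2) by (auto simp: prefix_def)
        then have "u @ True # s = replicate i False" using z'(1) by simp
        then have "True \<in> set (replicate i False)" by (metis in_set_conv_decomp)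
        then show False by simp
      qed
    qed
    have nb': "\<not> (\<exists>\<zeta>\<in>X. prefix \<zeta> (p @ [b]))" if "b" "\<not> b" for b using that by simp
    have below_p: "below p"
      using above[OF st(1), of p] nb by simp
    have at: "F (p @ b # u) l = Some b" if u: "p @ b # u \<in> S" and l: "l \<in> Field r" "dom (F p) = underS r l" for b u l
    proof -
      have dl: "dom (append_list r \<nu> p) = underS r l" using l(2) F_below[OF below_p] by simp
      show ?thesis
      proof (rule S_cases[OF u])
        assume "below (p @ b # u)"
        then show ?thesis using F_below append_list_Cons[OF \<nu> l(1) dl] by simp
      next
        fix \<zeta> i assume z: "p @ b # u = \<zeta> @ replicate i False" "\<zeta> \<in> X" "i < d"
        have "prefix p \<zeta> \<or> prefix \<zeta> p"
          by (rule prefix_same_cases[of p "p @ b # u"]) (simp, simp add: z(1))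
        then have "strict_prefix p \<zeta>" using nb z(2) by (auto simp: strict_prefix_def)
        then obtain c w where w: "\<zeta> = p @ c # w" by (rule strict_prefixE')
        then have "c = b" using z(1) by simp
        then have "append_list r \<nu> \<zeta> l = Some b" using append_list_Cons[OF \<nu> l(1) dl] w by simp
        then show ?thesis using e'(2)[OF z(2,3)] F_top[OF z(2)] z(1) unfolding map_le_def by (metis domI)
      qed
    qed
    show "p \<in> S" using below_p by (simp add: S_def)
    have "F p \<in> tree r" using tree[OF \<open>p \<in> S\<close>] .
    then obtain l where "l \<in> Field r" "dom (F p) = underS r l" unfolding tree_def by blast
    then show "\<exists>l\<in>Field r. dom (F p) = underS r l \<and>
           F (p @ True # s) l = Some True \<and> F (p @ False # t) l = Some False"
      using at[OF st(1)] at[OF st(2)] by blast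
  qed
  then have "qf_tp L0 (tree_struct r) (map F (map (\<lambda>(\<zeta>, i). \<zeta> @ replicate i False) ps)) =
    qf_tp L0 (tree_like longest_common_prefix prefix list_lex) (map (\<lambda>(\<zeta>, i). \<zeta> @ replicate i False) ps)"
    by (rule list_embedding_qf_tp[OF wo]) (use ps in \<open>auto simp: S_def\<close>)
  moreover have "map F (map (\<lambda>(\<zeta>, i). \<zeta> @ replicate i False) ps) = map (\<lambda>(\<zeta>, i). e \<zeta> i) ps"
    using ps F_top by auto
  ultimately show ?thesis by (simp only:)
qed

end

section \<open>Consistency of finitely many instances as a definable condition\<close>

lemma nth_concat_uniform:
  assumes "\<And>t. t \<in> set ts \<Longrightarrow> length t = n" "p < length ts" "j < n"
  shows "concat ts ! (p * n + j) = ts ! p ! j" "length (concat ts) = length ts * n"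
  using assms
proof (induction ts arbitrary: p)
  case (Cons t ts)
  {
    case 1
    have IH: "concat ts ! (p' * n + j) = ts ! p' ! j" if "p' < length ts" for p'
      by (rule Cons.IH(1)) (use 1 that in auto)
    show ?case using IH[of "p - 1"] 1 by (cases p) (auto simp: nth_append)
  next
    case 2
    then show ?case using Cons.IH(2)[of 0] by (cases ts) auto
  }
qed auto

lemma length_concat_uniform:
  "(\<And>t. t \<in> set ts \<Longrightarrow> length t = n) \<Longrightarrow> length (concat ts) = length ts * n"
  by (induction ts) auto

text \<open>One common realization is asked for, even for infinite \<open>X\<close>. For finite
  \<open>X\<close> this is a property of finitely many parameters expressed by a single formula, so
  it can be transferred and used in compactness.\<close>

definition consistent_on ::
  "('f, 'r, 'a) struct \<Rightarrow> nat \<Rightarrow> ('f, 'r) fm \<Rightarrow> ('i \<Rightarrow> 'a list) \<Rightarrow> 'i set \<Rightarrow> bool" where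
  "consistent_on M m \<psi> a X \<longleftrightarrow> (\<exists>x\<in>tuples M m. \<forall>\<eta>\<in>X. holds M \<psi> (x @ a \<eta>))"

lemma definable_consistent_on:
  fixes M :: "('f, 'r, 'a) struct" and X :: "'i set"
  assumes \<psi>: "\<psi> \<in> formulas L" "fv \<psi> \<subseteq> {..<m + n}" and X: "finite X"
  shows "definable L M (X \<times> {..<n}) (\<lambda>g. consistent_on M m \<psi> (\<lambda>\<eta>. map (\<lambda>j. g (\<eta>, j)) [0..<n]) X)"
proof -
  define xs :: "(nat + 'i \<times> nat) list" where "xs = map Inl [0..<m]"
  define ys where "ys \<eta> = map (\<lambda>j. Inr (\<eta>, j) :: nat + 'i \<times> nat) [0..<n]" for \<eta>
  define P where "P h \<longleftrightarrow> (\<forall>\<eta>\<in>X. holds M \<psi> (map h (xs @ ys \<eta>)))" for h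
  define R where "R g \<longleftrightarrow> (\<exists>h. (\<forall>v\<in>Inl ` {..<m}. h v \<in> univ M) \<and>
        (\<forall>v. v \<notin> Inl ` {..<m} \<longrightarrow> h v = g v) \<and> P h)" for g :: "nat + 'i \<times> nat \<Rightarrow> 'a"
  \<comment> \<open>Strips the tags from the parameter variables; the quantified variables are gone
    by then, so the value at \<open>Inl\<close> is immaterial.\<close>
  define f where "f v = (case v of Inl k \<Rightarrow> undefined | Inr y \<Rightarrow> y)" for v :: "nat + 'i \<times> nat"
  let ?V = "Inl ` {..<m} \<union> Inr ` (X \<times> {..<n}) :: (nat + 'i \<times> nat) set"
  have "definable L M ?V P" unfolding P_def
  proof (rule definable_ball[OF X])
    fix \<eta> assume "\<eta> \<in> X"
    have "definable L M (set (xs @ ys \<eta>)) (\<lambda>h. holds M \<psi> (map h (xs @ ys \<eta>)))"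
      by (rule definable_holds) (use \<psi> in \<open>auto simp: xs_def ys_def\<close>)
    then show "definable L M ?V (\<lambda>h. holds M \<psi> (map h (xs @ ys \<eta>)))"
      by (rule definable_mono) (use \<open>\<eta> \<in> X\<close> in \<open>auto simp: xs_def ys_def\<close>)
  qed
  then have "definable L M (?V - Inl ` {..<m}) R"
    unfolding R_def by (intro definable_Ex_finite) auto
  then have "definable L M (f ` (?V - Inl ` {..<m})) (\<lambda>g. R (g \<circ> f))" by (rule definable_reindex)
  then have def: "definable L M (X \<times> {..<n}) (\<lambda>g. R (g \<circ> f))"
    by (rule definable_mono) (auto simp: f_def)
  have "R (g \<circ> f) \<longleftrightarrow> consistent_on M m \<psi> (\<lambda>\<eta>. map (\<lambda>j. g (\<eta>, j)) [0..<n]) X" for g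
  proof
    assume "R (g \<circ> f)"
    then obtain h where h: "\<forall>v\<in>Inl ` {..<m}. h v \<in> univ M" "\<forall>v. v \<notin> Inl ` {..<m} \<longrightarrow> h v = (g \<circ> f) v" "P h"
      unfolding R_def by (elim exE conjE)
    have "h (Inr y) = g y" for y using h(2)[rule_format, of "Inr y"] by (auto simp: f_def)
    then have "map h (ys \<eta>) = map (\<lambda>j. g (\<eta>, j)) [0..<n]" for \<eta> by (simp add: ys_def)
    then have "\<forall>\<eta>\<in>X. holds M \<psi> (map h xs @ map (\<lambda>j. g (\<eta>, j)) [0..<n])"
      using h(3) by (simp add: P_def)
    moreover have "map h xs \<in> tuples M m" using h(1) by (auto simp: tuples_iff xs_def)
    ultimately show "consistent_on M m \<psi> (\<lambda>\<eta>. map (\<lambda>j. g (\<eta>, j)) [0..<n]) X"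
      unfolding consistent_on_def by blast
  next
    assume "consistent_on M m \<psi> (\<lambda>\<eta>. map (\<lambda>j. g (\<eta>, j)) [0..<n]) X"
    then obtain x where x: "x \<in> tuples M m" "\<forall>\<eta>\<in>X. holds M \<psi> (x @ map (\<lambda>j. g (\<eta>, j)) [0..<n])"
      unfolding consistent_on_def by blast
    define h where "h v = (case v of Inl k \<Rightarrow> if k < m then x ! k else (g \<circ> f) v | Inr y \<Rightarrow> g y)" for v
    have "map h xs = x" using x(1) by (auto simp: xs_def h_def tuples_iff intro: nth_equalityI)
    moreover have "map h (ys \<eta>) = map (\<lambda>j. g (\<eta>, j)) [0..<n]" for \<eta> by (simp add: ys_def h_def)
    ultimately have "P h" using x(2) by (simp add: P_def)
    moreover have "\<forall>v\<in>Inl ` {..<m}. h v \<in> univ M" using x(1) by (auto simp: h_def tuples_iff)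
    moreover have "\<forall>v. v \<notin> Inl ` {..<m} \<longrightarrow> h v = (g \<circ> f) v"
      by (auto simp: h_def f_def split: sum.splits)
    ultimately show "R (g \<circ> f)" unfolding R_def by (intro exI[of _ h] conjI)
  qed
  then show ?thesis using def by (simp only:)
qed

text \<open>The existence of a common realization is a definable condition on the concatenated
  tuple. The instances are indexed by their positions, since the lists may contain
  repetitions.\<close>

lemma exists_transfer:
  fixes M :: "('f, 'r, 'a) struct"
  assumes \<psi>: "\<psi> \<in> formulas L" "fv \<psi> \<subseteq> {..<m + n}"
    and ts: "\<And>t. t \<in> set ts \<Longrightarrow> length t = n" "\<And>t. t \<in> set ts' \<Longrightarrow> length t = n" "length ts = length ts'"
    and tp: "tp L M (concat ts) {} = tp L M (concat ts') {}"
    and ex: "\<exists>x\<in>tuples M m. \<forall>t\<in>set ts. holds M \<psi> (x @ t)"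
  shows "\<exists>x\<in>tuples M m. \<forall>t\<in>set ts'. holds M \<psi> (x @ t)"
proof -
  define N where "N = length ts"
  define vs where "vs = concat (map (\<lambda>p. map (Pair p) [0..<n]) [0..<N])"
  define R where "R g \<longleftrightarrow> consistent_on M m \<psi> (\<lambda>p. map (\<lambda>j. g (p, j)) [0..<n]) {..<N}" for g :: "nat \<times> nat \<Rightarrow> 'a"
  define g where "g us = (\<lambda>(p, j). us ! p ! j)" for us :: "'a list list"
  have "definable L M ({..<N} \<times> {..<n}) R" unfolding R_def by (rule definable_consistent_on[OF \<psi>]) simp
  then have def: "definable L M (set vs) R" by (rule definable_mono) (auto simp: vs_def)
  have g: "map (\<lambda>j. g us (p, j)) [0..<n] = us ! p" if "length (us ! p) = n" for us p
    using map_nth[of "us ! p"] that by (simp add: g_def)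
  have "map (g us) vs = concat us \<and> (R (g us) \<longleftrightarrow> (\<exists>x\<in>tuples M m. \<forall>t\<in>set us. holds M \<psi> (x @ t)))"
    if us: "length us = N" "\<And>t. t \<in> set us \<Longrightarrow> length t = n" for us
  proof -
    have nth: "map (\<lambda>j. g us (p, j)) [0..<n] = us ! p" if "p < N" for p
      using g[of us p] us that by simp
    have "map (\<lambda>p. map (\<lambda>j. g us (p, j)) [0..<n]) [0..<N] = map ((!) us) [0..<N]"
      using nth by simp
    also have "\<dots> = us" using map_nth[of us] us(1) by simp
    finally have "map (\<lambda>p. map (\<lambda>j. g us (p, j)) [0..<n]) [0..<N] = us" .
    moreover have "map (g us) vs = concat (map (\<lambda>p. map (\<lambda>j. g us (p, j)) [0..<n]) [0..<N])"
      by (simp add: vs_def map_concat comp_def)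
    moreover have "(\<forall>p\<in>{..<N}. holds M \<psi> (x @ map (\<lambda>j. g us (p, j)) [0..<n])) \<longleftrightarrow> (\<forall>t\<in>set us. holds M \<psi> (x @ t))" for x
      using nth us(1) by (auto simp: all_set_conv_all_nth)
    ultimately show ?thesis unfolding R_def consistent_on_def by simp
  qed
  from this[of ts] this[of ts'] show ?thesis
    using definable_transfer[OF _ def, of "g ts" "g ts'"] tp ts ex by (simp add: N_def)
qed

lemma conjunction_formula:
  fixes M :: "('f, 'r, 'a) struct"
  assumes \<psi>: "\<psi> \<in> formulas L" "fv \<psi> \<subseteq> {..<m + n}"
  obtains \<phi> where "\<phi> \<in> formulas L" "fv \<phi> \<subseteq> {..<m + N * n}"
    "\<And>(x :: 'a list) ts. length x = m \<Longrightarrow> length ts = N \<Longrightarrow> (\<And>t. t \<in> set ts \<Longrightarrow> length t = n) \<Longrightarrow>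
      holds M \<phi> (x @ concat ts) \<longleftrightarrow> (\<forall>t\<in>set ts. holds M \<psi> (x @ t))"
proof -
  define ps where "ps p = [0..<m] @ map (\<lambda>j. m + (p * n + j)) [0..<n]" for p
  have "definable L M (set [0..<m + N * n]) (\<lambda>g. \<forall>p\<in>{..<N}. holds M \<psi> (map g (ps p)))"
  proof (rule definable_ball)
    fix p assume p: "p \<in> {..<N}"
    have "definable L M (set (ps p)) (\<lambda>g. holds M \<psi> (map g (ps p)))"
      by (rule definable_holds) (use \<psi> in \<open>auto simp: ps_def\<close>)
    moreover have "p * n + j < N * n" if "j < n" for j
    proof -
      have "p * n + j < Suc p * n" using that by simp
      also have "\<dots> \<le> N * n" using p by (simp only: mult_le_mono1 Suc_leI lessThan_iff)
      finally show ?thesis .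
    qed
    ultimately show "definable L M (set [0..<m + N * n]) (\<lambda>g. holds M \<psi> (map g (ps p)))"
      by (elim definable_mono) (auto simp: ps_def)
  qed simp
  then show thesis
  proof (rule definable_formula)
    fix \<phi> assume p: "\<phi> \<in> formulas L" "fv \<phi> \<subseteq> {..<length [0..<m + N * n]}"
      "\<And>g. (\<forall>p\<in>{..<N}. holds M \<psi> (map g (ps p))) = holds M \<phi> (map g [0..<m + N * n])"
    show thesis
    proof (rule that[OF p(1)])
      fix x :: "'a list" and ts :: "'a list list" assume len: "length x = m" "length ts = N" "\<And>t. t \<in> set ts \<Longrightarrow> length t = n"
      have "length (x @ concat ts) = m + N * n" using length_concat_uniform[OF len(3)] len(1,2) by simp
      then have all: "map ((!) (x @ concat ts)) [0..<m + N * n] = x @ concat ts"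
        using map_nth[of "x @ concat ts"] by simp
      have one: "map ((!) (x @ concat ts)) (ps q) = x @ ts ! q" if q: "q < N" for q
      proof -
        have "concat ts ! (q * n + j) = ts ! q ! j" if "j < n" for j
          using nth_concat_uniform(1)[OF len(3), of ts q j] that q len(2) by simp
        moreover have "(x @ concat ts) ! (m + k) = concat ts ! k" for k
          using len(1) by (simp add: nth_append)
        ultimately have "map (\<lambda>j. (x @ concat ts) ! (m + (q * n + j))) [0..<n] = map ((!) (ts ! q)) [0..<n]"
          by simp
        also have "\<dots> = ts ! q" using map_nth[of "ts ! q"] len(2,3) q by simp
        finally have "map ((!) (x @ concat ts)) (map (\<lambda>j. m + (q * n + j)) [0..<n]) = ts ! q"
          by (simp add: comp_def)
        moreover have "map ((!) (x @ concat ts)) [0..<m] = x"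
          using len(1) by (auto simp: nth_append intro: nth_equalityI)
        ultimately show ?thesis by (simp only: ps_def map_append)
      qed
      show "holds M \<phi> (x @ concat ts) \<longleftrightarrow> (\<forall>t\<in>set ts. holds M \<psi> (x @ t))"
        using p(3)[of "(!) (x @ concat ts)"] one all len(2) by (auto simp: all_set_conv_all_nth)
    qed (use p(2) in simp)
  qed
qed

text \<open>Consistency along a system of chains depends only on the antichain \<open>X\<close> and
  the length \<open>d\<close>; base node, starting points and steps may be exchanged at
  will.\<close>

lemma consistent_on_chains:
  fixes M :: "('f, 'r, 'a) struct"
  assumes card: "Card_order r" "infinite (Field r)"
    and si: "strongly_indiscernible L M r n a"
    and \<psi>: "\<psi> \<in> formulas L" "fv \<psi> \<subseteq> {..<m + n}"
    and X: "finite X" "antichain_list X"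
    and e: "\<nu> \<in> tree r" "chains_above r \<nu> X d e"
    and e': "\<nu>' \<in> tree r" "chains_above r \<nu>' X d e'"
    and cons: "consistent_on M m \<psi> a ((\<lambda>(\<zeta>, i). e \<zeta> i) ` (X \<times> {..<d}))"
  shows "consistent_on M m \<psi> a ((\<lambda>(\<zeta>, i). e' \<zeta> i) ` (X \<times> {..<d}))"
proof -
  obtain ps where ps: "set ps = X \<times> {..<d}" using X(1) finite_list[of "X \<times> {..<d}"] by auto
  let ?es = "map (\<lambda>(\<zeta>, i). e \<zeta> i) ps" and ?es' = "map (\<lambda>(\<zeta>, i). e' \<zeta> i) ps"
  have tree: "set ?es \<subseteq> tree r" "set ?es' \<subseteq> tree r"
    using e(2) e'(2) ps unfolding chains_above_def by auto
  have a: "length (a \<eta>) = n" if "\<eta> \<in> tree r" for \<eta>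
    using si that unfolding strongly_indiscernible_def by (simp add: tuples_iff)
  have qf: "qf_tp L0 (tree_struct r) ?es = qf_tp L0 (tree_struct r) ?es'"
    using chains_qf_tp[OF card e(1) X(2) e(2), of ps] chains_qf_tp[OF card e'(1) X(2) e'(2), of ps] ps by simp
  have "length ?es = length ?es'" by simp
  then have tp: "tp L M (concat (map a ?es)) {} = tp L M (concat (map a ?es')) {}"
    using si[unfolded strongly_indiscernible_def, THEN conjunct2, rule_format, of ?es ?es'] tree qf
    by (auto simp: lists_eq_set)
  have "\<exists>x\<in>tuples M m. \<forall>t\<in>set (map a ?es'). holds M \<psi> (x @ t)"
  proof (rule exists_transfer[OF \<psi> _ _ _ tp])
    show "\<exists>x\<in>tuples M m. \<forall>t\<in>set (map a ?es). holds M \<psi> (x @ t)"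
      using cons unfolding consistent_on_def by (simp add: ps split_beta)
  qed (use tree a in auto)
  then show ?thesis unfolding consistent_on_def by (simp add: ps split_beta)
qed

section \<open>Finite nodes as lists, and room for blocks\<close>

definition list_of_node :: "nat node \<Rightarrow> bool list" where
  "list_of_node \<eta> = map (\<lambda>i. the (\<eta> i)) [0..<card (dom \<eta>)]"

lemma tree_natLeq_dom:
  assumes "\<eta> \<in> tree natLeq"
  shows "dom \<eta> = {..<card (dom \<eta>)}"
proof -
  obtain k where "dom \<eta> = underS natLeq k" using assms unfolding tree_def by blast
  moreover have "underS natLeq k = {..<k}" by (auto simp: underS_def natLeq_def)
  ultimately show ?thesis by simp
qed

lemma prefix_iff_nth:
  "prefix xs ys \<longleftrightarrow> length xs \<le> length ys \<and> (\<forall>i<length xs. xs ! i = ys ! i)"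
proof
  assume r: "length xs \<le> length ys \<and> (\<forall>i<length xs. xs ! i = ys ! i)"
  then have "take (length xs) ys = xs" by (auto intro: nth_equalityI)
  then show "prefix xs ys" by (metis take_is_prefix)
qed (auto simp: prefix_def nth_append)

lemma prefix_list_of_node:
  assumes "\<eta> \<in> tree natLeq" "\<nu> \<in> tree natLeq"
  shows "prefix (list_of_node \<eta>) (list_of_node \<nu>) \<longleftrightarrow> \<eta> \<subseteq>\<^sub>m \<nu>"
proof -
  define k l where "k = card (dom \<eta>)" and "l = card (dom \<nu>)"
  have d: "dom \<eta> = {..<k}" "dom \<nu> = {..<l}"
    using tree_natLeq_dom[OF assms(1)] tree_natLeq_dom[OF assms(2)] by (simp_all add: k_def l_def)
  have "\<eta> \<subseteq>\<^sub>m \<nu> \<longleftrightarrow> k \<le> l \<and> (\<forall>i<k. the (\<eta> i) = the (\<nu> i))"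
  proof
    assume le: "\<eta> \<subseteq>\<^sub>m \<nu>"
    then have "{..<k} \<subseteq> {..<l}" using map_le_implies_dom_le d by metis
    then show "k \<le> l \<and> (\<forall>i<k. the (\<eta> i) = the (\<nu> i))" using le d by (simp add: map_le_def)
  next
    assume r: "k \<le> l \<and> (\<forall>i<k. the (\<eta> i) = the (\<nu> i))"
    have "\<eta> i = \<nu> i" if "i < k" for i
    proof -
      have "i \<in> dom \<eta>" "i \<in> dom \<nu>" using that r d by auto
      then show ?thesis using r that by auto
    qed
    then show "\<eta> \<subseteq>\<^sub>m \<nu>" using d by (simp add: map_le_def)
  qed
  moreover have "prefix (list_of_node \<eta>) (list_of_node \<nu>) \<longleftrightarrow> k \<le> l \<and> (\<forall>i<k. the (\<eta> i) = the (\<nu> i))"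
    unfolding prefix_iff_nth list_of_node_def k_def[symmetric] l_def[symmetric] by auto
  ultimately show ?thesis by simp
qed

text \<open>The \<open>d\<close> zeros before each bit make room for a block: the spread of
  \<open>s\<close> followed by fewer than \<open>d\<close> zeros is strictly below the spread of
  every proper extension of \<open>s\<close>.\<close>

definition spread :: "nat \<Rightarrow> bool list \<Rightarrow> bool list" where
  "spread d s = concat (map (\<lambda>b. replicate d False @ [b]) s)"

lemma prefix_spread_iff: "prefix (spread d s) (spread d t) \<longleftrightarrow> prefix s t"
proof (induction s arbitrary: t)
  case (Cons b s)
  then show ?case by (cases t) (auto simp: spread_def)
qed (simp add: spread_def)

lemma antichain_spread:
  assumes X: "antichain_list X" and Y: "antichain_list Y"
  shows "antichain_list ((\<lambda>(\<zeta>, s). \<zeta> @ spread d s) ` (X \<times> Y))"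
  unfolding antichain_list_def
proof (intro ballI impI)
  fix u v assume "u \<in> (\<lambda>(\<zeta>, s). \<zeta> @ spread d s) ` (X \<times> Y)" "v \<in> (\<lambda>(\<zeta>, s). \<zeta> @ spread d s) ` (X \<times> Y)"
    and p: "prefix u v"
  then obtain \<zeta> s \<zeta>' s' where u: "\<zeta> \<in> X" "s \<in> Y" "u = \<zeta> @ spread d s" and v: "\<zeta>' \<in> X" "s' \<in> Y" "v = \<zeta>' @ spread d s'"
    by auto
  have "prefix \<zeta> v" "prefix \<zeta>' v" using p u(3) v(3) by (auto intro: prefix_order.trans append_prefixD)
  then have "\<zeta> = \<zeta>'" using prefix_same_cases X u(1) v(1) unfolding antichain_list_def by metis
  then have "prefix s s'" using p u(3) v(3) prefix_spread_iff by simp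
  then have "s = s'" using Y u(2) v(2) unfolding antichain_list_def by blast
  then show "u = v" using \<open>\<zeta> = \<zeta>'\<close> u(3) v(3) by simp
qed

lemma chains_above_append_list:
  assumes card: "Card_order r" "infinite (Field r)" and \<nu>: "\<nu> \<in> tree r"
  shows "chains_above r \<nu> X d (\<lambda>\<zeta> i. append_list r \<nu> (\<zeta> @ replicate i False))"
  unfolding chains_above_def
proof (intro ballI allI impI conjI)
  fix \<zeta> i
  show "append_list r \<nu> (\<zeta> @ replicate i False) \<in> tree r" by (rule append_list_tree[OF card \<nu>])
  show "append_list r \<nu> \<zeta> \<subseteq>\<^sub>m append_list r \<nu> (\<zeta> @ replicate i False)"
    by (rule append_list_prefix[OF card \<nu>]) simp
  fix j assume "j < i"
  then have "replicate i False = replicate j False @ replicate (i - j) False" by (simp flip: replicate_add)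
  then have "strict_prefix (\<zeta> @ replicate j False) (\<zeta> @ replicate i False)"
    using \<open>j < i\<close> by (auto simp: strict_prefix_def)
  then show "append_list r \<nu> (\<zeta> @ replicate j False) \<subseteq>\<^sub>m append_list r \<nu> (\<zeta> @ replicate i False)"
    "append_list r \<nu> (\<zeta> @ replicate j False) \<noteq> append_list r \<nu> (\<zeta> @ replicate i False)"
    using append_list_prefix[OF card \<nu>] append_list_strict[OF card \<nu>] by (auto simp: strict_prefix_def)
qed

text \<open>
  Take \<open>d\<close> maximal such that the formula is consistent along finite antichains of blocks, a block
  being a chain of length \<open>d\<close>, and a finite antichain \<open>X0\<close> of chains of length \<open>d + 1\<close> along which
  it is not.  The conjunction over \<open>card X0\<close> parallel blocks has ATP: two comparable conjunctions
  contain chains of length \<open>d + 1\<close> above all members of \<open>X0\<close>.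
\<close>

lemma chain_inconsistency_imp_ATP:
  fixes M :: "('f, 'r, 'a) struct"
  assumes card: "Card_order r" "infinite (Field r)"
    and ne: "univ M \<noteq> {}"
    and si: "strongly_indiscernible L M r n a"
    and \<psi>: "\<psi> \<in> formulas L" "fv \<psi> \<subseteq> {..<m + n}"
    and \<nu>: "\<nu> \<in> tree r"
  defines "C \<equiv> \<lambda>d. \<forall>X. finite X \<and> antichain_list X \<longrightarrow>
    consistent_on M m \<psi> a ((\<lambda>(\<zeta>, i). append_list r \<nu> (\<zeta> @ replicate i False)) ` (X \<times> {..<d}))"
  assumes C1: "C 1" and Ck: "\<not> C k"
  shows "\<not> NATP L M"
proof -
  have a: "a \<eta> \<in> tuples M n" if "\<eta> \<in> tree r" for \<eta>
    using si that unfolding strongly_indiscernible_def by simp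
  have E: "append_list r \<nu> s \<in> tree r" for s using append_list_tree[OF card \<nu>] .
  have "C 0"
  proof -
    obtain u where "u \<in> univ M" using ne by blast
    then have "replicate m u \<in> tuples M m" by (auto simp: tuples_iff)
    then show ?thesis unfolding C_def consistent_on_def by auto
  qed
  define D where "D = (LEAST k. \<not> C k)"
  have D: "\<not> C D" unfolding D_def using Ck by (rule LeastI)
  have less: "C i" if "i < D" for i using that not_less_Least unfolding D_def by blast
  \<comment> \<open>Thus \<open>d \<ge> 1\<close>: blocks are nonempty, which is needed below to
    take a node from the upper one of two comparable blocks.\<close>
  have "D \<noteq> 0" "D \<noteq> 1" using D C1 \<open>C 0\<close> by metis+
  then obtain d where d: "D = Suc d" "0 < d" by (cases D) auto
  have Cd: "C d" using less d(1) by simp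
  obtain X where X: "finite X" "antichain_list X"
    and incons: "\<not> consistent_on M m \<psi> a ((\<lambda>(\<zeta>, i). append_list r \<nu> (\<zeta> @ replicate i False)) ` (X \<times> {..<Suc d}))"
    using D unfolding d(1) C_def by blast
  obtain ps where ps: "set ps = X \<times> {..<d}" using X(1) finite_list[of "X \<times> {..<d}"] by auto
  define N where "N = length ps"
  \<comment> \<open>The nodes of the parallel blocks at \<open>s\<close>, one block of length
    \<open>d\<close> above each \<open>\<zeta> \<in> X\<close>; the parameter \<open>c s\<close>
    lists their tuples.\<close>
  define ns where "ns s = map (\<lambda>(\<zeta>, i). append_list r \<nu> (\<zeta> @ spread d s @ replicate i False)) ps" for s
  define c where "c s = concat (map a (ns s))" for s
  have ns_tree: "\<eta> \<in> tree r" if "\<eta> \<in> set (ns s)" for \<eta> s using that E by (auto simp: ns_def)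
  have len_a: "length t = n" if "t \<in> set (map a (ns s))" for t s
    using that a ns_tree by (auto simp: tuples_iff)
  show ?thesis
  proof (rule conjunction_formula[OF \<psi>, of N M])
    fix \<phi> assume \<phi>: "\<phi> \<in> formulas L" "fv \<phi> \<subseteq> {..<m + N * n}"
      and \<phi>_iff: "\<And>x ts. length x = m \<Longrightarrow> length ts = N \<Longrightarrow> (\<And>t. t \<in> set ts \<Longrightarrow> length t = n) \<Longrightarrow>
        holds M \<phi> (x @ concat ts) \<longleftrightarrow> (\<forall>t\<in>set ts. holds M \<psi> (x @ t))"
    have \<phi>c: "holds M \<phi> (x @ c s) \<longleftrightarrow> (\<forall>\<eta>\<in>set (ns s). holds M \<psi> (x @ a \<eta>))" if "x \<in> tuples M m" for x s
      using \<phi>_iff[of x "map a (ns s)", OF _ _ len_a] that unfolding c_def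
      by (simp add: tuples_iff N_def ns_def del: concat_map_singleton)
    have c_tuple: "c s \<in> tuples M (N * n)" for s
    proof -
      have "length (c s) = N * n"
        using length_concat_uniform[of "map a (ns s)" n, OF len_a] by (simp add: c_def N_def ns_def)
      moreover have "set (a \<eta>) \<subseteq> univ M" if "\<eta> \<in> set (ns s)" for \<eta>
        using a[OF ns_tree[OF that]] by (simp add: tuples_iff)
      then have "set (c s) \<subseteq> univ M" by (auto simp: c_def)
      ultimately show ?thesis by (simp add: tuples_iff)
    qed
    have "formula_ATP M m (N * n) \<phi>" unfolding formula_ATP_def
    proof (intro exI[of _ "\<lambda>\<eta>. c (list_of_node \<eta>)"] conjI ballI allI impI)
      show "c (list_of_node \<eta>) \<in> tuples M (N * n)" for \<eta> by (rule c_tuple)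
    next
      fix Y assume Y: "Y \<subseteq> tree natLeq" "\<forall>\<eta>\<in>Y. \<forall>\<nu>\<in>Y. \<eta> \<noteq> \<nu> \<longrightarrow> incomparable \<eta> \<nu>"
      show "consistent M m {(\<phi>, c (list_of_node \<eta>)) |\<eta>. \<eta> \<in> Y}"
        unfolding consistent_def
      proof (intro allI impI)
        fix q assume q: "q \<subseteq> {(\<phi>, c (list_of_node \<eta>)) |\<eta>. \<eta> \<in> Y}" "finite q"
        have "q \<subseteq> (\<lambda>\<eta>. (\<phi>, c (list_of_node \<eta>))) ` Y" using q(1) by auto
        then obtain Z where Z: "Z \<subseteq> Y" "finite Z" "q = (\<lambda>\<eta>. (\<phi>, c (list_of_node \<eta>))) ` Z"
          using finite_subset_image[OF q(2)] by blast
        \<comment> \<open>The starting points of all blocks that occur. They form a finite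
          antichain, so \<open>C d\<close> applies to them.\<close>
        let ?W = "(\<lambda>(\<zeta>, s). \<zeta> @ spread d s) ` (X \<times> list_of_node ` Z)"
        have "antichain_list (list_of_node ` Z)" unfolding antichain_list_def
        proof (intro ballI impI)
          fix u v assume "u \<in> list_of_node ` Z" "v \<in> list_of_node ` Z" and p: "prefix u v"
          then obtain \<eta> \<nu> where e: "\<eta> \<in> Z" "\<nu> \<in> Z" "u = list_of_node \<eta>" "v = list_of_node \<nu>" by blast
          then have "\<eta> \<subseteq>\<^sub>m \<nu>" using p prefix_list_of_node[of \<eta> \<nu>] Z(1) Y(1) by blast
          then have "\<eta> = \<nu>" using Y(2) e(1,2) Z(1) unfolding incomparable_def by blast
          then show "u = v" using e by simp
        qed
        then have "antichain_list ?W" by (rule antichain_spread[OF X(2)])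
        moreover have "finite ?W" using X(1) Z(2) by simp
        ultimately have "consistent_on M m \<psi> a ((\<lambda>(\<zeta>, i). append_list r \<nu> (\<zeta> @ replicate i False)) ` (?W \<times> {..<d}))"
          using Cd unfolding C_def by blast
        then obtain x where x: "x \<in> tuples M m"
          "\<forall>\<eta>\<in>(\<lambda>(\<zeta>, i). append_list r \<nu> (\<zeta> @ replicate i False)) ` (?W \<times> {..<d}). holds M \<psi> (x @ a \<eta>)"
          unfolding consistent_on_def by blast
        have "holds M \<phi> (x @ c (list_of_node \<eta>))" if e: "\<eta> \<in> Z" for \<eta>
          unfolding \<phi>c[OF x(1)]
        proof
          fix \<xi> assume "\<xi> \<in> set (ns (list_of_node \<eta>))"
          then obtain \<zeta> i where z: "\<zeta> \<in> X" "i < d"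
            "\<xi> = append_list r \<nu> ((\<zeta> @ spread d (list_of_node \<eta>)) @ replicate i False)"
            using ps unfolding ns_def by auto
          have "\<zeta> @ spread d (list_of_node \<eta>) \<in> ?W" using z(1) e by (intro image_eqI[of _ _ "(\<zeta>, list_of_node \<eta>)"]) auto
          then have "\<xi> \<in> (\<lambda>(\<zeta>, i). append_list r \<nu> (\<zeta> @ replicate i False)) ` (?W \<times> {..<d})"
            using z(2,3) by (intro image_eqI[of _ _ "(\<zeta> @ spread d (list_of_node \<eta>), i)"]) auto
          then show "holds M \<psi> (x @ a \<xi>)" using x(2) by blast
        qed
        then have "realizes M x q" unfolding realizes_def Z(3) by auto
        then show "\<exists>b\<in>tuples M m. realizes M b q" using x(1) by blast
      qed
    next
      fix \<eta> \<eta>' assume tr: "\<eta> \<in> tree natLeq" "\<eta>' \<in> tree natLeq" and le: "\<eta> \<subseteq>\<^sub>m \<eta>' \<and> \<eta> \<noteq> \<eta>'"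
      define s t where "s = list_of_node \<eta>" and "t = list_of_node \<eta>'"
      have "prefix s t" "\<not> prefix t s"
        using prefix_list_of_node[OF tr] prefix_list_of_node[OF tr(2,1)] le map_le_antisym
        unfolding s_def t_def by auto
      then have "strict_prefix s t" by (auto simp: strict_prefix_def)
      then obtain b u where t: "t = s @ b # u" by (rule strict_prefixE')
      have sp: "spread d t = spread d s @ replicate d False @ b # spread d u"
        by (simp add: t spread_def)
      \<comment> \<open>The block of length \<open>d\<close> at \<open>s\<close>, followed by the
        first node of the block at \<open>t\<close>. These chains of length \<open>d + 1\<close>
        above the members of \<open>X\<close> contradict the choice of \<open>X\<close>.\<close>
      define e where "e \<zeta> i = append_list r \<nu> (if i < d then \<zeta> @ spread d s @ replicate i False else \<zeta> @ spread d t)" for \<zeta> i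
      show "\<not> consistent M m {(\<phi>, c (list_of_node \<eta>)), (\<phi>, c (list_of_node \<eta>'))}"
      proof
        assume "consistent M m {(\<phi>, c (list_of_node \<eta>)), (\<phi>, c (list_of_node \<eta>'))}"
        then obtain x where x: "x \<in> tuples M m" "realizes M x {(\<phi>, c s), (\<phi>, c t)}"
          unfolding consistent_def s_def t_def by (metis finite.emptyI finite_insert order_refl)
        then have h: "holds M \<phi> (x @ c s)" "holds M \<phi> (x @ c t)" unfolding realizes_def by auto
        have "holds M \<psi> (x @ a (e \<zeta> i))" if z: "\<zeta> \<in> X" "i < Suc d" for \<zeta> i
        proof (cases "i < d")
          case True
          then have "(\<zeta>, i) \<in> set ps" using ps z(1) by simp
          then have "e \<zeta> i \<in> set (ns s)" using True by (force simp: e_def ns_def)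
          then show ?thesis using h(1) \<phi>c[OF x(1)] by blast
        next
          case False
          have "(\<zeta>, 0) \<in> set ps" using ps z(1) d(2) by simp
          then have "e \<zeta> i \<in> set (ns t)" using False by (force simp: e_def ns_def)
          then show ?thesis using h(2) \<phi>c[OF x(1)] by blast
        qed
        then have "consistent_on M m \<psi> a ((\<lambda>(\<zeta>, i). e \<zeta> i) ` (X \<times> {..<Suc d}))"
          unfolding consistent_on_def using x(1) by auto
        moreover have "chains_above r \<nu> X (Suc d) e" unfolding chains_above_def
        proof (intro ballI allI impI conjI)
          fix \<zeta> i assume "\<zeta> \<in> X" "i < Suc d"
          show "e \<zeta> i \<in> tree r" unfolding e_def by (rule E)
          show "append_list r \<nu> \<zeta> \<subseteq>\<^sub>m e \<zeta> i"
            unfolding e_def by (rule append_list_prefix[OF card \<nu>]) simp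
          fix j assume "j < i"
          have "strict_prefix (\<zeta> @ spread d s @ replicate j False)
              (if i < d then \<zeta> @ spread d s @ replicate i False else \<zeta> @ spread d t)"
          proof (cases "i < d")
            case True
            have "replicate i False = replicate j False @ replicate (i - j) False"
              using \<open>j < i\<close> by (simp flip: replicate_add)
            then show ?thesis using True \<open>j < i\<close> by (auto simp: strict_prefix_def)
          next
            case False
            have "replicate d False = replicate j False @ replicate (d - j) False"
              using \<open>j < i\<close> \<open>i < Suc d\<close> by (simp flip: replicate_add)
            then show ?thesis using False by (auto simp: strict_prefix_def sp)
          qed
          then show "e \<zeta> j \<subseteq>\<^sub>m e \<zeta> i" "e \<zeta> j \<noteq> e \<zeta> i"
            using append_list_prefix[OF card \<nu>] append_list_strict[OF card \<nu>] \<open>j < i\<close> \<open>i < Suc d\<close>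
            unfolding e_def by (auto simp: strict_prefix_def)
        qed
        moreover note chains_above_append_list[OF card \<nu>, of X "Suc d"]
        ultimately have "consistent_on M m \<psi> a ((\<lambda>(\<zeta>, i). append_list r \<nu> (\<zeta> @ replicate i False)) ` (X \<times> {..<Suc d}))"
          by (rule consistent_on_chains[OF card si \<psi> X \<nu> _ \<nu>, rotated 2])
        then show False by (rule notE[OF incons])
      qed
    qed
    then have "\<exists>m n. \<exists>\<phi>\<in>formulas L. fv \<phi> \<subseteq> {..<m + n} \<and> formula_ATP M m n \<phi>"
      using \<phi> by (intro exI[of _ m] exI[of _ "N * n"] bexI[of _ \<phi>] conjI)
    then show ?thesis by (simp only: NATP_def not_not)
  qed
qed

section \<open>Dense colours\<close>

lemma Field_Restr_underS: "Well_order r \<Longrightarrow> Field (Restr r (underS r a)) = underS r a"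
  by (simp add: Field_Restr_ofilter wo_rel.underS_ofilter wo_rel_def)

lemma bounded_below_regular:
  assumes card: "Card_order r" "infinite (Field r)" and a: "a \<in> Field r"
    and reg: "regularCard (Restr r (underS r a))"
    and X: "X \<subseteq> underS r a" "|X| <o Restr r (underS r a)"
  obtains b where "b \<in> underS r a" "\<And>x. x \<in> X \<Longrightarrow> (x, b) \<in> r"
proof -
  note wo = card_wo[OF card]
  let ?K = "Restr r (underS r a)"
  have F: "Field ?K = underS r a" by (rule Field_Restr_underS[OF wo])
  have "\<not> cofinal X ?K"
    using reg X not_ordLess_ordIso unfolding regularCard_def F by blast
  then obtain b where b: "b \<in> underS r a" "\<And>x. x \<in> X \<Longrightarrow> b = x \<or> (b, x) \<notin> ?K"
    unfolding cofinal_def F by blast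
  have "(x, b) \<in> r" if "x \<in> X" for x
  proof -
    have "x \<in> underS r a" using that X(1) by blast
    then have "b = x \<or> (b, x) \<notin> r" using b that by blast
    then show ?thesis
      using wo_total[OF wo, of x b] wo_refl[OF wo] \<open>x \<in> underS r a\<close> b(1) underS_Field[OF wo, of a] by blast
  qed
  then show thesis using that b(1) by blast
qed

text \<open>In the application \<open>a\<close> is the ordinal \<kappa> inside \<kappa>', so these
  are the nodes of length less than \<kappa>.\<close>

definition below :: "'o rel \<Rightarrow> 'o \<Rightarrow> 'o node \<Rightarrow> bool" where
  "below r a \<nu> \<longleftrightarrow> (\<exists>b\<in>underS r a. dom \<nu> = underS r b)"

lemma below_tree: "Well_order r \<Longrightarrow> below r a \<nu> \<Longrightarrow> \<nu> \<in> tree r"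
  unfolding below_def tree_def using underS_Field by fast

text \<open>By regularity the lengths have a common bound below \<kappa>, and pairwise comparable
  nodes agree wherever two of them are defined.\<close>

lemma common_extension:
  assumes card: "Card_order r" "infinite (Field r)" and a: "a \<in> Field r"
    and reg: "regularCard (Restr r (underS r a))"
    and A: "|A| <o Restr r (underS r a)" "\<And>\<nu>. \<nu> \<in> A \<Longrightarrow> below r a \<nu>"
    and comp: "\<And>\<nu> \<nu>'. \<nu> \<in> A \<Longrightarrow> \<nu>' \<in> A \<Longrightarrow> \<nu> \<subseteq>\<^sub>m \<nu>' \<or> \<nu>' \<subseteq>\<^sub>m \<nu>"
  obtains \<nu> where "below r a \<nu>" "\<And>\<xi>. \<xi> \<in> A \<Longrightarrow> \<xi> \<subseteq>\<^sub>m \<nu>"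
proof -
  note wo = card_wo[OF card]
  have "\<forall>\<nu>\<in>A. \<exists>b. b \<in> underS r a \<and> dom \<nu> = underS r b" using A(2) unfolding below_def by blast
  then obtain f where f: "\<And>\<nu>. \<nu> \<in> A \<Longrightarrow> f \<nu> \<in> underS r a \<and> dom \<nu> = underS r (f \<nu>)" by metis
  have "|f ` A| <o Restr r (underS r a)" using card_of_image ordLeq_ordLess_trans A(1) by blast
  moreover have "f ` A \<subseteq> underS r a" using f by blast
  ultimately obtain b where b: "b \<in> underS r a" "\<And>x. x \<in> f ` A \<Longrightarrow> (x, b) \<in> r"
    using bounded_below_regular[OF card a reg] by metis
  \<comment> \<open>The default \<open>Some False\<close> pads the union with zeros, so that its
    restriction to the bound \<open>b\<close> is a node of exactly that length.\<close>
  define U where "U x = (if \<exists>\<nu>\<in>A. x \<in> dom \<nu> then (SOME \<nu>. \<nu> \<in> A \<and> x \<in> dom \<nu>) x else Some False)" for x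
  have U: "U x = \<nu> x" if n: "\<nu> \<in> A" "x \<in> dom \<nu>" for \<nu> x
  proof -
    define \<nu>' where "\<nu>' = (SOME \<nu>. \<nu> \<in> A \<and> x \<in> dom \<nu>)"
    have n': "\<nu>' \<in> A \<and> x \<in> dom \<nu>'" unfolding \<nu>'_def by (rule someI[of _ \<nu>]) (use n in simp)
    have "U x = \<nu>' x" using n unfolding U_def \<nu>'_def by auto
    also have "\<dots> = \<nu> x" using comp[of \<nu> \<nu>'] n n' unfolding map_le_def by metis
    finally show ?thesis .
  qed
  have U_dom: "U x \<noteq> None" for x
  proof (cases "\<exists>\<nu>\<in>A. x \<in> dom \<nu>")
    case True
    then obtain \<nu> where n: "\<nu> \<in> A" "x \<in> dom \<nu>" by blast
    then show ?thesis using U[OF n] by auto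
  qed (simp add: U_def)
  show thesis
  proof (rule that[of "U |` underS r b"])
    have "dom (U |` underS r b) = underS r b" using U_dom by (auto simp: restrict_map_def split: if_splits)
    then show "below r a (U |` underS r b)" using b(1) unfolding below_def by blast
    fix \<xi> assume x: "\<xi> \<in> A"
    then have "(f \<xi>, b) \<in> r" using b(2) by blast
    then have "underS r (f \<xi>) \<subseteq> underS r b"
      using wo_trans[OF wo] wo_antisym[OF wo] unfolding underS_def by blast
    then show "\<xi> \<subseteq>\<^sub>m U |` underS r b"
      unfolding map_le_def using f[OF x] U[OF x] by (metis restrict_in subsetD)
  qed
qed

text \<open>
  If no colour were dense above a node, one could avoid the colours one after the other along an
  increasing sequence of nodes, whose union is still a node by regularity.
\<close>

lemma dense_colour:
  fixes col :: "'o node \<Rightarrow> 'c"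
  assumes card: "Card_order r" "infinite (Field r)" and a: "a \<in> Field r"
    and reg: "regularCard (Restr r (underS r a))"
    and Col: "|Col| <o Restr r (underS r a)" "\<And>\<rho>. dom \<rho> = underS r a \<Longrightarrow> col \<rho> \<in> Col"
  obtains c \<nu> where "below r a \<nu>"
    "\<And>\<nu>'. below r a \<nu>' \<Longrightarrow> \<nu> \<subseteq>\<^sub>m \<nu>' \<Longrightarrow> \<exists>\<rho>. dom \<rho> = underS r a \<and> \<nu>' \<subseteq>\<^sub>m \<rho> \<and> col \<rho> = c"
proof (rule ccontr)
  note main = that
  assume no: "\<not> thesis"
  define kills where "kills c \<nu> \<longleftrightarrow> below r a \<nu> \<and> (\<forall>\<rho>. dom \<rho> = underS r a \<longrightarrow> \<nu> \<subseteq>\<^sub>m \<rho> \<longrightarrow> col \<rho> \<noteq> c)" for c \<nu>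
  \<comment> \<open>Since no colour is dense above any node, each colour can be avoided for good by
    passing to a further extension.\<close>
  have N: "\<exists>\<nu>'. kills c \<nu>' \<and> \<nu> \<subseteq>\<^sub>m \<nu>'" if n: "below r a \<nu>" for c \<nu>
  proof (rule ccontr)
    assume k: "\<not> (\<exists>\<nu>'. kills c \<nu>' \<and> \<nu> \<subseteq>\<^sub>m \<nu>')"
    have "\<exists>\<rho>. dom \<rho> = underS r a \<and> \<nu>' \<subseteq>\<^sub>m \<rho> \<and> col \<rho> = c" if "below r a \<nu>'" "\<nu> \<subseteq>\<^sub>m \<nu>'" for \<nu>'
      using k that unfolding kills_def by blast
    then show False using no main[OF n] by blast
  qed
  \<comment> \<open>A partial injection-like record of avoided colours: at most one node for each
    colour, all nodes pairwise comparable. A maximal record takes the place of the transfinite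
    construction.\<close>
  define good where "good R \<longleftrightarrow> (\<forall>p\<in>R. fst p \<in> Col \<and> kills (fst p) (snd p)) \<and>
    (\<forall>p\<in>R. \<forall>q\<in>R. snd p \<subseteq>\<^sub>m snd q \<or> snd q \<subseteq>\<^sub>m snd p) \<and> (\<forall>p\<in>R. \<forall>q\<in>R. fst p = fst q \<longrightarrow> p = q)"
    for R :: "('c \<times> 'o node) set"
  have "\<exists>R\<in>{R. good R}. \<forall>R'\<in>{R. good R}. R \<subseteq> R' \<longrightarrow> R' = R"
  proof (rule subset_Zorn_nonempty)
    have "good {}" by (simp add: good_def)
    then show "{R. good R} \<noteq> {}" by blast
    fix \<C> assume c: "\<C> \<noteq> {}" "subset.chain {R. good R} \<C>"
    have two: "\<exists>R. good R \<and> p \<in> R \<and> q \<in> R" if pq: "p \<in> \<Union>\<C>" "q \<in> \<Union>\<C>" for p q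
    proof -
      obtain R R' where R: "R \<in> \<C>" "p \<in> R" "R' \<in> \<C>" "q \<in> R'" using pq by blast
      then have "R \<subseteq> R' \<or> R' \<subseteq> R" "good R" "good R'" using c(2) unfolding subset.chain_def by blast+
      then show ?thesis using R by blast
    qed
    have "good (\<Union>\<C>)" unfolding good_def
    proof (intro conjI ballI)
      fix p q assume pq: "p \<in> \<Union>\<C>" "q \<in> \<Union>\<C>"
      obtain R where R: "good R" "p \<in> R" "q \<in> R" using two[OF pq] by blast
      then show "snd p \<subseteq>\<^sub>m snd q \<or> snd q \<subseteq>\<^sub>m snd p" "fst p = fst q \<longrightarrow> p = q"
        unfolding good_def by blast+
    next
      fix p assume p: "p \<in> \<Union>\<C>"
      obtain R where R: "good R" "p \<in> R" using two[OF p p] by blast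
      then show "fst p \<in> Col" "kills (fst p) (snd p)" unfolding good_def by blast+
    qed
    then show "\<Union>\<C> \<in> {R. good R}" by simp
  qed
  then obtain R where R: "good R" and max: "\<And>R'. good R' \<Longrightarrow> R \<subseteq> R' \<Longrightarrow> R' = R" by auto
  have "inj_on fst R" using R unfolding good_def inj_on_def by blast
  moreover have "fst ` R \<subseteq> Col" using R unfolding good_def by blast
  ultimately have "|R| \<le>o |Col|" using card_of_ordLeqI[of fst R Col] by blast
  then have "|snd ` R| \<le>o |Col|" using card_of_image ordLeq_transitive by blast
  then have small: "|snd ` R| <o Restr r (underS r a)" using Col(1) ordLeq_ordLess_trans by blast
  have bel: "below r a \<nu>" if "\<nu> \<in> snd ` R" for \<nu> using R that unfolding good_def kills_def by blast
  have comp: "\<nu> \<subseteq>\<^sub>m \<nu>' \<or> \<nu>' \<subseteq>\<^sub>m \<nu>" if "\<nu> \<in> snd ` R" "\<nu>' \<in> snd ` R" for \<nu> \<nu>'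
    using R that unfolding good_def by blast
  obtain \<nu> where \<nu>: "below r a \<nu>" "\<And>\<xi>. \<xi> \<in> snd ` R \<Longrightarrow> \<xi> \<subseteq>\<^sub>m \<nu>"
    by (rule common_extension[OF card a reg small bel comp]) (assumption, assumption, assumption, (rule that; blast))
  \<comment> \<open>A common extension \<open>\<nu>\<close> of the record exists, as there are at
    most as many entries as colours. A missing colour could be avoided above it, against
    maximality.\<close>
  have all: "c \<in> fst ` R" if c: "c \<in> Col" for c
  proof (rule ccontr)
    assume nc: "c \<notin> fst ` R"
    obtain \<nu>' where \<nu>': "kills c \<nu>'" "\<nu> \<subseteq>\<^sub>m \<nu>'" using N[OF \<nu>(1)] by blast
    have "snd p \<subseteq>\<^sub>m \<nu>'" if "p \<in> R" for p using \<nu>(2)[of "snd p"] that \<nu>'(2) map_le_trans by blast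
    then have "good (insert (c, \<nu>') R)"
      using R c nc \<nu>'(1) unfolding good_def by (auto simp: image_iff)
    then have "insert (c, \<nu>') R = R" by (rule max) blast
    then show False using nc by (metis fst_conv image_eqI insertI1)
  qed
  \<comment> \<open>Continuing \<open>\<nu>\<close> by zeros up to length \<kappa> gives a sequence
    that extends all recorded nodes. Its own colour is among the avoided ones.\<close>
  define \<rho> where "\<rho> x = (if x \<in> underS r a then (if x \<in> dom \<nu> then \<nu> x else Some False) else None)" for x
  have dom: "dom \<rho> = underS r a" by (auto simp: \<rho>_def dom_def split: if_splits)
  have sub: "dom \<nu> \<subseteq> underS r a"
  proof -
    obtain b where "b \<in> underS r a" "dom \<nu> = underS r b" using \<nu>(1) unfolding below_def by blast
    then show ?thesis
      using wo_trans[OF card_wo[OF card]] wo_antisym[OF card_wo[OF card]] unfolding underS_def by blast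
  qed
  then have "\<nu> \<subseteq>\<^sub>m \<rho>" unfolding map_le_def \<rho>_def by auto
  obtain p where p: "p \<in> R" "fst p = col \<rho>" using all[OF Col(2)[OF dom]] by auto
  have "snd p \<subseteq>\<^sub>m \<rho>" using \<nu>(2)[of "snd p"] p(1) \<open>\<nu> \<subseteq>\<^sub>m \<rho>\<close> map_le_trans by blast
  moreover have "kills (fst p) (snd p)" using R p(1) unfolding good_def by blast
  ultimately show False using p(2) dom unfolding kills_def by metis
qed

text \<open>\<kappa> is a limit, so finitely many further bits keep the length below it. This lets
  density be applied above copies of finite antichains.\<close>

lemma below_append_list:
  assumes card: "Card_order r" "infinite (Field r)" and a: "a \<in> Field r"
    and limit: "\<And>b. b \<in> underS r a \<Longrightarrow> \<exists>c\<in>underS r a. b \<in> underS r c"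
    and \<nu>: "below r a \<nu>"
  shows "below r a (append_list r \<nu> s)"
  using \<nu>
proof (induction s arbitrary: \<nu>)
  case (Cons b s)
  note wo = card_wo[OF card]
  obtain x where x: "x \<in> underS r a" "dom \<nu> = underS r x" using Cons.prems unfolding below_def by blast
  then have xF: "x \<in> Field r" using underS_Field[OF wo] by blast
  obtain z where z: "z \<in> underS r a" "x \<in> underS r z" using limit[OF x(1)] by blast
  obtain y where y: "y \<in> Field r" "insert x (underS r x) = underS r y"
      "\<And>z. z \<in> Field r \<Longrightarrow> x \<in> underS r z \<Longrightarrow> (y, z) \<in> r"
    by (rule successor[OF card xF]) (rule that; blast)
  have "(y, z) \<in> r" using y(3) z underS_Field[OF wo] by blast
  then have "y \<in> underS r a" using underS_down[OF wo z(1)] by blast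
  moreover have "dom (snoc r \<nu> b) = underS r y"
    unfolding snoc_eq[OF card xF x(2)] using x(2) y(2) by auto
  ultimately have "below r a (snoc r \<nu> b)" unfolding below_def by blast
  then show ?case using Cons.IH by (simp add: append_list_def)
qed (simp add: append_list_def)

lemma empty_node_tree:
  assumes wo: "Well_order r" and ne: "Field r \<noteq> {}"
  obtains z where "z \<in> Field r" "underS r z = {}" "Map.empty \<in> tree r"
proof -
  obtain z where z: "z \<in> Field r" "\<And>x. x \<in> Field r \<Longrightarrow> (z, x) \<in> r"
    using wo_least[OF wo _ ne] by blast
  have "underS r z = {}" using z(2) wo_antisym[OF wo] underS_Field[OF wo, of z] unfolding underS_def by blast
  moreover from this have "Map.empty \<in> tree r" using z(1) unfolding tree_def by auto
  ultimately show thesis using that z(1) by blast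
qed

lemma strict_chain_above:
  assumes card: "Card_order r" "infinite (Field r)" and a: "a \<in> Field r" and \<rho>: "dom \<rho> = underS r a"
    and l: "set l \<subseteq> Field r" "ascending r l"
  shows "chains_above r Map.empty {[]} (length l) (\<lambda>_ i. concat_node r \<rho> (zeros r (l ! i)))"
  unfolding chains_above_def
proof (intro ballI allI impI conjI)
  fix \<zeta> :: "bool list" and i assume z: "\<zeta> \<in> {[]}" and i: "i < length l"
  have lF: "l ! i \<in> Field r" using l(1) i nth_mem by blast
  show "concat_node r \<rho> (zeros r (l ! i)) \<in> tree r" by (rule concat_zeros_tree[OF card a \<rho> lF])
  show "append_list r Map.empty \<zeta> \<subseteq>\<^sub>m concat_node r \<rho> (zeros r (l ! i))"
    using z by (simp add: append_list_def)
  fix j assume "j < i"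
  then have "(l ! j, l ! i) \<in> r" "l ! j \<noteq> l ! i" using l(2) i by (auto simp: sorted_wrt_iff_nth_less)
  then show "concat_node r \<rho> (zeros r (l ! j)) \<subseteq>\<^sub>m concat_node r \<rho> (zeros r (l ! i))"
    "concat_node r \<rho> (zeros r (l ! j)) \<noteq> concat_node r \<rho> (zeros r (l ! i))"
    using concat_zeros_less[OF card a \<rho>] by blast+
qed

lemma antichain_singleton: "antichain_list {s}"
  by (simp add: antichain_list_def)

text \<open>Increasing chains of the same finite length have the same quantifier-free type: they are
  chains above the trivial antichain \<open>{[]}\<close> at the root.\<close>

lemma zeros_indiscernible:
  assumes card: "Card_order r" "infinite (Field r)" and a: "a \<in> Field r" and \<rho>: "dom \<rho> = underS r a"
    and si: "strongly_indiscernible L M r n f"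
  shows "indiscernible_seq L M r (\<lambda>i. f (concat_node r \<rho> (zeros r i))) {}"
  unfolding indiscernible_seq_def
proof (intro ballI impI, elim conjE)
  fix "is" js assume ij: "is \<in> lists (Field r)" "js \<in> lists (Field r)" "length is = length js"
    "ascending r is" "ascending r js"
  have e: "Map.empty \<in> tree r" using empty_node_tree[OF card_wo[OF card]] card(2) by (metis finite.emptyI)
  let ?N = "\<lambda>l. map (\<lambda>i. concat_node r \<rho> (zeros r i)) l"
  have qf: "qf_tp L0 (tree_struct r) (?N l) =
      qf_tp L0 (tree_like longest_common_prefix prefix list_lex) (map (\<lambda>i. replicate i False) [0..<length l])"
    if "set l \<subseteq> Field r" "ascending r l" for l
  proof -
    have "map (\<lambda>i. concat_node r \<rho> (zeros r (l ! i))) [0..<length l] = ?N l"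
      by (rule nth_equalityI) auto
    moreover have ps: "set (map (Pair []) [0..<length l]) \<subseteq> {[]} \<times> {..<length l}" by auto
    ultimately show ?thesis
      using chains_qf_tp[OF card e antichain_singleton strict_chain_above[OF card a \<rho> that] ps]
      by (simp add: comp_def)
  qed
  have F: "set is \<subseteq> Field r" "set js \<subseteq> Field r" using ij by auto
  have "qf_tp L0 (tree_struct r) (?N is) = qf_tp L0 (tree_struct r) (?N js)"
    using qf[OF F(1) ij(4)] qf[OF F(2) ij(5)] ij(3) by simp
  moreover have "?N l \<in> lists (tree r)" if "set l \<subseteq> Field r" for l
    using concat_zeros_tree[OF card a \<rho>] that by (auto simp: lists_eq_set)
  ultimately have "tp L M (concat (map f (?N is))) {} = tp L M (concat (map f (?N js))) {}"
    using si[unfolded strongly_indiscernible_def, THEN conjunct2, rule_format, of "?N is" "?N js"] F ij(3) by simp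
  then show "tp L M (concat (map (\<lambda>i. f (concat_node r \<rho> (zeros r i))) is)) {} =
      tp L M (concat (map (\<lambda>i. f (concat_node r \<rho> (zeros r i))) js)) {}"
    by (simp add: comp_def)
qed

lemma NATP_imp_realization:
  fixes M :: "('f, 'r, 'a) struct" and r :: "'o rel" and f :: "'o node \<Rightarrow> 'a list" and \<mu> :: "'l rel"
  assumes card: "Card_order r" "infinite (Field r)" and a: "a \<in> Field r"
    and K: "Card_order (Restr r (underS r a))" "regularCard (Restr r (underS r a))" "infinite (underS r a)"
      "|formulas L \<times> (UNIV :: nat set)| <o Restr r (underS r a)"
    and sat: "saturated L M \<mu>" and ne: "univ M \<noteq> {}"
    and small: "\<And>m n. |Inl ` {..<m} \<union> Inr ` (Field r \<times> {..<n}) :: (nat + 'o \<times> nat) set| <o \<mu>"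
    and si: "strongly_indiscernible L M r n f" and b: "b \<in> tuples M m"
    and NATP: "NATP L M"
  obtains \<rho> b' where "dom \<rho> = underS r a" "b' \<in> tuples M m"
    "indiscernible_seq L M r (\<lambda>i. f (concat_node r \<rho> (zeros r i))) (set b')"
    "tp L M b (set (f \<rho>)) = tp L M b' (set (f \<rho>))"
proof (rule ccontr)
  note main = that
  assume no: "\<not> thesis"
  note wo = card_wo[OF card]
  have Fne: "Field r \<noteq> {}" using a by blast
  obtain z where z: "z \<in> Field r" "underS r z = {}" and e: "Map.empty \<in> tree r"
    by (rule empty_node_tree[OF wo Fne])
  define s where "s \<rho> i = f (concat_node r \<rho> (zeros r i))" for \<rho> i
  have fn: "f \<eta> \<in> tuples M n" if "\<eta> \<in> tree r" for \<eta>
    using si that unfolding strongly_indiscernible_def by blast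
  \<comment> \<open>If no such formula existed for \<open>\<rho>\<close>,
    \<open>indiscernible_realization\<close> would produce a forbidden \<open>b'\<close>.\<close>
  have bad: "\<exists>\<psi> I. \<psi> \<in> formulas L \<and> fv \<psi> \<subseteq> {..<m + n} \<and> holds M \<psi> (b @ f \<rho>) \<and> finite I \<and> I \<subseteq> Field r \<and>
      \<not> consistent_on M m \<psi> (s \<rho>) I" if \<rho>: "dom \<rho> = underS r a" for \<rho>
  proof (rule ccontr)
    assume ok: "\<not> ?thesis"
    have s0: "s \<rho> z = f \<rho>" unfolding s_def using concat_zeros_zero[OF card a \<rho> z] by simp
    have sn: "s \<rho> i \<in> tuples M n" if "i \<in> Field r" for i
      unfolding s_def by (rule fn[OF concat_zeros_tree[OF card a \<rho> that]])
    have ind: "indiscernible_seq L M r (s \<rho>) {}"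
      using zeros_indiscernible[OF card a \<rho> si] by (simp add: s_def[abs_def])
    show False
    proof (rule indiscernible_realization[OF sat ne wo card(2) small sn ind b z(1)])
      fix \<phi> I assume "\<phi> \<in> formulas L" "fv \<phi> \<subseteq> {..<m + n}" "holds M \<phi> (b @ s \<rho> z)" "finite I" "I \<subseteq> Field r"
      then have "consistent_on M m \<phi> (s \<rho>) I" using ok s0 by auto
      then show "\<exists>x\<in>tuples M m. \<forall>i\<in>I. holds M \<phi> (x @ s \<rho> i)" by (simp add: consistent_on_def)
    next
      fix b' assume b': "b' \<in> tuples M m" "indiscernible_seq L M r (s \<rho>) (set b')"
        "tp L M b (set (s \<rho> z)) = tp L M b' (set (s \<rho> z))"
      show False using no main[OF \<rho> b'(1)] b'(2,3) s0 by (simp add: s_def[abs_def])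
    qed
  qed
  then obtain \<psi>0 I0 where bad': "\<And>\<rho>. dom \<rho> = underS r a \<Longrightarrow> \<psi>0 \<rho> \<in> formulas L \<and> fv (\<psi>0 \<rho>) \<subseteq> {..<m + n} \<and>
      holds M (\<psi>0 \<rho>) (b @ f \<rho>) \<and> finite (I0 \<rho>) \<and> I0 \<rho> \<subseteq> Field r \<and> \<not> consistent_on M m (\<psi>0 \<rho>) (s \<rho>) (I0 \<rho>)"
    by metis
  \<comment> \<open>Only the size of \<open>I0 \<rho>\<close> enters the colour. The finite subsets
    of \<kappa>' themselves would be too many, and the size suffices because all chains of that
    length have the same type.\<close>
  define col where "col \<rho> = (\<psi>0 \<rho>, card (I0 \<rho>))" for \<rho>
  have col: "col \<rho> \<in> formulas L \<times> (UNIV :: nat set)" if "dom \<rho> = underS r a" for \<rho>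
    using bad'[OF that] by (simp add: col_def)
  obtain c \<nu> where \<nu>: "below r a \<nu>"
    "\<And>\<nu>'. below r a \<nu>' \<Longrightarrow> \<nu> \<subseteq>\<^sub>m \<nu>' \<Longrightarrow> \<exists>\<rho>. dom \<rho> = underS r a \<and> \<nu>' \<subseteq>\<^sub>m \<rho> \<and> col \<rho> = c"
    by (rule dense_colour[OF card a K(2,4), where col = col]) (rule col, assumption, (rule that; blast))
  obtain \<psi> k where c: "c = (\<psi>, k)" by (cases c)
  obtain \<rho> where \<rho>: "dom \<rho> = underS r a" "col \<rho> = c" using \<nu>(2)[OF \<nu>(1) map_le_refl] by blast
  have \<psi>: "\<psi> \<in> formulas L" "fv \<psi> \<subseteq> {..<m + n}" using bad'[OF \<rho>(1)] \<rho>(2) by (auto simp: col_def c)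
  have \<nu>t: "\<nu> \<in> tree r" by (rule below_tree[OF wo \<nu>(1)])
  have limit: "\<exists>c\<in>underS r a. b \<in> underS r c" if b: "b \<in> underS r a" for b
  proof -
    obtain c where "c \<in> underS r a" "b \<noteq> c" "(b, c) \<in> Restr r (underS r a)"
      using infinite_Card_order_limit[OF K(1), unfolded Field_Restr_underS[OF wo], OF K(3) b] by blast
    then show ?thesis by (auto simp: underS_def)
  qed
  define C where "C d \<longleftrightarrow> (\<forall>X. finite X \<and> antichain_list X \<longrightarrow>
    consistent_on M m \<psi> f ((\<lambda>(\<zeta>, i). append_list r Map.empty (\<zeta> @ replicate i False)) ` (X \<times> {..<d})))" for d
  \<comment> \<open>Above \<open>\<nu>\<close> followed by \<open>\<zeta>\<close> there is a
    sequence of length \<kappa> with colour \<open>c\<close>, along which \<open>b\<close> itself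
    satisfies \<open>\<psi>\<close>. Being chains of length 1, these nodes may be exchanged for the
    copy of \<open>X\<close> at the root.\<close>
  have C1: "C 1" unfolding C_def
  proof (intro allI impI, elim conjE)
    fix X :: "bool list set" assume X: "finite X" "antichain_list X"
    have "\<exists>\<rho>. dom \<rho> = underS r a \<and> append_list r \<nu> \<zeta> \<subseteq>\<^sub>m \<rho> \<and> col \<rho> = c" for \<zeta>
      by (rule \<nu>(2)[OF below_append_list[OF card a limit \<nu>(1)] append_list_le[OF card \<nu>t]])
    then obtain g where g: "\<And>\<zeta>. dom (g \<zeta>) = underS r a \<and> append_list r \<nu> \<zeta> \<subseteq>\<^sub>m g \<zeta> \<and> col (g \<zeta>) = c" by metis
    have "chains_above r \<nu> X 1 (\<lambda>\<zeta> i. g \<zeta>)"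
      unfolding chains_above_def tree_def using g a by auto
    moreover have "consistent_on M m \<psi> f ((\<lambda>(\<zeta>, i). g \<zeta>) ` (X \<times> {..<1}))"
    proof -
      have "holds M \<psi> (b @ f (g \<zeta>))" for \<zeta>
        using bad'[of "g \<zeta>"] g[of \<zeta>] by (simp add: col_def c)
      then show ?thesis unfolding consistent_on_def using b by auto
    qed
    ultimately show "consistent_on M m \<psi> f ((\<lambda>(\<zeta>, i). append_list r Map.empty (\<zeta> @ replicate i False)) ` (X \<times> {..<1}))"
      using consistent_on_chains[OF card si \<psi> X \<nu>t _ e chains_above_append_list[OF card e]] by blast
  qed
  \<comment> \<open>The bad indices of \<open>\<rho>\<close> give \<open>k\<close> nodes on one
    chain; consistency along the chain of \<open>k\<close> zeros at the root would transfer to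
    them.\<close>
  have Ck: "\<not> C k"
  proof
    assume "C k"
    then have cons: "consistent_on M m \<psi> f
        ((\<lambda>(\<zeta>, i). append_list r Map.empty (\<zeta> @ replicate i False)) ` ({[]} \<times> {..<k}))"
      unfolding C_def using antichain_singleton by (metis finite.emptyI finite_insert)
    have I: "finite (I0 \<rho>)" "I0 \<rho> \<subseteq> Field r" "\<not> consistent_on M m \<psi> (s \<rho>) (I0 \<rho>)" "card (I0 \<rho>) = k"
      using bad'[OF \<rho>(1)] \<rho>(2) by (auto simp: col_def c)
    obtain l where l: "set l = I0 \<rho>" "length l = card (I0 \<rho>)" "ascending r l"
      by (rule ascending_enumeration[OF wo I(1,2)])
    have ch: "chains_above r Map.empty {[]} k (\<lambda>_ i. concat_node r \<rho> (zeros r (l ! i)))"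
      using strict_chain_above[OF card a \<rho>(1) _ l(3)] l(1,2) I(2,4) by simp
    have "finite {[] :: bool list}" by simp
    from consistent_on_chains[OF card si \<psi> this antichain_singleton e chains_above_append_list[OF card e] e ch cons]
    have "\<exists>x\<in>tuples M m. \<forall>i<k. holds M \<psi> (x @ s \<rho> (l ! i))"
      unfolding consistent_on_def s_def by auto
    then obtain x where x: "x \<in> tuples M m" "\<forall>i<k. holds M \<psi> (x @ s \<rho> (l ! i))" by (elim bexE)
    have "holds M \<psi> (x @ s \<rho> i)" if "i \<in> I0 \<rho>" for i
      using x(2) that l(1,2) I(4) by (metis in_set_conv_nth)
    then show False using I(3) x(1) unfolding consistent_on_def by blast
  qed
  have "\<not> NATP L M"
    by (rule chain_inconsistency_imp_ATP[OF card ne si \<psi> e C1[unfolded C_def] Ck[unfolded C_def]])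
  then show False using NATP by blast
qed

section \<open>Strongly indiscernible trees from ATP\<close>

text \<open>The blocks of \<open>k\<close> ones and a zero form a prefix-free code. Sequences of
  natural numbers thus embed into binary ones with respect to the prefix relation, which is all that
  ATP refers to.\<close>

definition unary :: "nat list \<Rightarrow> bool list" where
  "unary xs = concat (map (\<lambda>k. replicate k True @ [False]) xs)"

lemma prefix_block: "prefix (replicate k True @ False # u) (replicate l True @ False # v) \<longleftrightarrow> k = l \<and> prefix u v"
proof (induction k arbitrary: l)
  case 0
  then show ?case by (cases l) auto
next
  case (Suc k)
  then show ?case by (cases l) auto
qed

lemma prefix_unary_iff: "prefix (unary xs) (unary ys) \<longleftrightarrow> prefix xs ys"
proof (induction xs arbitrary: ys)
  case (Cons x xs)
  then show ?case by (cases ys) (auto simp: unary_def prefix_block)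
qed (simp add: unary_def)

definition node_of_list :: "bool list \<Rightarrow> nat node" where
  "node_of_list s = (\<lambda>i. if i < length s then Some (s ! i) else None)"

lemma node_of_list_tree: "node_of_list s \<in> tree natLeq"
proof -
  have "dom (node_of_list s) = {..<length s}" by (auto simp: node_of_list_def split: if_splits)
  moreover have "underS natLeq (length s) = {..<length s}" by (auto simp: underS_def natLeq_def)
  moreover have "length s \<in> Field natLeq" by (simp add: Field_natLeq)
  ultimately show ?thesis unfolding tree_def by blast
qed

lemma list_of_node_of_list: "list_of_node (node_of_list s) = s"
proof -
  have "dom (node_of_list s) = {..<length s}" by (auto simp: node_of_list_def split: if_splits)
  then show ?thesis by (auto simp: list_of_node_def node_of_list_def intro: nth_equalityI)
qed

lemma node_of_list_le_iff: "node_of_list s \<subseteq>\<^sub>m node_of_list t \<longleftrightarrow> prefix s t"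
  using prefix_list_of_node[OF node_of_list_tree node_of_list_tree] by (simp add: list_of_node_of_list)

text \<open>Compactness for the entries of the tree, with three kinds of conditions: consistency
  along finite antichains, inconsistency of comparable pairs, and indiscernibility. Finitely many of
  them concern finitely many nodes, for which \<open>tree_ramsey\<close> finds a copy among the
  sequences of numbers. The copy preserves the prefix relation, so it inherits the first two kinds
  from ATP; homogeneity gives the third.\<close>

lemma strongly_indiscernible_ATP_tree:
  fixes M :: "('f, 'r, 'a) struct" and r :: "'o rel" and \<mu> :: "'l rel"
  assumes card: "Card_order r" "infinite (Field r)"
    and sat: "saturated L M \<mu>" and ne: "univ M \<noteq> {}" and small: "|tree r \<times> {..<n}| <o \<mu>"
    and \<phi>: "\<phi> \<in> formulas L" "fv \<phi> \<subseteq> {..<m + n}" and ATP: "formula_ATP M m n \<phi>"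
  obtains a where "strongly_indiscernible L M r n a"
    "\<And>X. finite X \<Longrightarrow> X \<subseteq> tree r \<Longrightarrow> (\<forall>\<eta>\<in>X. \<forall>\<nu>\<in>X. \<eta> \<noteq> \<nu> \<longrightarrow> incomparable \<eta> \<nu>) \<Longrightarrow> consistent_on M m \<phi> a X"
    "\<And>\<eta> \<nu>. \<eta> \<in> tree r \<Longrightarrow> \<nu> \<in> tree r \<Longrightarrow> \<eta> \<subseteq>\<^sub>m \<nu> \<Longrightarrow> \<eta> \<noteq> \<nu> \<Longrightarrow> \<not> consistent_on M m \<phi> a {\<eta>, \<nu>}"
proof -
  note wo = card_wo[OF card]
  from ATP[unfolded formula_ATP_def] obtain c where
    c: "\<forall>\<eta>\<in>tree natLeq. c \<eta> \<in> tuples M n"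
    and cX: "\<forall>X\<subseteq>tree natLeq. (\<forall>\<eta>\<in>X. \<forall>\<nu>\<in>X. \<eta> \<noteq> \<nu> \<longrightarrow> incomparable \<eta> \<nu>) \<longrightarrow>
           consistent M m {(\<phi>, c \<eta>) |\<eta>. \<eta> \<in> X}"
    and cP: "\<forall>\<eta>\<in>tree natLeq. \<forall>\<nu>\<in>tree natLeq. \<eta> \<subseteq>\<^sub>m \<nu> \<and> \<eta> \<noteq> \<nu> \<longrightarrow>
           \<not> consistent M m {(\<phi>, c \<eta>), (\<phi>, c \<nu>)}"
    by (elim exE conjE)
  \<comment> \<open>The witness of ATP, read as a family indexed by sequences of natural
    numbers.\<close>
  define d where "d xs = c (node_of_list (unary xs))" for xs
  have d: "d xs \<in> tuples M n" for xs unfolding d_def using c node_of_list_tree by blast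
  have dX: "consistent_on M m \<phi> d Y" if Y: "finite Y" "\<forall>xs\<in>Y. \<forall>ys\<in>Y. prefix xs ys \<longrightarrow> xs = ys" for Y
  proof -
    let ?N = "(\<lambda>xs. node_of_list (unary xs)) ` Y"
    have "\<forall>\<eta>\<in>?N. \<forall>\<nu>\<in>?N. \<eta> \<noteq> \<nu> \<longrightarrow> incomparable \<eta> \<nu>"
    proof (intro ballI impI)
      fix \<eta> \<nu> assume "\<eta> \<in> ?N" "\<nu> \<in> ?N" "\<eta> \<noteq> \<nu>"
      then obtain xs ys where "xs \<in> Y" "ys \<in> Y" "\<eta> = node_of_list (unary xs)" "\<nu> = node_of_list (unary ys)" "xs \<noteq> ys" by auto
      then show "incomparable \<eta> \<nu>"
        using Y(2) unfolding incomparable_def by (simp add: node_of_list_le_iff prefix_unary_iff) metis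
    qed
    then have cons: "consistent M m {(\<phi>, c \<eta>) |\<eta>. \<eta> \<in> ?N}"
      using cX[rule_format, of ?N] node_of_list_tree by blast
    have eq: "{(\<phi>, c \<eta>) |\<eta>. \<eta> \<in> ?N} = (\<lambda>xs. (\<phi>, d xs)) ` Y" by (auto simp: d_def)
    have "\<exists>x\<in>tuples M m. realizes M x ((\<lambda>xs. (\<phi>, d xs)) ` Y)"
      by (rule cons[unfolded eq consistent_def, rule_format, OF order_refl]) (simp add: Y(1))
    then obtain x where "x \<in> tuples M m" "realizes M x ((\<lambda>xs. (\<phi>, d xs)) ` Y)"
      by (elim bexE)
    then show ?thesis unfolding consistent_on_def realizes_def by auto
  qed
  have dP: "\<not> consistent_on M m \<phi> d {xs, ys}" if p: "prefix xs ys" "xs \<noteq> ys" for xs ys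
  proof
    assume "consistent_on M m \<phi> d {xs, ys}"
    then obtain x where x: "x \<in> tuples M m" "holds M \<phi> (x @ d xs)" "holds M \<phi> (x @ d ys)"
      unfolding consistent_on_def by auto
    have "realizes M x q" if "q \<subseteq> {(\<phi>, d xs), (\<phi>, d ys)}" for q
      using x(2,3) that unfolding realizes_def by auto
    then have "consistent M m {(\<phi>, d xs), (\<phi>, d ys)}" unfolding consistent_def using x(1) by blast
    moreover have "node_of_list (unary xs) \<subseteq>\<^sub>m node_of_list (unary ys)"
      "\<not> node_of_list (unary ys) \<subseteq>\<^sub>m node_of_list (unary xs)"
      using p prefix_order.antisym by (auto simp: node_of_list_le_iff prefix_unary_iff)
    ultimately show False using cP node_of_list_tree unfolding d_def by (metis map_le_refl)
  qed
  define tup where "tup g \<eta> = map (\<lambda>j. g (\<eta>, j)) [0..<n]" for g :: "'o node \<times> nat \<Rightarrow> 'a" and \<eta>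
  define inc where "inc X \<longleftrightarrow> (\<forall>\<eta>\<in>X. \<forall>\<nu>\<in>X. \<eta> \<noteq> \<nu> \<longrightarrow> incomparable \<eta> \<nu>)" for X :: "'o node set"
  define CA where "CA = {X. finite X \<and> X \<subseteq> tree r \<and> inc X}"
  define CB where "CB = {X. \<exists>\<eta>\<in>tree r. \<exists>\<nu>\<in>tree r. \<eta> \<subseteq>\<^sub>m \<nu> \<and> \<eta> \<noteq> \<nu> \<and> X = {\<eta>, \<nu>}}"
  define CC where "CC = {(\<theta>, J, J'). \<theta> \<in> formulas L \<and> fv \<theta> \<subseteq> {..<length J * n} \<and> set J \<subseteq> tree r \<and> set J' \<subseteq> tree r \<and>
    length J = length J' \<and> qf_tp L0 (tree_struct r) J = qf_tp L0 (tree_struct r) J'}"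
  define P where "P s g = (case s of Inl X \<Rightarrow> consistent_on M m \<phi> (tup g) X
     | Inr (Inl X) \<Rightarrow> \<not> consistent_on M m \<phi> (tup g) X
     | Inr (Inr (\<theta>, J, J')) \<Rightarrow> holds M \<theta> (concat (map (tup g) J)) = holds M \<theta> (concat (map (tup g) J')))"
    for s :: "'o node set + 'o node set + ('f, 'r) fm \<times> 'o node list \<times> 'o node list" and g
  define C where "C = Inl ` CA \<union> Inr ` Inl ` CB \<union> Inr ` Inr ` CC"
  have C_cases: "(\<And>X. s = Inl X \<Longrightarrow> X \<in> CA \<Longrightarrow> thesis) \<Longrightarrow> (\<And>X. s = Inr (Inl X) \<Longrightarrow> X \<in> CB \<Longrightarrow> thesis) \<Longrightarrow>
    (\<And>\<theta> J J'. s = Inr (Inr (\<theta>, J, J')) \<Longrightarrow> (\<theta>, J, J') \<in> CC \<Longrightarrow> thesis) \<Longrightarrow> thesis" if "s \<in> C" for s thesis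
    using that unfolding C_def by auto
  let ?V = "tree r \<times> {..<n}"
  have tup_map: "concat (map (tup g) J) = map g (concat (map (\<lambda>\<eta>. map (Pair \<eta>) [0..<n]) J))" for g J
    by (simp add: map_concat tup_def[abs_def] comp_def)
  have tup_len: "length (concat (map (tup g) J)) = length J * n" for g J
    by (induction J) (simp_all add: tup_def)
  have defP: "definable L M ?V (P s)" if s: "s \<in> C" for s
  proof (rule C_cases[OF s])
    fix X assume X: "s = Inl X" "X \<in> CA"
    have "definable L M (X \<times> {..<n}) (\<lambda>g. consistent_on M m \<phi> (tup g) X)"
      unfolding tup_def by (rule definable_consistent_on[OF \<phi>]) (use X in \<open>simp add: CA_def\<close>)
    then show ?thesis unfolding P_def X(1) sum.case
      by (rule definable_mono) (use X(2) in \<open>auto simp: CA_def\<close>)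
  next
    fix X assume X: "s = Inr (Inl X)" "X \<in> CB"
    have "definable L M (X \<times> {..<n}) (\<lambda>g. consistent_on M m \<phi> (tup g) X)"
      unfolding tup_def by (rule definable_consistent_on[OF \<phi>]) (use X in \<open>auto simp: CB_def\<close>)
    then have "definable L M (X \<times> {..<n}) (\<lambda>g. \<not> consistent_on M m \<phi> (tup g) X)" by (rule definable_not)
    then show ?thesis unfolding P_def X(1) sum.case
      by (rule definable_mono) (use X(2) in \<open>auto simp: CB_def\<close>)
  next
    fix \<theta> J J' assume X: "s = Inr (Inr (\<theta>, J, J'))" "(\<theta>, J, J') \<in> CC"
    have "definable L M ?V (\<lambda>g. holds M \<theta> (concat (map (tup g) K)))" if K: "K = J \<or> K = J'" for K
    proof -
      have len: "length (concat (map (\<lambda>\<eta>. map (Pair \<eta>) [0..<n]) K)) = length K * n"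
        by (induction K) simp_all
      have "definable L M (set (concat (map (\<lambda>\<eta>. map (Pair \<eta>) [0..<n]) K))) (\<lambda>g. holds M \<theta> (concat (map (tup g) K)))"
        unfolding tup_map by (rule definable_holds) (use X(2) K len in \<open>auto simp: CC_def\<close>)
      then show ?thesis by (rule definable_mono) (use X(2) K in \<open>auto simp: CC_def\<close>)
    qed
    then show ?thesis unfolding P_def X(1) sum.case prod.case by (intro definable_iff) auto
  qed
  have fs: "\<exists>g. (\<forall>v\<in>?V. g v \<in> univ M) \<and> (\<forall>v\<in>{}. g v = undefined v) \<and> (\<forall>s\<in>S0. P s g)"
    if S0: "S0 \<subseteq> C" "finite S0" for S0
  proof -
    define nodes where "nodes s = (case s of Inl X \<Rightarrow> X | Inr (Inl X) \<Rightarrow> X | Inr (Inr (\<theta>, J, J')) \<Rightarrow> set J \<union> set J')"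
      for s :: "'o node set + 'o node set + ('f, 'r) fm \<times> 'o node list \<times> 'o node list"
    define A0 where "A0 = (\<Union>s\<in>S0. nodes s)"
    have nodes: "finite (nodes s) \<and> nodes s \<subseteq> tree r" if s: "s \<in> C" for s
      by (rule C_cases[OF s]) (auto simp: nodes_def CA_def CB_def CC_def)
    have A0: "finite A0" "A0 \<subseteq> tree r" unfolding A0_def using S0 nodes by blast+
    \<comment> \<open>Closing under meets puts the substructures generated by the tuples inside
      \<open>A\<close>, as \<open>qf_tp_eq_positions\<close> requires.\<close>
    define A where "A = (\<lambda>(a, b). meet r a b) ` (A0 \<times> A0)"
    note A = meet_closure[OF wo A0(2), folded A_def]
    have "finite A" unfolding A_def using A0(1) by simp
    define N where "N = card A"
    have "\<exists>e. bij_betw e {..<card A} A \<and> (\<forall>i j. i < card A \<longrightarrow> j < card A \<longrightarrow> lex r (e i) (e j) = (i \<le> j))"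
    proof (rule lex_enumeration[OF wo \<open>finite A\<close> A(2)])
      fix e assume "bij_betw e {..<card A} A" "\<And>i j. i < card A \<Longrightarrow> j < card A \<Longrightarrow> lex r (e i) (e j) \<longleftrightarrow> i \<le> j"
      then show ?thesis by (intro exI[of _ e]) simp
    qed
    then obtain e where e0: "bij_betw e {..<card A} A"
      "\<forall>i j. i < card A \<longrightarrow> j < card A \<longrightarrow> lex r (e i) (e j) = (i \<le> j)"
      by (elim exE conjE)
    have e: "bij_betw e {..<N} A" "\<And>i j. i < N \<Longrightarrow> j < N \<Longrightarrow> lex r (e i) (e j) \<longleftrightarrow> i \<le> j"
      using e0 by (simp_all add: N_def)
    define R where "R = (\<lambda>i j. i < N \<and> j < N \<and> e i \<subseteq>\<^sub>m e j)"
    have R: "dfs N R" unfolding R_def by (rule dfs_lex_enumeration[OF wo e(1) A(2) e(2)])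
    define S where "S = {x. Inr (Inr x) \<in> S0}"
    have "finite ((\<lambda>x. Inr (Inr x)) -` S0)" by (rule finite_vimageI[OF S0(2)]) (auto intro: injI)
    then have S_fin: "finite S" by (simp add: S_def vimage_def)
    have S_CC: "x \<in> CC" if "x \<in> S" for x using that S0(1) by (auto simp: S_def C_def)
    have S_A: "set J \<subseteq> A" "set J' \<subseteq> A" if "(\<theta>, J, J') \<in> S" for \<theta> J J'
    proof -
      have "nodes (Inr (Inr (\<theta>, J, J'))) \<subseteq> A0" using that unfolding A0_def S_def by blast
      then show "set J \<subseteq> A" "set J' \<subseteq> A" using A(1) by (auto simp: nodes_def)
    qed
    define G where "G x y = (case x of (\<theta>, J, J') \<Rightarrow> case y of (q, t, t', js) \<Rightarrow>
      strict_mono_on {..<q} t \<and> t ` {..<q} \<subseteq> {..<N} \<and> meet_closed R q t \<and>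
      strict_mono_on {..<q} t' \<and> t' ` {..<q} \<subseteq> {..<N} \<and> meet_closed R q t' \<and>
      pull_back R q t = pull_back R q t' \<and> set js \<subseteq> {..<q} \<and>
      J = map (\<lambda>j. e (t j)) js \<and> J' = map (\<lambda>j. e (t' j)) js)"
      for x :: "('f, 'r) fm \<times> 'o node list \<times> 'o node list" and y :: "nat \<times> (nat \<Rightarrow> nat) \<times> (nat \<Rightarrow> nat) \<times> nat list"
    have "\<exists>y. G x y" if x: "x \<in> S" for x
    proof -
      obtain \<theta> J J' where xe: "x = (\<theta>, J, J')" by (cases x)
      have J: "set J \<subseteq> A" "set J' \<subseteq> A" "length J = length J'"
          "qf_tp L0 (tree_struct r) J = qf_tp L0 (tree_struct r) J'"
        using S_A[of \<theta> J J'] S_CC[of x] x by (auto simp: xe CC_def)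
      show ?thesis
      proof (rule qf_tp_eq_positions[OF wo A(2,3) e J], assumption, assumption)
        fix q t t' js assume "strict_mono_on {..<q} t" "t ` {..<q} \<subseteq> {..<N}"
          "meet_closed (\<lambda>i j. i < N \<and> j < N \<and> e i \<subseteq>\<^sub>m e j) q t"
          "strict_mono_on {..<q} t'" "t' ` {..<q} \<subseteq> {..<N}"
          "meet_closed (\<lambda>i j. i < N \<and> j < N \<and> e i \<subseteq>\<^sub>m e j) q t'"
          "pull_back (\<lambda>i j. i < N \<and> j < N \<and> e i \<subseteq>\<^sub>m e j) q t = pull_back (\<lambda>i j. i < N \<and> j < N \<and> e i \<subseteq>\<^sub>m e j) q t'"
          "set js \<subseteq> {..<q}" "J = map (\<lambda>j. e (t j)) js" "J' = map (\<lambda>j. e (t' j)) js"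
        then have "G x (q, t, t', js)" unfolding G_def xe prod.case R_def by blast
        then show "\<exists>y. G x y" by blast
      qed simp_all
    qed
    then obtain y where y: "\<And>x. x \<in> S \<Longrightarrow> G x (y x)" by metis
    define q where "q x = fst (y x)" for x
    define t where "t x = fst (snd (y x))" for x
    define t' where "t' x = fst (snd (snd (y x)))" for x
    define js where "js x = snd (snd (snd (y x)))" for x
    have G: "strict_mono_on {..<q x} (t x) \<and> t x ` {..<q x} \<subseteq> {..<N} \<and> meet_closed R (q x) (t x)"
      "strict_mono_on {..<q x} (t' x) \<and> t' x ` {..<q x} \<subseteq> {..<N} \<and> meet_closed R (q x) (t' x)"
      "pull_back R (q x) (t x) = pull_back R (q x) (t' x)" "set (js x) \<subseteq> {..<q x}"
      "fst (snd x) = map (\<lambda>j. e (t x j)) (js x)" "snd (snd x) = map (\<lambda>j. e (t' x j)) (js x)" if "x \<in> S" for x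
      using y[OF that] unfolding G_def q_def t_def t'_def js_def by (simp_all add: split_beta)
    \<comment> \<open>The colour of a tuple of sequences is the truth value of the formula of the
      condition at their parameters; both sides of the condition will receive the same
      colour.\<close>
    define \<chi> where "\<chi> x l = holds M (fst x) (concat (map d l))" for x :: "('f, 'r) fm \<times> 'o node list \<times> 'o node list" and l
    have "\<exists>F. (\<forall>i<N. \<forall>j<N. prefix (F i) (F j) \<longleftrightarrow> R i j) \<and>
      (\<forall>x\<in>S. \<chi> x (map (\<lambda>j. F (t x j)) (js x)) = \<chi> x (map (\<lambda>j. F (t' x j)) (js x)))"
    proof (rule tree_ramsey[where \<chi> = \<chi>, OF R S_fin G(1) G(2) G(3) G(4)])
      fix F assume "\<And>i j. i < N \<Longrightarrow> j < N \<Longrightarrow> prefix (F i) (F j) \<longleftrightarrow> R i j"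
        "\<And>x. x \<in> S \<Longrightarrow> \<chi> x (map (\<lambda>j. F (t x j)) (js x)) = \<chi> x (map (\<lambda>j. F (t' x j)) (js x))"
      then show ?thesis by (intro exI[of _ F]) simp
    qed
    then obtain F where F: "\<forall>i<N. \<forall>j<N. prefix (F i) (F j) \<longleftrightarrow> R i j"
      "\<forall>x\<in>S. \<chi> x (map (\<lambda>j. F (t x j)) (js x)) = \<chi> x (map (\<lambda>j. F (t' x j)) (js x))" by (elim exE conjE)
    define ix where "ix \<eta> = inv_into {..<N} e \<eta>" for \<eta>
    have ix: "ix \<eta> < N" "e (ix \<eta>) = \<eta>" if "\<eta> \<in> A" for \<eta>
    proof -
      have "\<eta> \<in> e ` {..<N}" using that e(1) by (simp add: bij_betw_def)
      from inv_into_into[OF this] f_inv_into_f[OF this] show "ix \<eta> < N" "e (ix \<eta>) = \<eta>" by (simp_all add: ix_def)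
    qed
    have ix_e: "ix (e i) = i" if "i < N" for i
      unfolding ix_def by (rule inv_into_f_f) (use e(1) that in \<open>auto simp: bij_betw_def\<close>)
    \<comment> \<open>Each node of \<open>A\<close> gets the parameter at its copy. Off
      \<open>A\<close> the index \<open>ix\<close> is arbitrary, but every value of \<open>d\<close>
      is a tuple of \<open>M\<close>, so the entries stay in the universe.\<close>
    define g where "g = (\<lambda>(\<eta>, j). d (F (ix \<eta>)) ! j)"
    have tup_g: "tup g \<eta> = d (F (ix \<eta>))" for \<eta>
      using map_nth[of "d (F (ix \<eta>))"] d[of "F (ix \<eta>)"] by (simp add: tup_def g_def tuples_iff)
    have le: "prefix (F (ix \<eta>)) (F (ix \<nu>)) \<longleftrightarrow> \<eta> \<subseteq>\<^sub>m \<nu>" if "\<eta> \<in> A" "\<nu> \<in> A" for \<eta> \<nu>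
      using F(1) ix[OF that(1)] ix[OF that(2)] by (simp add: R_def)
    have cons: "consistent_on M m \<phi> (tup g) X \<longleftrightarrow> consistent_on M m \<phi> d ((\<lambda>\<eta>. F (ix \<eta>)) ` X)" for X
      unfolding consistent_on_def by (simp add: tup_g)
    have X_A: "nodes s \<subseteq> A" if "s \<in> S0" for s using that A(1) unfolding A0_def by blast
    have "P s g" if s: "s \<in> S0" for s
    proof (rule C_cases[OF subsetD[OF S0(1) s]])
      fix X assume X: "s = Inl X" "X \<in> CA"
      have XA: "X \<subseteq> A" using X_A[OF s] by (simp add: X(1) nodes_def)
      have "consistent_on M m \<phi> d ((\<lambda>\<eta>. F (ix \<eta>)) ` X)"
      proof (rule dX)
        show "finite ((\<lambda>\<eta>. F (ix \<eta>)) ` X)" using X(2) by (simp add: CA_def)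
        show "\<forall>xs\<in>(\<lambda>\<eta>. F (ix \<eta>)) ` X. \<forall>ys\<in>(\<lambda>\<eta>. F (ix \<eta>)) ` X. prefix xs ys \<longrightarrow> xs = ys"
        proof (intro ballI impI)
          fix xs ys assume "xs \<in> (\<lambda>\<eta>. F (ix \<eta>)) ` X" "ys \<in> (\<lambda>\<eta>. F (ix \<eta>)) ` X" and p: "prefix xs ys"
          then obtain \<eta> \<nu> where h: "\<eta> \<in> X" "\<nu> \<in> X" "xs = F (ix \<eta>)" "ys = F (ix \<nu>)" by blast
          then have "\<eta> \<subseteq>\<^sub>m \<nu>" using p le XA by blast
          then have "\<eta> = \<nu>" using X(2) h(1,2) unfolding CA_def inc_def incomparable_def by blast
          then show "xs = ys" using h by simp
        qed
      qed
      then show ?thesis unfolding P_def X(1) sum.case cons .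
    next
      fix X assume X: "s = Inr (Inl X)" "X \<in> CB"
      then obtain \<eta> \<nu> where h: "\<eta> \<subseteq>\<^sub>m \<nu>" "\<eta> \<noteq> \<nu>" "X = {\<eta>, \<nu>}" unfolding CB_def by blast
      have XA: "\<eta> \<in> A" "\<nu> \<in> A" using X_A[OF s] by (simp_all add: X(1) h(3) nodes_def)
      have "F (ix \<eta>) \<noteq> F (ix \<nu>)"
        using le[OF XA(2,1)] h(1,2) map_le_antisym by auto
      then have "\<not> consistent_on M m \<phi> d {F (ix \<eta>), F (ix \<nu>)}" using dP le[OF XA] h(1) by blast
      then show ?thesis unfolding P_def X(1) sum.case cons h(3) by simp
    next
      fix \<theta> J J' assume X: "s = Inr (Inr (\<theta>, J, J'))"
      define x where "x = (\<theta>, J, J')"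
      have x: "x \<in> S" using s by (simp add: S_def X x_def)
      have maps: "map (tup g) (map (\<lambda>j. e (u j)) (js x)) = map d (map (\<lambda>j. F (u j)) (js x))"
        if "u ` {..<q x} \<subseteq> {..<N}" for u
        using that G(4)[OF x] by (auto simp: tup_g ix_e image_subset_iff subset_iff)
      have JJ: "J = map (\<lambda>j. e (t x j)) (js x)" "J' = map (\<lambda>j. e (t' x j)) (js x)"
        using G(5,6)[OF x] by (simp_all add: x_def)
      have "map (tup g) J = map d (map (\<lambda>j. F (t x j)) (js x))"
        unfolding JJ(1) using G(1)[OF x] by (intro maps) blast
      moreover have "map (tup g) J' = map d (map (\<lambda>j. F (t' x j)) (js x))"
        unfolding JJ(2) using G(2)[OF x] by (intro maps) blast
      ultimately show ?thesis unfolding P_def X sum.case prod.case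
        using bspec[OF F(2) x] by (simp only: \<chi>_def x_def fst_conv)
    qed
    moreover have "g v \<in> univ M" if "v \<in> ?V" for v
    proof -
      obtain \<eta> j where "v = (\<eta>, j)" "j < n" using \<open>v \<in> ?V\<close> by blast
      then show ?thesis using nth_mem[of j "d (F (ix \<eta>))"] d[of "F (ix \<eta>)"] by (simp add: tuples_iff g_def subset_iff)
    qed
    ultimately show ?thesis by (intro exI[of _ g] conjI ballI) simp_all
  qed
  have "\<exists>g. (\<forall>v\<in>?V. g v \<in> univ M) \<and> (\<forall>s\<in>C. P s g)"
  proof (rule saturated_realizes[where S = C and P = P and I = ?V and J = "{}" and ?g0.0 = undefined,
        OF defP sat ne small _ fs])
    fix g assume "\<And>v. v \<in> ?V \<Longrightarrow> g v \<in> univ M" "\<And>s. s \<in> C \<Longrightarrow> P s g"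
    then show ?thesis by (intro exI[of _ g] conjI ballI)
  qed simp_all
  then obtain g where g: "\<forall>v\<in>?V. g v \<in> univ M" "\<forall>s\<in>C. P s g" by (elim exE conjE)
  show thesis
  proof (rule that[of "tup g"])
    show "strongly_indiscernible L M r n (tup g)" unfolding strongly_indiscernible_def
    proof (intro conjI ballI impI)
      show "tup g \<eta> \<in> tuples M n" if "\<eta> \<in> tree r" for \<eta> using g(1) that by (auto simp: tup_def tuples_iff)
      fix J J' assume J0: "J \<in> lists (tree r)" "J' \<in> lists (tree r)"
        and same: "length J = length J' \<and> qf_tp L0 (tree_struct r) J = qf_tp L0 (tree_struct r) J'"
      note J = J0 conjunct1[OF same] conjunct2[OF same]
      show "tp L M (concat (map (tup g) J)) {} = tp L M (concat (map (tup g) J')) {}"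
      proof (rule tp_empty_eqI)
        show "length (concat (map (tup g) J)) = length (concat (map (tup g) J'))" unfolding tup_len J(3) ..
        fix \<theta> assume "\<theta> \<in> formulas L" "fv \<theta> \<subseteq> {..<length (concat (map (tup g) J))}"
        then have "(\<theta>, J, J') \<in> CC" using J by (auto simp: CC_def tup_len)
        then have "Inr (Inr (\<theta>, J, J')) \<in> C" by (simp add: C_def)
        from bspec[OF g(2) this] show "holds M \<theta> (concat (map (tup g) J)) = holds M \<theta> (concat (map (tup g) J'))"
          unfolding P_def sum.case prod.case .
      qed
    qed
    fix X :: "'o node set" assume "finite X" "X \<subseteq> tree r" "\<forall>\<eta>\<in>X. \<forall>\<nu>\<in>X. \<eta> \<noteq> \<nu> \<longrightarrow> incomparable \<eta> \<nu>"
    then have "Inl X \<in> C" by (simp add: C_def CA_def inc_def)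
    from bspec[OF g(2) this] show "consistent_on M m \<phi> (tup g) X" unfolding P_def sum.case .
  next
    fix \<eta> \<nu> :: "'o node" assume "\<eta> \<in> tree r" "\<nu> \<in> tree r" "\<eta> \<subseteq>\<^sub>m \<nu>" "\<eta> \<noteq> \<nu>"
    then have "Inr (Inl {\<eta>, \<nu>}) \<in> C" unfolding C_def CB_def by blast
    from bspec[OF g(2) this] show "\<not> consistent_on M m \<phi> (tup g) {\<eta>, \<nu>}" unfolding P_def sum.case .
  qed
qed

lemma realization_imp_NATP:
  fixes M :: "('f, 'r, 'a) struct" and r :: "'o rel" and \<mu> :: "'l rel"
  assumes card: "Card_order r" "infinite (Field r)" and a: "a \<in> Field r"
    and sat: "saturated L M \<mu>" and ne: "univ M \<noteq> {}" and small: "\<And>n. |tree r \<times> {..<n::nat}| <o \<mu>"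
    and real: "\<And>n f b. strongly_indiscernible L M r n f \<Longrightarrow> b \<in> lists (univ M) \<Longrightarrow>
      \<exists>\<rho> b'. dom \<rho> = underS r a \<and> b' \<in> tuples M (length b) \<and>
        indiscernible_seq L M r (\<lambda>i. f (concat_node r \<rho> (zeros r i))) (set b') \<and>
        tp L M b (set (f \<rho>)) = tp L M b' (set (f \<rho>))"
  shows "NATP L M"
proof (rule ccontr)
  assume "\<not> NATP L M"
  then obtain m n \<phi> where \<phi>: "\<phi> \<in> formulas L" "fv \<phi> \<subseteq> {..<m + n}" and ATP: "formula_ATP M m n \<phi>"
    unfolding NATP_def not_not by (elim exE bexE conjE)
  note wo = card_wo[OF card]
  have "\<exists>f. strongly_indiscernible L M r n f \<and>
    (\<forall>X. finite X \<longrightarrow> X \<subseteq> tree r \<longrightarrow> (\<forall>\<eta>\<in>X. \<forall>\<nu>\<in>X. \<eta> \<noteq> \<nu> \<longrightarrow> incomparable \<eta> \<nu>) \<longrightarrow> consistent_on M m \<phi> f X) \<and>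
    (\<forall>\<eta> \<nu>. \<eta> \<in> tree r \<longrightarrow> \<nu> \<in> tree r \<longrightarrow> \<eta> \<subseteq>\<^sub>m \<nu> \<longrightarrow> \<eta> \<noteq> \<nu> \<longrightarrow> \<not> consistent_on M m \<phi> f {\<eta>, \<nu>})"
  proof (rule strongly_indiscernible_ATP_tree[OF card sat ne small \<phi> ATP])
    fix f assume "strongly_indiscernible L M r n f"
      "\<And>X. finite X \<Longrightarrow> X \<subseteq> tree r \<Longrightarrow> (\<forall>\<eta>\<in>X. \<forall>\<nu>\<in>X. \<eta> \<noteq> \<nu> \<longrightarrow> incomparable \<eta> \<nu>) \<Longrightarrow> consistent_on M m \<phi> f X"
      "\<And>\<eta> \<nu>. \<eta> \<in> tree r \<Longrightarrow> \<nu> \<in> tree r \<Longrightarrow> \<eta> \<subseteq>\<^sub>m \<nu> \<Longrightarrow> \<eta> \<noteq> \<nu> \<Longrightarrow> \<not> consistent_on M m \<phi> f {\<eta>, \<nu>}"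
    then show ?thesis by (intro exI[of _ f] conjI allI impI)
  qed
  then obtain f where si: "strongly_indiscernible L M r n f"
    and cons: "\<forall>X. finite X \<longrightarrow> X \<subseteq> tree r \<longrightarrow> (\<forall>\<eta>\<in>X. \<forall>\<nu>\<in>X. \<eta> \<noteq> \<nu> \<longrightarrow> incomparable \<eta> \<nu>) \<longrightarrow> consistent_on M m \<phi> f X"
    and incons: "\<forall>\<eta> \<nu>. \<eta> \<in> tree r \<longrightarrow> \<nu> \<in> tree r \<longrightarrow> \<eta> \<subseteq>\<^sub>m \<nu> \<longrightarrow> \<eta> \<noteq> \<nu> \<longrightarrow> \<not> consistent_on M m \<phi> f {\<eta>, \<nu>}"
    by (elim exE conjE)
  have f: "f \<eta> \<in> tuples M n" if "\<eta> \<in> tree r" for \<eta>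
    using si that unfolding strongly_indiscernible_def by blast
  \<comment> \<open>Sequences of equal length are comparable only if equal, so this level is an
    antichain. Finite consistency and saturation give one \<open>b\<close> for the whole level,
    before \<rho> is chosen by the assumption.\<close>
  define B where "B = {\<rho> :: 'o node. dom \<rho> = underS r a}"
  have B: "B \<subseteq> tree r" unfolding B_def tree_def using a by blast
  define p where "p = (\<lambda>\<rho>. (\<phi>, f \<rho>)) ` B"
  define A where "A = (\<Union>\<rho>\<in>B. set (f \<rho>))"
  have "A \<subseteq> univ M" unfolding A_def using f B by (auto simp: tuples_iff)
  moreover have "|A| <o \<mu>"
  proof -
    have "A \<subseteq> (\<lambda>(\<eta>, j). f \<eta> ! j) ` (tree r \<times> {..<n})"
    proof
      fix x assume "x \<in> A"
      then obtain \<rho> where \<rho>: "\<rho> \<in> B" "x \<in> set (f \<rho>)" unfolding A_def by blast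
      then obtain j where "j < length (f \<rho>)" "x = f \<rho> ! j" by (auto simp: in_set_conv_nth)
      then show "x \<in> (\<lambda>(\<eta>, j). f \<eta> ! j) ` (tree r \<times> {..<n})"
        using \<rho>(1) B f[of \<rho>] by (intro image_eqI[of _ _ "(\<rho>, j)"]) (auto simp: tuples_iff)
    qed
    then have "|A| \<le>o |tree r \<times> {..<n}|"
      using card_of_mono1 card_of_image ordLeq_transitive by metis
    then show ?thesis using small ordLeq_ordLess_trans by blast
  qed
  moreover have "p \<subseteq> formulas_over L m A"
    unfolding p_def formulas_over_def A_def using \<phi> f B by (auto simp: tuples_iff lists_eq_set subset_iff)
  moreover have "consistent M m p" unfolding consistent_def
  proof (intro allI impI)
    fix q assume q: "q \<subseteq> p" "finite q"
    obtain Z where Z: "Z \<subseteq> B" "finite Z" "q = (\<lambda>\<rho>. (\<phi>, f \<rho>)) ` Z"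
      using finite_subset_image[OF q(2) q(1)[unfolded p_def]] by blast
    have same: "\<rho> = \<rho>'" if "\<rho> \<in> B" "\<rho>' \<in> B" "\<rho> \<subseteq>\<^sub>m \<rho>'" for \<rho> \<rho>'
      using that unfolding B_def map_le_def by (intro map_le_antisym) (auto simp: map_le_def)
    have inc: "incomparable \<eta> \<nu>" if h: "\<eta> \<in> Z" "\<nu> \<in> Z" "\<eta> \<noteq> \<nu>" for \<eta> \<nu>
      using same[of \<eta> \<nu>] same[of \<nu> \<eta>] h Z(1) unfolding incomparable_def by blast
    have "consistent_on M m \<phi> f Z"
      by (rule cons[rule_format, OF Z(2)]) (use Z(1) B inc in blast)+
    then show "\<exists>b\<in>tuples M m. realizes M b q" unfolding consistent_on_def realizes_def Z(3) by auto
  qed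
  ultimately obtain b where b: "b \<in> tuples M m" "realizes M b p" using sat unfolding saturated_def by blast
  have bl: "b \<in> lists (univ M)" "length b = m" using b(1) by (simp_all add: tuples_def)
  obtain \<rho> b' where \<rho>: "dom \<rho> = underS r a" and b': "b' \<in> tuples M m"
    and ind: "indiscernible_seq L M r (\<lambda>i. f (concat_node r \<rho> (zeros r i))) (set b')"
    and tp: "tp L M b (set (f \<rho>)) = tp L M b' (set (f \<rho>))"
    using real[OF si bl(1)] bl(2) by metis
  have "\<rho> \<in> B" using \<rho> by (simp add: B_def)
  then have "\<rho> \<in> tree r" using B by blast
  then have len: "length (f \<rho>) = n" "length b' = m" using f b' by (simp_all add: tuples_iff)
  have "holds M \<phi> (b @ f \<rho>)" using b(2) \<open>\<rho> \<in> B\<close> unfolding realizes_def p_def by auto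
  then have "(\<phi>, f \<rho>) \<in> tp L M b (set (f \<rho>))"
    unfolding tp_def formulas_over_def using \<phi> bl(2) len by (auto simp: lists_eq_set)
  then have h0: "holds M \<phi> (b' @ f \<rho>)" unfolding tp by (simp add: tp_def)
  have Fne: "Field r \<noteq> {}" using a by blast
  obtain z where z: "z \<in> Field r" "underS r z = {}" by (rule empty_node_tree[OF wo Fne])
  obtain w where w: "w \<in> Field r" "z \<noteq> w" "(z, w) \<in> r"
    using infinite_Card_order_limit[OF card z(1)] by blast
  \<comment> \<open>\<open>\<rho>\<close> is the member of the chain at the least index
    \<open>z\<close>, and \<open>\<rho>'\<close> the one at another index \<open>w\<close>.
    Indiscernibility over \<open>b'\<close> carries the formula from \<open>\<rho>\<close> to
    \<open>\<rho>'\<close>, a proper extension.\<close>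
  define \<rho>' where "\<rho>' = concat_node r \<rho> (zeros r w)"
  have \<rho>0: "concat_node r \<rho> (zeros r z) = \<rho>" by (rule concat_zeros_zero[OF card a \<rho> z])
  have \<rho>': "\<rho>' \<in> tree r" "\<rho> \<subseteq>\<^sub>m \<rho>'" "\<rho> \<noteq> \<rho>'"
    using concat_zeros_tree[OF card a \<rho> w(1)] concat_zeros_less[OF card a \<rho> w(3,2)]
    unfolding \<rho>'_def \<rho>0 by auto
  have len': "length (f \<rho>') = n" using f[OF \<rho>'(1)] by (simp add: tuples_iff)
  have same: "tp L M (f \<rho>) (set b') = tp L M (f \<rho>') (set b')"
    using ind[unfolded indiscernible_seq_def, rule_format, of "[z]" "[w]"] z(1) w(1)
    by (simp add: \<rho>0 \<rho>'_def)
  \<comment> \<open>Exchanges the two blocks of variables: in the type of \<open>f \<rho>\<close>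
    over \<open>b'\<close> the tuple \<open>b'\<close> comes last, in \<open>\<phi>\<close> it comes
    first.\<close>
  define s where "s k = (if k < m then n + k else k - m)" for k
  define \<theta> where "\<theta> = ren s \<phi>"
  have \<theta>: "\<theta> \<in> formulas L" "fv \<theta> \<subseteq> {..<n + m}"
    using \<phi> by (auto simp: \<theta>_def formulas_def wf_ren fv_ren s_def subset_iff)
  have swap: "holds M \<theta> (y @ b') = holds M \<phi> (b' @ y)" if "length y = n" for y
    unfolding holds_def \<theta>_def sat_ren
    by (rule sat_cong) (use \<phi>(2) len(2) that in \<open>auto simp: s_def nth_append subset_iff\<close>)
  have "(\<theta>, b') \<in> tp L M (f \<rho>) (set b')"
    unfolding tp_def formulas_over_def using \<theta> len h0 swap[OF len(1)] by (auto simp: lists_eq_set)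
  then have "holds M \<theta> (f \<rho>' @ b')" unfolding same by (simp add: tp_def)
  then have "holds M \<phi> (b' @ f \<rho>')" using swap[OF len'] by simp
  then have "consistent_on M m \<phi> f {\<rho>, \<rho>'}" unfolding consistent_on_def using h0 b' by auto
  then show False using incons \<open>\<rho> \<in> tree r\<close> \<rho>' by blast
qed

section \<open>Cardinal estimates and the equivalence\<close>

lemma finite_ordLeq_infinite:
  assumes "finite A" "infinite B"
  shows "|A| \<le>o |B|"
  using assms card_of_ordLeq_finite ordLeq_total[OF card_of_Well_order card_of_Well_order] by blast

lemma card_of_Times_finite_ordLeq:
  assumes "infinite B" "|A| \<le>o |B|" "finite C"
  shows "|A \<times> C| \<le>o |B|"
  by (rule card_of_Times_ordLeq_infinite_Field)
    (use assms finite_ordLeq_infinite card_of_card_order_on in \<open>simp_all add: Field_card_of\<close>)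

theorem theorem3p25:
  fixes L :: "('f, 'r) lang" and T :: "('f, 'r) fm set" and M :: "('f, 'r, 'm) struct"
    and \<kappa> :: "'k rel" and \<kappa>' :: "'o rel" and \<mu> :: "'l rel"
  assumes "complete_theory L T"
    and "Card_order \<kappa>" and "Card_order \<kappa>'"
    and "ctwo ^c |formulas L| <o \<kappa>" and "\<kappa> <o \<kappa>'"
    and "regularCard \<kappa>"
    and "Card_order \<mu>" and "|tree \<kappa>'| <o \<mu>" and "monster_model L T \<mu> M"
  shows "NATP L M \<longleftrightarrow>
    (\<forall>n a b. strongly_indiscernible L M \<kappa>' n a \<and> b \<in> lists (univ M) \<longrightarrow>
      (\<exists>\<rho>\<in>level \<kappa>' \<kappa>. \<exists>b'\<in>tuples M (length b).
         indiscernible_seq L M \<kappa>' (\<lambda>i. a (concat_node \<kappa>' \<rho> (zeros \<kappa>' i))) (set b') \<and>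
         tp L M b (set (a \<rho>)) = tp L M b' (set (a \<rho>))))"
proof -
  have sat: "saturated L M \<mu>" and ne: "univ M \<noteq> {}"
    using \<open>monster_model L T \<mu> M\<close> by (simp_all add: monster_model_def is_model_def is_struct_def)
  note card = \<open>Card_order \<kappa>'\<close> and card0 = \<open>Card_order \<kappa>\<close>
  have "inj (\<lambda>i. Eq (Var i) (Var i) :: ('f, 'r) fm)" by (auto intro: injI)
  moreover have "range (\<lambda>i. Eq (Var i) (Var i)) \<subseteq> formulas L" by (auto simp: formulas_def)
  ultimately have inf_fm: "infinite (formulas L)"
    using finite_subset range_inj_infinite by blast
  have "|formulas L| <o ctwo ^c |formulas L|" by (rule ordLess_ctwo_cexp[OF card_of_Card_order])
  then have fm_less: "|formulas L| <o \<kappa>" using \<open>ctwo ^c |formulas L| <o \<kappa>\<close> ordLess_transitive by blast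
  have "|formulas L| \<le>o |Field \<kappa>|"
    using fm_less card_of_Field_ordIso[OF card0] ordLess_imp_ordLeq ordLeq_ordIso_trans ordIso_symmetric by blast
  then have inf0: "infinite (Field \<kappa>)" using inf_fm card_of_ordLeq_infinite by blast
  have "|Field \<kappa>| \<le>o |Field \<kappa>'|" using \<open>\<kappa> <o \<kappa>'\<close> by (intro card_of_mono2 ordLess_imp_ordLeq)
  then have inf: "infinite (Field \<kappa>')" using inf0 card_of_ordLeq_infinite by blast
  have wo: "Well_order \<kappa>'" and wo0: "Well_order \<kappa>" using card card0 card_order_on_well_order_on by blast+
  \<comment> \<open>The ordinal \<kappa> as an element of \<kappa>'. Being a cardinal, regularity
    and size are carried over to the segment below \<open>a\<close>.\<close>
  obtain a where a: "a \<in> Field \<kappa>'" and iso: "\<kappa> =o Restr \<kappa>' (underS \<kappa>' a)"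
    using \<open>\<kappa> <o \<kappa>'\<close> ordLess_iff_ordIso_Restr[OF wo wo0] by blast
  let ?K = "Restr \<kappa>' (underS \<kappa>' a)"
  have K: "Card_order ?K" by (rule Card_order_ordIso2[OF card0 iso])
  have "Cinfinite \<kappa>" using card0 inf0 by (simp add: cinfinite_def)
  then have reg: "regularCard ?K" by (rule regularCard_ordIso[OF iso _ \<open>regularCard \<kappa>\<close>])
  have "|Field \<kappa>| =o |underS \<kappa>' a|"
    using card_of_cong[OF iso] by (simp add: Field_Restr_underS[OF wo])
  then have infK: "infinite (underS \<kappa>' a)" using inf0 card_of_ordIso_finite by blast
  have "|UNIV :: nat set| \<le>o |formulas L|" using inf_fm infinite_iff_card_of_nat by blast
  then have "|formulas L \<times> (UNIV :: nat set)| =o |formulas L|"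
    by (intro card_of_Times_infinite[OF inf_fm, THEN conjunct1]) auto
  then have fmK: "|formulas L \<times> (UNIV :: nat set)| <o ?K"
    using fm_less iso ordIso_ordLess_trans ordLess_ordIso_trans by blast
  \<comment> \<open>Sequences of zeros embed \<kappa>' into the tree. So the bound on the size of
    the tree also bounds the set of variables for a sequence of length \<kappa>'.\<close>
  have dom_zeros: "dom (zeros \<kappa>' i) = underS \<kappa>' i" for i by (auto simp: zeros_def dom_def)
  have "inj_on (zeros \<kappa>') (Field \<kappa>')"
  proof (rule inj_onI)
    fix i j assume ij: "i \<in> Field \<kappa>'" "j \<in> Field \<kappa>'" and "zeros \<kappa>' i = zeros \<kappa>' j"
    then have "dom (zeros \<kappa>' i) = dom (zeros \<kappa>' j)" by simp
    then have "underS \<kappa>' i = underS \<kappa>' j" by (simp add: dom_zeros)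
    then show "i = j" using underS_inj[OF wo] ij by blast
  qed
  moreover have "zeros \<kappa>' ` Field \<kappa>' \<subseteq> tree \<kappa>'" by (auto simp: tree_def dom_zeros)
  ultimately have FT: "|Field \<kappa>'| \<le>o |tree \<kappa>'|" using card_of_ordLeq by blast
  then have infT: "infinite (tree \<kappa>')" using inf card_of_ordLeq_infinite by blast
  have small: "|Inl ` {..<m} \<union> Inr ` (Field \<kappa>' \<times> {..<n}) :: (nat + 'o \<times> nat) set| <o \<mu>" for m n
  proof -
    have "|Inr ` (Field \<kappa>' \<times> {..<n}) :: (nat + 'o \<times> nat) set| \<le>o |tree \<kappa>'|"
      by (rule ordLeq_transitive[OF card_of_image card_of_Times_finite_ordLeq[OF infT FT finite_lessThan]])
    then have "|Inl ` {..<m} \<union> Inr ` (Field \<kappa>' \<times> {..<n}) :: (nat + 'o \<times> nat) set| \<le>o |tree \<kappa>'|"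
      by (intro card_of_Un_ordLeq_infinite_Field)
        (use infT finite_ordLeq_infinite[OF finite_imageI[OF finite_lessThan] infT] card_of_card_order_on in
          \<open>simp_all add: Field_card_of\<close>)
    then show ?thesis using \<open>|tree \<kappa>'| <o \<mu>\<close> ordLeq_ordLess_trans by blast
  qed
  have small': "|tree \<kappa>' \<times> {..<n}| <o \<mu>" for n :: nat
    using card_of_Times_finite_ordLeq[OF infT ordIso_imp_ordLeq[OF card_of_refl] finite_lessThan]
      \<open>|tree \<kappa>'| <o \<mu>\<close> by (rule ordLeq_ordLess_trans)
  \<comment> \<open>Different initial segments of a well-order have different order types, so the
    level is given by the single element \<open>a\<close>.\<close>
  have level: "\<rho> \<in> level \<kappa>' \<kappa> \<longleftrightarrow> dom \<rho> = underS \<kappa>' a" for \<rho>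
  proof
    assume "\<rho> \<in> level \<kappa>' \<kappa>"
    then obtain c where c: "c \<in> Field \<kappa>'" "dom \<rho> = underS \<kappa>' c" "Restr \<kappa>' (underS \<kappa>' c) =o \<kappa>"
      unfolding level_def tree_def by force
    then have "Restr \<kappa>' (underS \<kappa>' c) =o ?K" using iso ordIso_transitive by blast
    then have "c = a" using c(1) a segment_unique[OF card inf] by blast
    then show "dom \<rho> = underS \<kappa>' a" using c(2) by simp
  next
    assume "dom \<rho> = underS \<kappa>' a"
    then show "\<rho> \<in> level \<kappa>' \<kappa>" using a ordIso_symmetric[OF iso] by (auto simp: level_def tree_def)
  qed
  show ?thesis
  proof (intro iffI allI impI)
    fix n f b
    assume NATP: "NATP L M" and "strongly_indiscernible L M \<kappa>' n f \<and> b \<in> lists (univ M)"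
    then have si: "strongly_indiscernible L M \<kappa>' n f" and b: "b \<in> tuples M (length b)"
      by (simp_all add: tuples_def)
    show "\<exists>\<rho>\<in>level \<kappa>' \<kappa>. \<exists>b'\<in>tuples M (length b).
         indiscernible_seq L M \<kappa>' (\<lambda>i. f (concat_node \<kappa>' \<rho> (zeros \<kappa>' i))) (set b') \<and>
         tp L M b (set (f \<rho>)) = tp L M b' (set (f \<rho>))"
      by (rule NATP_imp_realization[OF card inf a K reg infK fmK sat ne small si b NATP])
        (use level in blast)
  next
    assume R: "\<forall>n a b. strongly_indiscernible L M \<kappa>' n a \<and> b \<in> lists (univ M) \<longrightarrow>
      (\<exists>\<rho>\<in>level \<kappa>' \<kappa>. \<exists>b'\<in>tuples M (length b).
         indiscernible_seq L M \<kappa>' (\<lambda>i. a (concat_node \<kappa>' \<rho> (zeros \<kappa>' i))) (set b') \<and>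
         tp L M b (set (a \<rho>)) = tp L M b' (set (a \<rho>)))"
    show "NATP L M"
    proof (rule realization_imp_NATP[OF card inf a sat ne small'])
      fix n f b assume "strongly_indiscernible L M \<kappa>' n f" "b \<in> lists (univ M)"
      then show "\<exists>\<rho> b'. dom \<rho> = underS \<kappa>' a \<and> b' \<in> tuples M (length b) \<and>
        indiscernible_seq L M \<kappa>' (\<lambda>i. f (concat_node \<kappa>' \<rho> (zeros \<kappa>' i))) (set b') \<and>
        tp L M b (set (f \<rho>)) = tp L M b' (set (f \<rho>))"
        using R[rule_format, OF conjI] unfolding Bex_def level by (simp only: ex_simps)
    qed
  qed
qed

end
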